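(* Let $1\le p\le\infty$, let $E$ be a Banach space and $X$ a Banach lattice. Suppose that $E^{***}$ has the approximation property or $X^{*}$ has the positive metric approximation property. If an operator $T:X\to E$ has a latticially $p$-nuclear adjoint $T^*:E^*\to X^*$, then $T$ is positively $p$-nuclear and $\widetilde\nu^{p}(T)=\widetilde\nu_{p}(T^{*})$.
   Context: All Banach spaces and Banach lattices are real; operators are bounded and linear. $p\in[1,\infty]$ and $p^{*}$ is the conjugate exponent. For a Banach lattice $X$, $X_+$ is the positive cone. For a Banach space $E$, $l_p(E)$ is the space of $p$-summable sequences with norm $\|(u_n)_n\|_p=(\sum_n\|u_n\|^p)^{1/p}$, and $l_p^w(E)$ is the space of weakly $p$-summable sequences with norm $\|(u_n)_n\|_p^w=\sup_{u^*\in B_{E^*}}(\sum_n|\langle u^*,u_n\rangle|^p)^{1/p}$ (usual modification for exponent $\infty$). $l_p^w(X)_+$ denotes the sequences in $l_p^w(X)$ with all terms in $X_+$. $u^*\otimes x$ is the operator $u\mapsto\langle u^*,u\rangle x$. Latticially $p$-nuclear: $S:E\to X$ (with $X$ a Banach lattice) is latticially $p$-nuclear if $S=\sum_{j=1}^\infty u_j^*\otimes x_j$ with $(u_j^* )_j\in l_p(E^* )$ and $(x_j)_j\in l^w_{p^*}(X)_+$; $\widetilde\nu_p(S)=\inf\|(u_j^* )_j\|_p\|(x_j)_j\|^w_{p^*}$ over all such representations. Positively $p$-nuclear: $T:X\to E$ is positively $p$-nuclear if $T=\sum_{j=1}^\infty x_j^*\otimes u_j$ with $(x_j^* )_j\in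 l^w_{p^*}(X^* )_+$ and $(u_j)_j\in l_p(E)$; $\widetilde\nu^p(T)=\inf\|(x_j^* )_j\|^w_{p^*}\|(u_j)_j\|_p$ over all such representations. $E$ has the approximation property if for every $\epsilon>0$ and compact $K\subset E$ there is a finite rank operator $S$ on $E$ with $\|Su-u\|<\epsilon$ for all $u\in K$. A Banach lattice $X$ has the positive metric approximation property if for every $\epsilon>0$ and compact $K\subset X$ there is a positive finite rank operator $R$ on $X$ with $\|R\|\le1$ and $\|Rx-x\|<\epsilon$ for all $x\in K$. *)

theory Defs
  imports "HOL-Analysis.Analysis" "HOL-Library.Lattice_Algebras" "HOL-Library.Extended_Real"
begin

section \<open>Banach lattices\<close>

class banach_lattice = banach + ordered_real_vector + lattice_ab_group_add +
  assumes norm_mono_modulus: "sup x (- x) \<le> sup y (- y) \<Longrightarrow> norm x \<le> norm y"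

instance real :: banach_lattice
  by standard (auto simp: sup_real_def max_def split: if_splits)

lemma norm_le_of_order_interval:
  fixes x y :: "'a::banach_lattice"
  assumes "- x \<le> y" "y \<le> x"
  shows "norm y \<le> norm x"
proof (rule norm_mono_modulus)
  have "- y \<le> x" using assms(1) by (simp add: minus_le_iff)
  then show "sup y (- y) \<le> sup x (- x)"
    using assms(2) by (simp add: le_supI1)
qed

lemma riesz_decomposition:
  fixes x x' y :: "'a::lattice_ab_group_add"
  assumes "0 \<le> x" "0 \<le> x'" "- (x + x') \<le> y" "y \<le> x + x'"
  obtains z where "- x \<le> z" "z \<le> x" "- x' \<le> y - z" "y - z \<le> x'"
proof
  let ?z = "sup (- x) (inf y x)"
  show "- x \<le> ?z" by simp
  have "- x \<le> 0" using assms(1) by simp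
  also have "0 \<le> x" by fact
  finally show "?z \<le> x" by simp
  have "- x \<le> y + x'" using assms(3) by (simp add: algebra_simps)
  moreover have "inf y x \<le> y + x'" using assms(2) by (meson add_increasing2 inf.cobounded1 order_trans order_refl)
  ultimately have "?z \<le> y + x'" by (rule le_supI)
  then have "?z - x' \<le> y" by (simp only: diff_le_eq)
  then show "- x' \<le> y - ?z"
    by (metis diff_le_eq le_diff_eq add.commute diff_conv_add_uminus)
  have "y - x' \<le> inf y x" using assms(2,4) by (simp add: algebra_simps add_increasing2)
  then have "y - x' \<le> ?z" by (rule le_supI2)
  then show "y - ?z \<le> x'" by (simp only: diff_le_eq add.commute)
qed

lemma norm_prts_le: "norm (pprt x + - nprt x) \<le> norm (x :: 'a::banach_lattice)"
  proof (rule norm_mono_modulus)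
    have eq: "pprt x + - nprt x = sup x (- x)"
    proof -
      have "pprt x + - nprt x = 2 *\<^sub>R pprt x - x"
        using prts[of x] by (simp add: scaleR_2 algebra_simps)
      also have "2 *\<^sub>R pprt x = sup (x + x) 0"
      proof -
        have "x + x \<le> sup (x + x) 0" "0 \<le> sup (x + x) 0" by simp_all
        show ?thesis
        proof (rule antisym)
          have h: "z \<le> (1/2) *\<^sub>R w" if "z + z \<le> w" for z w :: 'a
            using scaleR_left_mono[OF that, of "1/2"]
            by (simp add: scaleR_2[symmetric])
          have "pprt x \<le> (1/2) *\<^sub>R sup (x + x) 0"
            unfolding pprt_def by (intro sup_least h) auto
          from scaleR_left_mono[OF this, of 2]
          show "2 *\<^sub>R pprt x \<le> sup (x + x) 0" by simp
          show "sup (x + x) 0 \<le> 2 *\<^sub>R pprt x"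
            by (intro sup_least) (auto simp: scaleR_2 pprt_def intro!: add_mono add_nonneg_nonneg)
        qed
      qed
      also have "sup (x + x) 0 - x = sup x (- x)"
        using add_sup_distrib_right[of "x + x" 0 "- x"] by simp
      finally show ?thesis .
    qed
    have "0 \<le> pprt x + - nprt x" by (intro add_nonneg_nonneg zero_le_pprt) simp
    then have "- (pprt x + - nprt x) \<le> pprt x + - nprt x"
      by (meson neg_le_0_iff_le order_trans)
    then have "sup (pprt x + - nprt x) (- (pprt x + - nprt x)) \<le> pprt x + - nprt x"
      by (intro le_supI order_refl)
    then show "sup (pprt x + - nprt x) (- (pprt x + - nprt x)) \<le> sup x (- x)"
      by (simp only: eq)
  qed

lemma modulus_functional:
  fixes f :: "'a::banach_lattice \<Rightarrow>\<^sub>L real"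
  shows "\<exists>M :: 'a \<Rightarrow>\<^sub>L real. (\<forall>x\<ge>0. \<bar>blinfun_apply f x\<bar> \<le> blinfun_apply M x) \<and>
    (\<forall>N :: 'a \<Rightarrow>\<^sub>L real. (\<forall>x\<ge>0. \<bar>blinfun_apply f x\<bar> \<le> blinfun_apply N x) \<longrightarrow>
       (\<forall>x\<ge>0. blinfun_apply M x \<le> blinfun_apply N x)) \<and>
    norm M \<le> norm f"
proof -
  define I where "I x = blinfun_apply f ` {y. - x \<le> y \<and> y \<le> x}" for x
  define m where "m x = Sup (I x)" for x
  have bd: "f y \<le> norm f * norm x" if "- x \<le> y" "y \<le> x" for x y
  proof -
    have "f y \<le> norm f * norm y"
      using norm_blinfun[of f y] by simp
    also have "\<dots> \<le> norm f * norm x"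
      by (intro mult_left_mono norm_le_of_order_interval that) simp
    finally show ?thesis .
  qed
  have bdd: "bdd_above (I x)" for x
    unfolding I_def using bd by (intro bdd_aboveI[of _ "norm f * norm x"]) auto
  have upper: "f y \<le> m x" if "- x \<le> y" "y \<le> x" for x y
    unfolding m_def by (rule cSup_upper[OF _ bdd]) (auto simp: I_def that)
  have ne: "I x \<noteq> {}" if "0 \<le> x" for x
  proof -
    have "- x \<le> 0" using that by simp
    then show ?thesis unfolding I_def using that by blast
  qed
  have least: "m x \<le> c" if "0 \<le> x" "\<And>y. - x \<le> y \<Longrightarrow> y \<le> x \<Longrightarrow> f y \<le> c" for x c
    unfolding m_def by (rule cSup_least[OF ne]) (use that in \<open>auto simp: I_def\<close>)
  have m_norm: "m x \<le> norm f * norm x" if "0 \<le> x" for x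
    using least[OF that] bd by blast
  have m_nonneg: "0 \<le> m x" if "0 \<le> x" for x
    using upper[of x 0] that by simp
  have m_add: "m (x + x') = m x + m x'" if x: "0 \<le> x" "0 \<le> x'" for x x'
  proof (rule antisym)
    show "m (x + x') \<le> m x + m x'"
    proof (rule least)
      fix y assume "- (x + x') \<le> y" "y \<le> x + x'"
      then obtain z where "- x \<le> z" "z \<le> x" "- x' \<le> y - z" "y - z \<le> x'"
        using riesz_decomposition x by metis
      then have "f z \<le> m x" "f (y - z) \<le> m x'" using upper by blast+
      then show "f y \<le> m x + m x'" by (simp add: blinfun.diff_right)
    qed (use x in simp)
    have "f y + f y' \<le> m (x + x')"
      if "- x \<le> y" "y \<le> x" "- x' \<le> y'" "y' \<le> x'" for y y'
    proof -
      have "- (x + x') \<le> y + y'" "y + y' \<le> x + x'"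
        using add_mono[OF that(1,3)] add_mono[OF that(2,4)] by simp_all
      from upper[OF this] show ?thesis by (simp add: blinfun.add_right)
    qed
    then have "f y \<le> m (x + x') - f y'"
      if "- x \<le> y" "y \<le> x" "- x' \<le> y'" "y' \<le> x'" for y y'
      unfolding le_diff_eq using that by blast
    then have "m x \<le> m (x + x') - f y'" if "- x' \<le> y'" "y' \<le> x'" for y'
      using least[OF x(1)] that by blast
    then have "f y' \<le> m (x + x') - m x" if "- x' \<le> y'" "y' \<le> x'" for y'
      using that by (simp add: algebra_simps)
    then have "m x' \<le> m (x + x') - m x"
      using least[OF x(2)] by blast
    then show "m x + m x' \<le> m (x + x')" by simp
  qed
  have m_scale_le: "m (r *\<^sub>R x) \<le> r * m x" if "0 < r" "0 \<le> x" for r x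
  proof (rule least)
    show "0 \<le> r *\<^sub>R x" using that by (simp add: scaleR_nonneg_nonneg)
    fix y assume y: "- (r *\<^sub>R x) \<le> y" "y \<le> r *\<^sub>R x"
    have "- x \<le> inverse r *\<^sub>R y"
      using scaleR_left_mono[OF y(1), of "inverse r"] that by simp
    moreover have "inverse r *\<^sub>R y \<le> x"
      using scaleR_left_mono[OF y(2), of "inverse r"] that by simp
    ultimately have "f (inverse r *\<^sub>R y) \<le> m x" by (rule upper)
    then show "f y \<le> r * m x"
      using that by (simp add: blinfun.scaleR_right field_simps)
  qed
  have m_scale: "m (r *\<^sub>R x) = r * m x" if "0 < r" "0 \<le> x" for r x
  proof (rule antisym)
    show "m (r *\<^sub>R x) \<le> r * m x" using m_scale_le that .
    have "m (inverse r *\<^sub>R (r *\<^sub>R x)) \<le> inverse r * m (r *\<^sub>R x)"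
      using that by (intro m_scale_le) (auto simp: scaleR_nonneg_nonneg)
    then show "r * m x \<le> m (r *\<^sub>R x)"
      using that by (simp add: field_simps)
  qed
  have m_0: "m 0 = 0" using m_add[of 0 0] by simp

  define g where "g x = m (pprt x) - m (- nprt x)" for x
  have nn: "0 \<le> - nprt x" for x :: 'a by simp
  have g_diff: "g (a - b) = m a - m b" if "0 \<le> a" "0 \<le> b" for a b
  proof -
    have "pprt (a - b) + nprt (a - b) = a - b" using prts[of "a - b"] by simp
    then have "pprt (a - b) + b = a + - nprt (a - b)"
      by (simp add: algebra_simps)
    then have "m (pprt (a - b)) + m b = m a + m (- nprt (a - b))"
      using m_add[of "pprt (a - b)" b] m_add[of a "- nprt (a - b)"] that by simp
    then show ?thesis by (simp add: g_def)
  qed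
  have split: "x = pprt x - (- nprt x)" for x :: 'a using prts[of x] by simp
  have g_pos: "g x = m x" if "0 \<le> x" for x
    using g_diff[of x 0] that by (simp add: m_0)
  have g_add: "g (x + y) = g x + g y" for x y
  proof -
    have "x + y = (pprt x + pprt y) - (- nprt x + - nprt y)"
      using arg_cong2[of _ _ _ _ "(+)", OF split[of x] split[of y]]
      by (simp only: diff_conv_add_uminus minus_minus minus_add_distrib ac_simps)
    moreover have "g ((pprt x + pprt y) - (- nprt x + - nprt y))
        = m (pprt x + pprt y) - m (- nprt x + - nprt y)"
      by (intro g_diff add_nonneg_nonneg nn zero_le_pprt)
    ultimately show ?thesis
      using m_add[OF zero_le_pprt zero_le_pprt, of x y] m_add[OF nn nn, of x y]
      by (simp add: g_def)
  qed
  have g_minus: "g (- x) = - g x" for x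
    using g_add[of x "- x"] g_pos[of 0] m_0 by simp
  have g_scale_pos: "g (r *\<^sub>R x) = r * g x" if "0 < r" for r x
  proof -
    have "r *\<^sub>R x = r *\<^sub>R pprt x - r *\<^sub>R (- nprt x)"
      using split[of x] by (metis scaleR_right_diff_distrib)
    moreover have "g (r *\<^sub>R pprt x - r *\<^sub>R (- nprt x)) = m (r *\<^sub>R pprt x) - m (r *\<^sub>R (- nprt x))"
      using that by (intro g_diff scaleR_nonneg_nonneg nn zero_le_pprt) auto
    ultimately show ?thesis
      using m_scale[OF that zero_le_pprt, of x] m_scale[OF that nn, of x]
      by (simp add: g_def algebra_simps)
  qed
  have g_scale: "g (r *\<^sub>R x) = r * g x" for r x
  proof (cases r "0::real" rule: linorder_cases)
    case less
    then have "g ((- r) *\<^sub>R (- x)) = (- r) * g (- x)" by (intro g_scale_pos) simp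
    then show ?thesis by (simp add: g_minus)
  qed (use g_scale_pos g_pos[of 0] m_0 in auto)
  have g_bound: "\<bar>g x\<bar> \<le> norm f * norm x" for x
  proof -
    have "\<bar>g x\<bar> \<le> m (pprt x) + m (- nprt x)"
      using m_nonneg[OF zero_le_pprt, of x] m_nonneg[OF nn, of x] by (simp add: g_def)
    also have "\<dots> = m (pprt x + - nprt x)"
      by (rule m_add[symmetric]) (rule zero_le_pprt nn)+
    also have "\<dots> \<le> norm f * norm (pprt x + - nprt x)"
      by (intro m_norm add_nonneg_nonneg zero_le_pprt nn)
    also have "\<dots> \<le> norm f * norm x"
      by (intro mult_left_mono norm_prts_le) simp
    finally show ?thesis .
  qed
  have bl: "bounded_linear g"
    by (rule bounded_linear_intro[where K = "norm f"])
      (auto simp: g_add g_scale mult.commute[of _ "norm f"] g_bound)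
  have app: "blinfun_apply (Blinfun g) x = g x" for x
    by (simp add: bl bounded_linear_Blinfun_apply)
  show ?thesis
  proof (intro exI[of _ "Blinfun g"] conjI allI impI)
    fix x :: 'a assume x: "0 \<le> x"
    then have "- x \<le> x" by (meson neg_le_0_iff_le order_trans)
    then show "\<bar>f x\<bar> \<le> Blinfun g x"
      using upper[of x x] upper[of x "- x"] by (simp add: app g_pos x blinfun.minus_right abs_le_iff)
  next
    fix N :: "'a \<Rightarrow>\<^sub>L real" and x :: 'a
    assume "\<forall>x\<ge>0. \<bar>f x\<bar> \<le> N x" and x: "0 \<le> x"
    then have N: "\<bar>f z\<bar> \<le> N z" if "0 \<le> z" for z using that by blast
    have "m x \<le> N x"
    proof (rule least[OF x])
      fix y assume y: "- x \<le> y" "y \<le> x"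
      have half: "0 \<le> (1/2) *\<^sub>R (x + y)" "0 \<le> (1/2) *\<^sub>R (x - y)"
        using diff_right_mono[OF y(1), of "- x"] diff_right_mono[OF y(2), of y]
        by (simp_all add: scaleR_nonneg_nonneg add.commute)
      have x_eq: "(1/2) *\<^sub>R (x + y) + (1/2) *\<^sub>R (x - y) = x"
      proof -
        have "(x + y) + (x - y) = x + x" by (simp only: diff_conv_add_uminus ac_simps) simp
        then have "(1/2) *\<^sub>R ((x + y) + (x - y)) = (1/2) *\<^sub>R (2 *\<^sub>R x)"
          by (simp only: scaleR_2)
        also have "\<dots> = x" by simp
        finally show ?thesis by (simp only: scaleR_right_distrib)
      qed
      have "(x + y) - (x - y) = 2 *\<^sub>R y" by (simp add: scaleR_2)
      then have "(1/2) *\<^sub>R (x + y) - (1/2) *\<^sub>R (x - y) = y"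
        by (simp flip: scaleR_right_diff_distrib)
      then have "f y = f ((1/2) *\<^sub>R (x + y)) - f ((1/2) *\<^sub>R (x - y))"
        by (metis blinfun.diff_right)
      also have "\<dots> \<le> N ((1/2) *\<^sub>R (x + y)) + N ((1/2) *\<^sub>R (x - y))"
        using N[OF half(1)] N[OF half(2)] by linarith
      also have "\<dots> = N x"
        by (simp only: x_eq flip: blinfun.add_right)
      finally show "f y \<le> N x" .
    qed
    then show "Blinfun g x \<le> N x" by (simp add: app g_pos x)
  next
    show "norm (Blinfun g) \<le> norm f"
      by (rule norm_blinfun_bound) (auto simp: app g_bound)
  qed
qed

text \<open>A totally ordered Banach lattice embeds isometrically and order-isomorphically into \<open>\<real>\<close>.\<close>

lemma linorder_banach_lattice_real:
  obtains \<phi> :: "'b::{banach_lattice, linorder} \<Rightarrow>\<^sub>L real" and \<psi> :: "real \<Rightarrow>\<^sub>L 'b" where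
    "\<And>y. \<psi> (\<phi> y) = y" "\<And>y. \<bar>\<phi> y\<bar> = norm y" "\<And>y. 0 \<le> y \<longleftrightarrow> 0 \<le> \<phi> y"
    "\<And>r. 0 \<le> r \<Longrightarrow> 0 \<le> \<psi> r" "\<And>r. norm (\<psi> r) \<le> \<bar>r\<bar>"
proof (cases "\<exists>e::'b. e \<noteq> 0")
  case False
  then have z: "y = 0 \<longleftrightarrow> True" "(0 \<le> y) \<longleftrightarrow> True" for y :: 'b by (auto intro: eq_refl)
  show ?thesis
    by (rule that[of 0 0]) (simp_all add: z)
next
  case True
  then obtain e0 :: 'b where "e0 \<noteq> 0" by blast
  then obtain e1 :: 'b where e1: "0 < e1"
    by (metis linorder_less_linear neg_0_less_iff_less)
  define e where "e = (1 / norm e1) *\<^sub>R e1"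
  have e_norm: "norm e = 1" using e1 by (simp add: e_def)
  have e_nn: "0 \<le> e" using e1 by (simp add: e_def scaleR_nonneg_nonneg)
  have mono: "norm x \<le> norm y" if "0 \<le> x" "x \<le> y" for x y :: 'b
    using norm_le_of_order_interval[of y x] that
    by (meson neg_le_0_iff_le order_trans)
  have pos: "y = norm y *\<^sub>R e" if y: "0 \<le> y" for y :: 'b
  proof -
    have "norm (y - norm y *\<^sub>R e) \<le> d" if d: "0 < d" for d
    proof -
      have up: "y \<le> (norm y + d) *\<^sub>R e"
      proof (rule ccontr)
        assume "\<not> ?thesis"
        then have "norm ((norm y + d) *\<^sub>R e) \<le> norm y"
          using e_nn d by (intro mono) (auto intro!: scaleR_nonneg_nonneg)
        then show False using d e_norm by simp
      qed
      have lo: "(norm y - d) *\<^sub>R e \<le> y"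
      proof (rule ccontr)
        assume a: "\<not> ?thesis"
        then have "y < (norm y - d) *\<^sub>R e" by simp
        with y have "norm y \<le> norm ((norm y - d) *\<^sub>R e)" by (intro mono) auto
        then have "norm y \<le> \<bar>norm y - d\<bar>" using e_norm by simp
        then have "norm y - d < 0" using d by auto
        then have "(norm y - d) *\<^sub>R e \<le> 0" using e_nn by (simp add: scaleR_nonpos_nonneg)
        with y have "(norm y - d) *\<^sub>R e \<le> y" by (rule order_trans[rotated])
        with a show False by simp
      qed
      have "norm (y - norm y *\<^sub>R e) \<le> norm (d *\<^sub>R e)"
        by (rule norm_le_of_order_interval) (use up lo in \<open>auto simp: algebra_simps\<close>)
      then show ?thesis using d e_norm by simp
    qed
    then have "norm (y - norm y *\<^sub>R e) \<le> 0" by (rule dense_ge)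
    then show ?thesis by simp
  qed
  have "\<exists>c. y = c *\<^sub>R e" for y :: 'b
  proof (cases "0 \<le> y")
    case True then show ?thesis using pos by blast
  next
    case False
    then have "0 \<le> - y" by simp
    then have "y = (- norm y) *\<^sub>R e" using pos[of "- y"] by (metis minus_minus norm_minus_cancel scaleR_minus_left)
    then show ?thesis by blast
  qed
  then obtain c where c: "y = c y *\<^sub>R e" for y :: 'b by metis
  have e0: "e \<noteq> 0" using e_norm by auto
  have uniq: "c (r *\<^sub>R e) = r" for r
    using c[of "r *\<^sub>R e"] e0 by simp
  have c_add: "c (x + y) = c x + c y" for x y
    by (metis c scaleR_left_distrib uniq)
  have c_scale: "c (r *\<^sub>R x) = r * c x" for r x
    by (metis c scaleR_scaleR uniq)
  have c_norm: "\<bar>c y\<bar> = norm y" for y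
    using c[of y] e_norm by (metis mult.right_neutral norm_scaleR)
  have bl: "bounded_linear c"
    by (rule bounded_linear_intro[where K = 1]) (auto simp: c_add c_scale c_norm)
  have nn: "0 \<le> r *\<^sub>R e \<longleftrightarrow> 0 \<le> r" for r
  proof
    assume a: "0 \<le> r *\<^sub>R e"
    show "0 \<le> r"
    proof (rule ccontr)
      assume "\<not> 0 \<le> r"
      then have "r *\<^sub>R e \<le> 0" "r *\<^sub>R e \<noteq> 0" using e_nn e0 by (auto simp: scaleR_nonpos_nonneg)
      with a show False by simp
    qed
  qed (use e_nn in \<open>simp add: scaleR_nonneg_nonneg\<close>)
  have bl2: "bounded_linear (\<lambda>r. r *\<^sub>R e)" by (rule bounded_linear_scaleR_left)
  show ?thesis
  proof (rule that[of "Blinfun (\<lambda>r. r *\<^sub>R e)" "Blinfun c"])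
    show "0 \<le> y \<longleftrightarrow> 0 \<le> Blinfun c y" for y
      using nn[of "c y"] c[of y] by (simp add: bounded_linear_Blinfun_apply bl)
  qed (simp_all add: bounded_linear_Blinfun_apply bl bl2 c[symmetric] c_norm nn e_norm)
qed

lemma modulus_blinfun:
  fixes f :: "'a::banach_lattice \<Rightarrow>\<^sub>L 'b::{banach_lattice, linorder}"
  shows "\<exists>M :: 'a \<Rightarrow>\<^sub>L 'b. (\<forall>x\<ge>0. blinfun_apply f x \<le> blinfun_apply M x) \<and> (\<forall>x\<ge>0. - blinfun_apply f x \<le> blinfun_apply M x) \<and>
    (\<forall>N :: 'a \<Rightarrow>\<^sub>L 'b. (\<forall>x\<ge>0. blinfun_apply f x \<le> blinfun_apply N x) \<and> (\<forall>x\<ge>0. - blinfun_apply f x \<le> blinfun_apply N x) \<longrightarrow> (\<forall>x\<ge>0. blinfun_apply M x \<le> blinfun_apply N x)) \<and>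
    norm M \<le> norm f"
proof -
  obtain \<phi> :: "'b \<Rightarrow>\<^sub>L real" and \<psi> :: "real \<Rightarrow>\<^sub>L 'b" where
    iso: "\<And>y. \<psi> (\<phi> y) = y" "\<And>y. \<bar>\<phi> y\<bar> = norm y" "\<And>y. 0 \<le> y \<longleftrightarrow> 0 \<le> \<phi> y"
    "\<And>r. 0 \<le> r \<Longrightarrow> 0 \<le> \<psi> r" "\<And>r. norm (\<psi> r) \<le> \<bar>r\<bar>"
    by (rule linorder_banach_lattice_real) (rule that; assumption)
  have le1: "x \<le> \<psi> r" if "\<phi> x \<le> r" for x r
    using iso(4)[of "r - \<phi> x"] that by (simp add: blinfun.diff_right iso(1))
  have le2: "\<psi> r \<le> x" if "r \<le> \<phi> x" for x r
    using iso(4)[of "\<phi> x - r"] that by (simp add: blinfun.diff_right iso(1))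
  have le3: "\<phi> x \<le> \<phi> y" if "x \<le> y" for x y
    using iso(3)[of "y - x"] that by (simp add: blinfun.diff_right)
  obtain M :: "'a \<Rightarrow>\<^sub>L real" where M: "\<forall>x\<ge>0. \<bar>(\<phi> o\<^sub>L f) x\<bar> \<le> M x"
    "\<forall>N :: 'a \<Rightarrow>\<^sub>L real. (\<forall>x\<ge>0. \<bar>(\<phi> o\<^sub>L f) x\<bar> \<le> N x) \<longrightarrow> (\<forall>x\<ge>0. M x \<le> N x)"
    "norm M \<le> norm (\<phi> o\<^sub>L f)"
    using modulus_functional[of "\<phi> o\<^sub>L f"] by blast
  have M1: "\<bar>\<phi> (f x)\<bar> \<le> M x" if "0 \<le> x" for x
    using M(1) that by simp
  have nf: "norm (\<phi> o\<^sub>L f) \<le> norm f"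
    by (rule norm_blinfun_bound) (auto simp: iso(2) norm_blinfun)
  show ?thesis
  proof (intro exI[of _ "\<psi> o\<^sub>L M"] conjI allI impI)
    fix x :: 'a assume x: "0 \<le> x"
    show "f x \<le> (\<psi> o\<^sub>L M) x" using M1[OF x] by (auto intro!: le1)
    show "- f x \<le> (\<psi> o\<^sub>L M) x" using M1[OF x] by (auto intro!: le1 simp: blinfun.minus_right)
  next
    fix N :: "'a \<Rightarrow>\<^sub>L 'b" and x :: 'a
    assume N: "(\<forall>x\<ge>0. f x \<le> N x) \<and> (\<forall>x\<ge>0. - f x \<le> N x)" and x: "0 \<le> x"
    have "\<bar>(\<phi> o\<^sub>L f) z\<bar> \<le> (\<phi> o\<^sub>L N) z" if "0 \<le> z" for z
    proof -
      have "\<phi> (f z) \<le> \<phi> (N z)" "\<phi> (- f z) \<le> \<phi> (N z)"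
        using N that by (auto intro: le3)
      then show ?thesis by (simp add: abs_le_iff blinfun.minus_right)
    qed
    then have "M x \<le> (\<phi> o\<^sub>L N) x" using M(2) x by blast
    then show "(\<psi> o\<^sub>L M) x \<le> N x" by (auto intro!: le2)
  next
    show "norm (\<psi> o\<^sub>L M) \<le> norm f"
    proof (rule norm_blinfun_bound)
      fix x
      have "norm ((\<psi> o\<^sub>L M) x) \<le> \<bar>M x\<bar>" by (simp add: iso(5))
      also have "\<dots> \<le> norm M * norm x" using norm_blinfun[of M x] by simp
      also have "\<dots> \<le> norm f * norm x"
        using M(3) nf by (intro mult_right_mono) auto
      finally show "norm ((\<psi> o\<^sub>L M) x) \<le> norm f * norm x" .
    qed simp
  qed
qed

text \<open>
  The dual of a Banach lattice, ordered by the dual cone. Class instances cannot mention the type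
  \<^typ>\<open>real\<close> as an argument of \<^typ>\<open>('a, 'b) blinfun\<close>, so the codomain is described
  by the sort of totally ordered Banach lattices, which are (up to isomorphism) only \<open>\<real>\<close> and \<open>{0}\<close>.
\<close>

instantiation blinfun :: (banach_lattice, "{banach_lattice, linorder}") banach_lattice
begin

definition less_eq_blinfun :: "'a \<Rightarrow>\<^sub>L 'b \<Rightarrow> 'a \<Rightarrow>\<^sub>L 'b \<Rightarrow> bool" where
  "less_eq_blinfun f g \<longleftrightarrow> (\<forall>x\<ge>0. f x \<le> g x)"

definition less_blinfun :: "'a \<Rightarrow>\<^sub>L 'b \<Rightarrow> 'a \<Rightarrow>\<^sub>L 'b \<Rightarrow> bool" where
  "less_blinfun f g \<longleftrightarrow> f \<le> g \<and> \<not> g \<le> f"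

definition sup_blinfun :: "'a \<Rightarrow>\<^sub>L 'b \<Rightarrow> 'a \<Rightarrow>\<^sub>L 'b \<Rightarrow> 'a \<Rightarrow>\<^sub>L 'b" where
  "sup_blinfun f g = (THE h. f \<le> h \<and> g \<le> h \<and> (\<forall>k. f \<le> k \<and> g \<le> k \<longrightarrow> h \<le> k))"

definition inf_blinfun :: "'a \<Rightarrow>\<^sub>L 'b \<Rightarrow> 'a \<Rightarrow>\<^sub>L 'b \<Rightarrow> 'a \<Rightarrow>\<^sub>L 'b" where
  "inf_blinfun f g = - sup (- f) (- g)"

instance
proof -
  have antisym: "f = g" if "f \<le> g" "g \<le> f" for f g :: "'a \<Rightarrow>\<^sub>L 'b"
  proof (rule blinfun_eqI)
    fix x :: 'a
    have eq: "f z = g z" if "0 \<le> z" for z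
      using that \<open>f \<le> g\<close> \<open>g \<le> f\<close> by (simp add: less_eq_blinfun_def antisym)
    have "0 \<le> - nprt x" by simp
    then have "f (- nprt x) = g (- nprt x)" by (rule eq)
    then have "f (pprt x) = g (pprt x)" "f (nprt x) = g (nprt x)"
      by (auto simp: eq blinfun.minus_right)
    then show "f x = g x" by (metis prts blinfun.add_right)
  qed
  have refl: "f \<le> f" for f :: "'a \<Rightarrow>\<^sub>L 'b" by (simp add: less_eq_blinfun_def)
  have trans: "f \<le> h" if "f \<le> g" "g \<le> h" for f g h :: "'a \<Rightarrow>\<^sub>L 'b"
    using that by (meson less_eq_blinfun_def order_trans)
  have add: "h + f \<le> h + g" if "f \<le> g" for f g h :: "'a \<Rightarrow>\<^sub>L 'b"
    using that by (simp add: less_eq_blinfun_def blinfun.add_left)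
  have scale: "r *\<^sub>R f \<le> r *\<^sub>R g" if "f \<le> g" "0 \<le> r" for r and f g :: "'a \<Rightarrow>\<^sub>L 'b"
    using that by (simp add: less_eq_blinfun_def blinfun.scaleR_left scaleR_left_mono)
  have scale': "r *\<^sub>R f \<le> s *\<^sub>R f" if "r \<le> s" "0 \<le> f" for r s and f :: "'a \<Rightarrow>\<^sub>L 'b"
    using that by (simp add: less_eq_blinfun_def blinfun.scaleR_left scaleR_right_mono)
  have neg: "- g \<le> - f" if "f \<le> g" for f g :: "'a \<Rightarrow>\<^sub>L 'b"
    using that by (simp add: less_eq_blinfun_def blinfun.minus_left)
  have neg': "- g \<le> f" if "- f \<le> g" for f g :: "'a \<Rightarrow>\<^sub>L 'b"
    using neg[OF that] by simp
  have mod_ex: "\<exists>M. f \<le> M \<and> - f \<le> M \<and> (\<forall>k. f \<le> k \<and> - f \<le> k \<longrightarrow> M \<le> k) \<and> norm M \<le> norm f"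
    for f :: "'a \<Rightarrow>\<^sub>L 'b"
    unfolding less_eq_blinfun_def uminus_blinfun.rep_eq by (rule modulus_blinfun)
  have sup_eq: "sup f g = h" if "f \<le> h" "g \<le> h" "\<And>k. f \<le> k \<Longrightarrow> g \<le> k \<Longrightarrow> h \<le> k"
    for f g h :: "'a \<Rightarrow>\<^sub>L 'b"
    unfolding sup_blinfun_def using that by (intro the_equality) (auto intro: antisym)
  have sup_ex: "\<exists>h. f \<le> h \<and> g \<le> h \<and> (\<forall>k. f \<le> k \<and> g \<le> k \<longrightarrow> h \<le> k)" for f g :: "'a \<Rightarrow>\<^sub>L 'b"
  proof -
    obtain M :: "'a \<Rightarrow>\<^sub>L 'b" where M: "f - g \<le> M" "- (f - g) \<le> M"
      "\<And>k. f - g \<le> k \<Longrightarrow> - (f - g) \<le> k \<Longrightarrow> M \<le> k"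
      using mod_ex[of "f - g"] by blast
    have two: "(1/2) *\<^sub>R (h + h) = h" for h :: "'a \<Rightarrow>\<^sub>L 'b"
      by (simp flip: scaleR_2)
    define h where "h = (1/2) *\<^sub>R (f + g + M)"
    have "f \<le> h"
    proof -
      have "f + f \<le> f + g + M" using add[OF M(1), of "f + g"] by simp
      from scale[OF this, of "1/2"] show ?thesis by (simp only: h_def two)
    qed
    moreover have "g \<le> h"
    proof -
      have "g + g \<le> f + g + M" using add[OF M(2), of "f + g"] by simp
      from scale[OF this, of "1/2"] show ?thesis by (simp only: h_def two)
    qed
    moreover have "h \<le> k" if k: "f \<le> k" "g \<le> k" for k
    proof -
      have fg: "f + g \<le> k + k" "f + f \<le> k + k" "g + g \<le> k + k"
        using k by (auto simp: less_eq_blinfun_def blinfun.add_left intro: add_mono)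
      have "M \<le> k + k - (f + g)"
        using add[OF fg(2), of "- (f + g)"] add[OF fg(3), of "- (f + g)"]
        by (intro M(3)) (auto simp: algebra_simps)
      from add[OF this, of "f + g"] have "f + g + M \<le> k + k" by simp
      from scale[OF this, of "1/2"] show ?thesis by (simp only: h_def two)
    qed
    ultimately show ?thesis by blast
  qed
  have sup: "f \<le> sup f g" "g \<le> sup f g" "f \<le> k \<Longrightarrow> g \<le> k \<Longrightarrow> sup f g \<le> k"
    for f g k :: "'a \<Rightarrow>\<^sub>L 'b"
  proof -
    obtain h where h: "f \<le> h" "g \<le> h" "\<And>k. f \<le> k \<Longrightarrow> g \<le> k \<Longrightarrow> h \<le> k"
      using sup_ex[of f g] by blast
    from sup_eq[OF h] have "sup f g = h" by blast
    with h show "f \<le> sup f g" "g \<le> sup f g" "f \<le> k \<Longrightarrow> g \<le> k \<Longrightarrow> sup f g \<le> k"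
      by auto
  qed
  have norm_sup: "norm (sup f (- f)) = norm f" for f :: "'a \<Rightarrow>\<^sub>L 'b"
  proof (rule order.antisym)
    obtain M :: "'a \<Rightarrow>\<^sub>L 'b" where M: "f \<le> M" "- f \<le> M" "\<And>k. f \<le> k \<Longrightarrow> - f \<le> k \<Longrightarrow> M \<le> k" "norm M \<le> norm f"
      using mod_ex[of f] by blast
    then have eq: "sup f (- f) = M" by (intro sup_eq) auto
    with M show "norm (sup f (- f)) \<le> norm f" by simp
    show "norm f \<le> norm (sup f (- f))"
    proof (rule norm_blinfun_bound)
      fix x :: 'a
      have nn: "0 \<le> - nprt x" by simp
      have M': "f z \<le> M z" "- f z \<le> M z" if "0 \<le> z" for z
        using M(1,2) that by (auto simp: less_eq_blinfun_def blinfun.minus_left)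
      let ?a = "pprt x + - nprt x"
      have fx: "f x = f (pprt x) + - f (- nprt x)"
        by (metis prts blinfun.add_right blinfun.minus_right minus_minus)
      have "f x \<le> M ?a"
        unfolding fx blinfun.add_right by (intro add_mono M' nn zero_le_pprt)
      moreover have "- f x \<le> M ?a"
      proof -
        have "- f x = - f (pprt x) + f (- nprt x)" using fx by simp
        also have "\<dots> \<le> M ?a"
          unfolding blinfun.add_right by (intro add_mono M' nn zero_le_pprt)
        finally show ?thesis .
      qed
      ultimately have "norm (f x) \<le> norm (M ?a)"
        by (intro norm_le_of_order_interval) (simp_all add: minus_le_iff)
      also have "\<dots> \<le> norm M * norm ?a" by (rule norm_blinfun)
      also have "norm ?a \<le> norm x" by (rule norm_prts_le)
      finally show "norm (f x) \<le> norm (sup f (- f)) * norm x"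
        by (simp add: eq mult_left_mono)
    qed simp
  qed
  have norm_mono: "norm f \<le> norm g" if "0 \<le> f" "f \<le> g" for f g :: "'a \<Rightarrow>\<^sub>L 'b"
  proof (rule norm_blinfun_bound)
    fix x :: 'a
    have nn: "0 \<le> - nprt x" by simp
    let ?a = "pprt x + - nprt x"
    have f0: "0 \<le> f z" if "0 \<le> z" for z
      using \<open>0 \<le> f\<close> that by (simp add: less_eq_blinfun_def)
    have fg: "f z \<le> g z" if "0 \<le> z" for z
      using \<open>f \<le> g\<close> that by (simp add: less_eq_blinfun_def)
    have a: "0 \<le> ?a" by (intro add_nonneg_nonneg nn zero_le_pprt)
    have fx: "f x = f (pprt x) + - f (- nprt x)"
      by (metis prts blinfun.add_right blinfun.minus_right minus_minus)
    have m: "- f z \<le> f z" if "0 \<le> z" for z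
      using f0[OF that] by (meson neg_le_0_iff_le order_trans)
    have "f x \<le> f ?a"
      unfolding fx blinfun.add_right by (intro add_mono m nn order_refl)
    moreover have "- f x \<le> f ?a"
    proof -
      have "- f x = - f (pprt x) + f (- nprt x)" using fx by simp
      also have "\<dots> \<le> f ?a"
        unfolding blinfun.add_right by (intro add_mono m zero_le_pprt order_refl)
      finally show ?thesis .
    qed
    ultimately have "f x \<le> g ?a" "- f x \<le> g ?a" using fg[OF a] by (auto intro: order_trans)
    then have "norm (f x) \<le> norm (g ?a)"
      by (intro norm_le_of_order_interval) (simp_all add: minus_le_iff)
    also have "\<dots> \<le> norm g * norm ?a" by (rule norm_blinfun)
    also have "norm ?a \<le> norm x" by (rule norm_prts_le)
    finally show "norm (f x) \<le> norm g * norm x" by (simp add: mult_left_mono)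
  qed simp
  show "OFCLASS('a \<Rightarrow>\<^sub>L 'b, banach_lattice_class)"
  proof
    fix f g h :: "'a \<Rightarrow>\<^sub>L 'b" and r s :: real
    show "(f < g) = (f \<le> g \<and> \<not> g \<le> f)" by (rule less_blinfun_def)
    show "f \<le> f" by (rule refl)
    show "f \<le> g \<Longrightarrow> g \<le> h \<Longrightarrow> f \<le> h" by (rule trans)
    show "f \<le> g \<Longrightarrow> g \<le> f \<Longrightarrow> f = g" by (rule antisym)
    show "f \<le> g \<Longrightarrow> h + f \<le> h + g" by (rule add)
    show "f \<le> g \<Longrightarrow> 0 \<le> r \<Longrightarrow> r *\<^sub>R f \<le> r *\<^sub>R g" by (rule scale)
    show "r \<le> s \<Longrightarrow> 0 \<le> f \<Longrightarrow> r *\<^sub>R f \<le> s *\<^sub>R f" by (rule scale')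
    show "f \<le> sup f g" "g \<le> sup f g" by (rule sup)+
    show "g \<le> f \<Longrightarrow> h \<le> f \<Longrightarrow> sup g h \<le> f" by (rule sup)
    show "inf f g \<le> f" "inf f g \<le> g" unfolding inf_blinfun_def by (rule neg', rule sup)+
    show "f \<le> g \<Longrightarrow> f \<le> h \<Longrightarrow> f \<le> inf g h"
      unfolding inf_blinfun_def using neg[OF sup(3)[OF neg neg, of f g h]] by simp
    show "norm f \<le> norm g" if le: "sup f (- f) \<le> sup g (- g)"
    proof -
      have "0 \<le> sup f (- f)"
      proof -
        have "0 \<le> sup f (- f) + sup f (- f)"
          unfolding less_eq_blinfun_def
        proof (intro allI impI)
          fix x :: 'a assume "0 \<le> x"
          then have "f x \<le> sup f (- f) x" "- f x \<le> sup f (- f) x"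
            using sup(1)[of f "- f"] sup(2)[of "- f" f]
            by (simp_all add: less_eq_blinfun_def blinfun.minus_left)
          from add_mono[OF this] show "blinfun_apply 0 x \<le> (sup f (- f) + sup f (- f)) x"
            by (simp add: blinfun.add_left)
        qed
        from scale[OF this, of "1/2"] show ?thesis by (simp flip: scaleR_2)
      qed
      from norm_mono[OF this le] show ?thesis by (simp only: norm_sup)
    qed
  qed
qed

end

lemma positive_functional_iff:
  fixes f :: "'a::banach_lattice \<Rightarrow>\<^sub>L real"
  shows "0 \<le> f \<longleftrightarrow> (\<forall>x\<ge>0. 0 \<le> f x)"
  by (simp add: less_eq_blinfun_def)


section \<open>Strongly and weakly \<open>p\<close>-summable sequences\<close>

definition conj_exponent :: "ereal \<Rightarrow> ereal" where
  "conj_exponent p = (if p = 1 then \<infinity> else if p = \<infinity> then 1 else p / (p - 1))"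

definition lp_space :: "ereal \<Rightarrow> (nat \<Rightarrow> 'a::real_normed_vector) set" where
  "lp_space p = {u. if p = \<infinity> then bounded (range u)
                    else summable (\<lambda>n. norm (u n) powr real_of_ereal p)}"

definition lp_norm :: "ereal \<Rightarrow> (nat \<Rightarrow> 'a::real_normed_vector) \<Rightarrow> real" where
  "lp_norm p u = (if p = \<infinity> then (SUP n. norm (u n))
                  else (\<Sum>n. norm (u n) powr real_of_ereal p) powr (1 / real_of_ereal p))"

definition weak_lp_space :: "ereal \<Rightarrow> (nat \<Rightarrow> 'a::real_normed_vector) set" where
  "weak_lp_space p = {u. \<forall>f :: 'a \<Rightarrow>\<^sub>L real. (\<lambda>n. f (u n)) \<in> lp_space p}"

text \<open>The supremum is finite on \<open>weak_lp_space p\<close> by the uniform boundedness principle.\<close>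

definition weak_lp_norm :: "ereal \<Rightarrow> (nat \<Rightarrow> 'a::real_normed_vector) \<Rightarrow> real" where
  "weak_lp_norm p u = (SUP f \<in> cball (0 :: 'a \<Rightarrow>\<^sub>L real) 1. lp_norm p (\<lambda>n. blinfun_apply f (u n)))"


section \<open>Operators\<close>

definition rank_one :: "('a::real_normed_vector \<Rightarrow>\<^sub>L real) \<Rightarrow> 'b::real_normed_vector \<Rightarrow> 'a \<Rightarrow>\<^sub>L 'b" where
  "rank_one f x = blinfun_scaleR_left x o\<^sub>L f"

lemma rank_one_apply [simp]: "rank_one f x u = f u *\<^sub>R x"
  by (simp add: rank_one_def)

definition blinfun_adjoint ::
  "('a::real_normed_vector \<Rightarrow>\<^sub>L 'b::real_normed_vector) \<Rightarrow> ('b \<Rightarrow>\<^sub>L real) \<Rightarrow>\<^sub>L ('a \<Rightarrow>\<^sub>L real)" where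
  "blinfun_adjoint T = Blinfun (\<lambda>f. f o\<^sub>L T)"

lemma blinfun_adjoint_apply [simp]:
  fixes T :: "'a::real_normed_vector \<Rightarrow>\<^sub>L 'b::real_normed_vector"
  shows "blinfun_adjoint T f = f o\<^sub>L T"
proof -
  have "bounded_linear (\<lambda>f :: 'b \<Rightarrow>\<^sub>L real. f o\<^sub>L T)"
    by (rule bounded_bilinear.bounded_linear_left[OF bounded_bilinear_blinfun_compose])
  then show ?thesis by (simp add: blinfun_adjoint_def bounded_linear_Blinfun_apply)
qed

definition finite_rank :: "('a::real_normed_vector \<Rightarrow>\<^sub>L 'b::real_normed_vector) \<Rightarrow> bool" where
  "finite_rank S \<longleftrightarrow> (\<exists>B. finite B \<and> range S \<subseteq> span B)"

definition approximation_property :: "'a::banach itself \<Rightarrow> bool" where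
  "approximation_property _ \<longleftrightarrow>
     (\<forall>\<epsilon>>0. \<forall>K :: 'a set. compact K \<longrightarrow>
        (\<exists>S :: 'a \<Rightarrow>\<^sub>L 'a. finite_rank S \<and> (\<forall>u\<in>K. norm (S u - u) < \<epsilon>)))"

definition positive_metric_approximation_property :: "'a::banach_lattice itself \<Rightarrow> bool" where
  "positive_metric_approximation_property _ \<longleftrightarrow>
     (\<forall>\<epsilon>>0. \<forall>K :: 'a set. compact K \<longrightarrow>
        (\<exists>R :: 'a \<Rightarrow>\<^sub>L 'a. finite_rank R \<and> (\<forall>x\<ge>0. 0 \<le> R x) \<and> norm R \<le> 1 \<and>
           (\<forall>x\<in>K. norm (R x - x) < \<epsilon>)))"


section \<open>Latticially and positively \<open>p\<close>-nuclear operators\<close>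

text \<open>
  The series representing an operator converges in the operator norm. For \<open>p < \<infinity>\<close> this is automatic
  once it converges pointwise; for \<open>p = \<infinity>\<close> it is a genuine requirement.
\<close>

definition latticially_nuclear_reps ::
  "ereal \<Rightarrow> ('a::banach \<Rightarrow>\<^sub>L 'b::banach_lattice) \<Rightarrow> ((nat \<Rightarrow> 'a \<Rightarrow>\<^sub>L real) \<times> (nat \<Rightarrow> 'b)) set" where
  "latticially_nuclear_reps p S =
     {(u, x). u \<in> lp_space p \<and> x \<in> weak_lp_space (conj_exponent p) \<and> (\<forall>j. 0 \<le> x j) \<and>
        (\<lambda>j. rank_one (u j) (x j)) sums S}"

definition latticially_nuclear :: "ereal \<Rightarrow> ('a::banach \<Rightarrow>\<^sub>L 'b::banach_lattice) \<Rightarrow> bool" where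
  "latticially_nuclear p S \<longleftrightarrow> latticially_nuclear_reps p S \<noteq> {}"

definition latticially_nuclear_norm :: "ereal \<Rightarrow> ('a::banach \<Rightarrow>\<^sub>L 'b::banach_lattice) \<Rightarrow> real" where
  "latticially_nuclear_norm p S =
     (INF (u, x) \<in> latticially_nuclear_reps p S. lp_norm p u * weak_lp_norm (conj_exponent p) x)"

definition positively_nuclear_reps ::
  "ereal \<Rightarrow> ('b::banach_lattice \<Rightarrow>\<^sub>L 'a::banach) \<Rightarrow> ((nat \<Rightarrow> 'b \<Rightarrow>\<^sub>L real) \<times> (nat \<Rightarrow> 'a)) set" where
  "positively_nuclear_reps p T =
     {(x, u). x \<in> weak_lp_space (conj_exponent p) \<and> (\<forall>j. 0 \<le> x j) \<and> u \<in> lp_space p \<and>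
        (\<lambda>j. rank_one (x j) (u j)) sums T}"

definition positively_nuclear :: "ereal \<Rightarrow> ('b::banach_lattice \<Rightarrow>\<^sub>L 'a::banach) \<Rightarrow> bool" where
  "positively_nuclear p T \<longleftrightarrow> positively_nuclear_reps p T \<noteq> {}"

definition positively_nuclear_norm :: "ereal \<Rightarrow> ('b::banach_lattice \<Rightarrow>\<^sub>L 'a::banach) \<Rightarrow> real" where
  "positively_nuclear_norm p T =
     (INF (x, u) \<in> positively_nuclear_reps p T. weak_lp_norm (conj_exponent p) x * lp_norm p u)"

end

theory Submission
  imports Defs
begin

text \<open>
  Let \<open>T\<^sup>* = \<Sum>\<^sub>j u\<^sub>j \<otimes> x\<^sub>j\<close> with \<open>u\<^sub>j\<close> in the bidual of \<open>E\<close> and positive \<open>x\<^sub>j\<close> in the dual of \<open>X\<close>;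
  the task is to replace the \<open>u\<^sub>j\<close> by vectors of \<open>E\<close> at the expense of an arbitrarily small increase
  of the norm. Consider the convex set of all tensors \<open>\<Sum>\<^sub>j (\<mu>\<^sub>j u\<^sub>j - w\<^sub>j) \<otimes> x\<^sub>j\<close> with finitely many nonzero
  \<open>\<mu>\<^sub>j \<in> [0, 1]\<close>, with \<open>w\<^sub>j \<in> E\<close> and \<open>\<parallel>w\<^sub>j\<parallel> \<le> \<mu>\<^sub>j \<parallel>u\<^sub>j\<parallel>\<close>, and with \<open>\<Sum>\<^sub>j \<mu>\<^sub>j u\<^sub>j \<otimes> x\<^sub>j\<close> close to \<open>T\<^sup>*\<close>. If it had
      positive
  distance from \<open>0\<close> in the nuclear norm, a separating functional would be an operator \<open>D\<close> from \<open>X\<^sup>*\<close> to the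
  third dual of \<open>E\<close>, and after subtracting the canonical projection of \<open>D\<close> onto \<open>E\<^sup>*\<close> one could take \<open>D\<close>
  to have values in the annihilator of \<open>E\<close> with \<open>\<Sum>\<^sub>j \<langle>D x\<^sub>j, u\<^sub>j\<rangle> \<noteq> 0\<close>. But \<open>T\<close> has values in \<open>E\<close>, so
  \<open>\<Sum>\<^sub>j \<langle>f, u\<^sub>j\<rangle> x\<^sub>j = 0\<close> for every \<open>f\<close> in the annihilator. Hence the trace vanishes when \<open>D\<close> is replaced by a
  finite rank operator, and the approximation property of \<open>E\<^sup>*\<^sup>*\<^sup>*\<close> or the positive one of \<open>X\<^sup>*\<close> provides
  finite rank approximants of \<open>D\<close>. For \<open>p = \<infinity>\<close> the tails of the series need not be small in the nuclear
  norm; there \<open>D\<close> factors through an \<open>L\<^sub>1\<close>-space, whose approximation property suffices.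

  So \<open>T\<close> is the sum of a finite tensor with terms in \<open>E\<close> and of an operator of small norm with a
  representation of the same kind, and the costs of the two parts add up. Iterating this
  gives the representation of \<open>T\<close>. The convexity weights \<open>\<mu>\<^sub>j\<close> matter for \<open>p = \<infinity>\<close>: they share
  each term between the two parts, so that its cost is not counted twice.
\<close>

section \<open>Sublinear functionals and the Hahn--Banach theorem\<close>

text \<open>Two obstacles shape the argument. First, the separating operator D controls only sums
  over positive vectors of bounded cost. \<open>weight_bound\<close> isolates this information: it
  yields bounds on weighted sums of the norms of \<open>D y\<close>, and it survives a positive
  contraction applied to the vectors y. This is why the approximation on the dual of X has to be
  positive and metric, whereas on the third dual of E the approximants act after D, where closeness
  on a compact set suffices. For p = infinity the same bound, with all weights equal to 1, says that
  D is cone absolutely summing; this is the source of the L1-space.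

  Second, the blocks split off one after another must form a series converging in operator norm, and
  smallness of a block does not make its prefixes small. Each block is therefore cut into many equal
  slices that are cycled through, which keeps the operator and does not raise the cost.

  Subtracting the canonical projection is possible because the \<open>w j\<close> range over full
  balls of E: they can be chosen to almost norm the restriction of \<open>D (x j)\<close> to
  E.\<close>

definition sublinear_on :: "'a::real_vector set \<Rightarrow> ('a \<Rightarrow> real) \<Rightarrow> bool" where
  "sublinear_on S q \<longleftrightarrow> (\<forall>x\<in>S. \<forall>y\<in>S. q (x + y) \<le> q x + q y) \<and>
     (\<forall>c\<ge>0. \<forall>x\<in>S. q (c *\<^sub>R x) = c * q x)"

text \<open>Homogeneity as an inequality suffices: the reverse inequality is the same one for the
  inverse factor.\<close>

lemma sublinear_onI:
  assumes S: "subspace S"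
    and add: "\<And>x y. x \<in> S \<Longrightarrow> y \<in> S \<Longrightarrow> q (x + y) \<le> q x + q y"
    and scale: "\<And>c x. 0 < c \<Longrightarrow> x \<in> S \<Longrightarrow> q (c *\<^sub>R x) \<le> c * q x"
    and zero: "q 0 = 0"
  shows "sublinear_on S q"
  unfolding sublinear_on_def
proof (intro conjI ballI allI impI)
  fix c :: real and x assume c: "0 \<le> c" and x: "x \<in> S"
  show "q (c *\<^sub>R x) = c * q x"
  proof (cases "c = 0")
    case False
    with c have c: "0 < c" by simp
    have "q (inverse c *\<^sub>R (c *\<^sub>R x)) \<le> inverse c * q (c *\<^sub>R x)"
      using c S x by (intro scale) (auto simp: subspace_scale)
    with c have "c * q x \<le> q (c *\<^sub>R x)" by (simp add: field_simps)
    with scale[OF c x] show ?thesis by simp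
  qed (simp add: zero)
qed (use add in auto)

lemma sublinear_on_add: "sublinear_on S q \<Longrightarrow> x \<in> S \<Longrightarrow> y \<in> S \<Longrightarrow> q (x + y) \<le> q x + q y"
  and sublinear_on_scale: "sublinear_on S q \<Longrightarrow> 0 \<le> c \<Longrightarrow> x \<in> S \<Longrightarrow> q (c *\<^sub>R x) = c * q x"
  by (simp_all add: sublinear_on_def)

lemma sublinear_on_0: "subspace S \<Longrightarrow> sublinear_on S q \<Longrightarrow> q 0 = 0"
  using sublinear_on_scale[of S q 0 0] by (simp add: subspace_0)

lemma sublinear_on_ge_neg:
  assumes "subspace S" "sublinear_on S q" "x \<in> S"
  shows "- q (- x) \<le> q x"
  using sublinear_on_add[OF assms(2,3), of "- x"] sublinear_on_0[OF assms(1,2)] assms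
  by (simp add: subspace_neg)

text \<open>The functional r is \<open>q\<close> lowered along the cone spanned by \<open>K\<close>:
  the infimum of q(x + t k) - t c over t \<ge> 0 and k in \<open>K\<close>. The bound c \<le> q on
  \<open>K\<close> keeps it finite, convexity of \<open>K\<close> makes it subadditive. A linear
  functional below r is below \<open>q\<close> and at least \<open>c\<close> on \<open>K\<close>;
  this serves both the minimality argument, with \<open>K\<close> a single point, and
  separation.\<close>

lemma sublinear_on_shift:
  assumes S: "subspace S" and q: "sublinear_on S q"
    and K: "convex K" "K \<subseteq> S" "K \<noteq> {}" and c: "\<And>k. k \<in> K \<Longrightarrow> c \<le> q k"
  obtains r where "sublinear_on S r" "\<And>x. x \<in> S \<Longrightarrow> r x \<le> q x" "\<And>x. x \<notin> S \<Longrightarrow> r x = 0"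
    "\<And>x k. x \<in> S \<Longrightarrow> k \<in> K \<Longrightarrow> r x \<le> q (x + k) - c"
proof -
  define I where "I = {0::real..} \<times> K"
  define g where "g x = (\<lambda>(t, k). q (x + t *\<^sub>R k) - t * c)" for x
  \<comment> \<open>The value 0 off \<open>S\<close> makes functionals on \<open>S\<close>
    comparable as total functions in the later application of Zorn's lemma.\<close>
  define r where "r x = (if x \<in> S then INF i\<in>I. g x i else 0)" for x
  have in_S: "x + t *\<^sub>R k \<in> S" if "x \<in> S" "k \<in> K" for x t k
    using S that K by (auto intro: subspace_add subspace_scale)
  have ne: "I \<noteq> {}" using K by (auto simp: I_def)
  have lb: "- q (- x) \<le> g x i" if "x \<in> S" "i \<in> I" for x i
  proof -
    obtain t k where i: "i = (t, k)" "0 \<le> t" "k \<in> K" using \<open>i \<in> I\<close> by (auto simp: I_def)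
    have "q (t *\<^sub>R k) \<le> q (x + t *\<^sub>R k) + q (- x)"
      using sublinear_on_add[OF q in_S[OF that(1) i(3)], of "- x" t] S that by (simp add: subspace_neg)
    moreover have "t * c \<le> q (t *\<^sub>R k)"
      using sublinear_on_scale[OF q i(2), of k] i K c[OF i(3)] by (auto simp: mult_left_mono)
    ultimately show ?thesis by (simp add: g_def i)
  qed
  have r_le: "r x \<le> g x i" if "x \<in> S" "i \<in> I" for x i
  proof -
    have "(INF i\<in>I. g x i) \<le> g x i"
      by (rule cINF_lower) (use that lb[OF that(1)] in \<open>auto intro: bdd_belowI[of _ "- q (- x)"]\<close>)
    then show ?thesis using that by (simp add: r_def)
  qed
  have r_ge: "d \<le> r x" if "x \<in> S" "\<And>i. i \<in> I \<Longrightarrow> d \<le> g x i" for x d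
    unfolding r_def using that ne by (auto intro!: cINF_greatest)
  obtain k0 where k0: "k0 \<in> K" using K by auto
  have r_q: "r x \<le> q x" if "x \<in> S" for x
    using r_le[OF that, of "(0, k0)"] k0 by (simp add: g_def I_def)
  have "sublinear_on S r"
  proof (rule sublinear_onI[OF S])
    fix x x' assume x: "x \<in> S" "x' \<in> S"
    have *: "r (x + x') \<le> g x i + g x' i'" if "i \<in> I" "i' \<in> I" for i i'
    proof -
      obtain t k where i: "i = (t, k)" "0 \<le> t" "k \<in> K" using \<open>i \<in> I\<close> by (auto simp: I_def)
      obtain t' k' where i': "i' = (t', k')" "0 \<le> t'" "k' \<in> K" using \<open>i' \<in> I\<close> by (auto simp: I_def)
      \<comment> \<open>Convexity puts the sum of two points on rays through \<open>K\<close> back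
        on such a ray; if both coefficients vanish, any point of \<open>K\<close> serves.\<close>
      obtain k'' where k'': "k'' \<in> K" "t *\<^sub>R k + t' *\<^sub>R k' = (t + t') *\<^sub>R k''"
      proof (cases "t + t' = 0")
        case True
        with i i' have "t = 0" "t' = 0" by linarith+
        with that show ?thesis using k0 by simp
      next
        case False
        with i i' have pos: "0 < t + t'" by simp
        have "(t / (t + t')) *\<^sub>R k + (t' / (t + t')) *\<^sub>R k' \<in> K"
          using i i' pos by (intro convexD[OF K(1)]) (auto simp: add_divide_distrib[symmetric])
        moreover have "(t + t') *\<^sub>R ((t / (t + t')) *\<^sub>R k + (t' / (t + t')) *\<^sub>R k') = t *\<^sub>R k + t' *\<^sub>R k'"
          using pos by (simp add: scaleR_right_distrib)
        ultimately show ?thesis using that by metis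
      qed
      have "r (x + x') \<le> g (x + x') (t + t', k'')"
        using i i' k'' x S by (intro r_le) (auto simp: I_def subspace_add)
      also have "\<dots> = q ((x + t *\<^sub>R k) + (x' + t' *\<^sub>R k')) - (t + t') * c"
        using k''(2) by (simp add: g_def algebra_simps)
      also have "\<dots> \<le> g x i + g x' i'"
        using sublinear_on_add[OF q in_S[OF x(1) i(3)] in_S[OF x(2) i'(3)], of t t']
        by (simp add: g_def i i' algebra_simps)
      finally show ?thesis .
    qed
    have "r (x + x') - g x i \<le> r x'" if "i \<in> I" for i
      using *[OF that] by (intro r_ge x) (simp add: algebra_simps)
    then have "r (x + x') - r x' \<le> r x" by (intro r_ge x) (simp add: algebra_simps)
    then show "r (x + x') \<le> r x + r x'" by simp
  next
    fix d :: real and x assume d: "0 < d" and x: "x \<in> S"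
    have "inverse d * r (d *\<^sub>R x) \<le> r x"
    proof (rule r_ge[OF x])
      fix i assume "i \<in> I"
      then obtain t k where i: "i = (t, k)" "0 \<le> t" "k \<in> K" by (auto simp: I_def)
      have "r (d *\<^sub>R x) \<le> g (d *\<^sub>R x) (d * t, k)"
        using d i S x by (intro r_le) (auto simp: subspace_scale I_def)
      also have "\<dots> = d * g x i"
        using sublinear_on_scale[OF q less_imp_le[OF d] in_S[OF x i(3), of t]]
        by (simp add: g_def i algebra_simps)
      finally show "inverse d * r (d *\<^sub>R x) \<le> g x i" using d by (simp add: field_simps)
    qed
    then show "r (d *\<^sub>R x) \<le> d * r x" using d by (simp add: field_simps)
  next
    have "0 \<le> r 0" using lb[of 0] sublinear_on_0[OF S q] S by (intro r_ge) (auto simp: subspace_0)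
    with r_q[of 0] sublinear_on_0[OF S q] S show "r 0 = 0" by (simp add: subspace_0)
  qed
  moreover have "r x \<le> q (x + k) - c" if "x \<in> S" "k \<in> K" for x k
    using r_le[OF that(1), of "(1, k)"] that(2) by (simp add: g_def I_def)
  ultimately show ?thesis using that[of r] r_q by (simp add: r_def)
qed

text \<open>A minimal element among the sublinear functionals below \<open>q\<close> is linear.\<close>

theorem hahn_banach_sublinear:
  assumes S: "subspace S" and q: "sublinear_on S q" and x0: "x0 \<in> S"
  obtains f where "\<And>x y. x \<in> S \<Longrightarrow> y \<in> S \<Longrightarrow> f (x + y) = f x + f y"
    "\<And>c x. x \<in> S \<Longrightarrow> f (c *\<^sub>R x) = c * f x"
    "\<And>x. x \<in> S \<Longrightarrow> f x \<le> q x" "f x0 = q x0"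
proof -
  \<comment> \<open>Lowering \<open>q\<close> at \<open>x0\<close> first forces equality there: a
    functional f below \<open>q0\<close> satisfies f(- x0) \<le> q 0 - q x0 = - q x0.\<close>
  obtain q0 where q0: "sublinear_on S q0" "\<And>x. x \<in> S \<Longrightarrow> q0 x \<le> q x" "\<And>x. x \<notin> S \<Longrightarrow> q0 x = 0"
    "\<And>x. x \<in> S \<Longrightarrow> q0 x \<le> q (x + x0) - q x0"
    by (rule sublinear_on_shift[OF S q, of "{x0}" "q x0"]) (use x0 in \<open>auto intro: that\<close>)
  define A where "A = {r. sublinear_on S r \<and> (\<forall>x\<in>S. r x \<le> q0 x) \<and> (\<forall>x. x \<notin> S \<longrightarrow> r x = 0)}"
  have q0A: "q0 \<in> A" using q0 by (auto simp: A_def)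
  \<comment> \<open>Zorn's lemma for the reversed order. The lower bound of a chain is its pointwise
    infimum, which is finite since every sublinear r below \<open>q0\<close> satisfies - q0 (- x)
    \<le> r x.\<close>
  have "\<exists>m\<in>A. \<forall>r\<in>A. (m \<ge> r \<longrightarrow> r = m)"
  proof (rule predicate_Zorn[of A "\<lambda>a b. b \<le> a"])
    show "partial_order_on A (relation_of (\<lambda>a b. b \<le> a) A)"
      by (auto simp: partial_order_on_def preorder_on_def refl_on_def trans_def antisym_def relation_of_def)
  next
    fix C assume C: "C \<in> Chains (relation_of (\<lambda>a b. b \<le> a) A)"
    then have CA: "C \<subseteq> A" and chain: "\<And>a b. a \<in> C \<Longrightarrow> b \<in> C \<Longrightarrow> a \<le> b \<or> b \<le> a"
      by (auto simp: Chains_def relation_of_def)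
    show "\<exists>u\<in>A. \<forall>a\<in>C. u \<le> a"
    proof (cases "C = {}")
      case True then show ?thesis using q0A by auto
    next
      case False
      define u where "u x = (INF r\<in>C. r x)" for x
      have sub: "sublinear_on S r" "\<And>x. x \<in> S \<Longrightarrow> r x \<le> q0 x" "\<And>x. x \<notin> S \<Longrightarrow> r x = 0" if "r \<in> C" for r
        using that CA by (auto simp: A_def)
      have lb: "- q0 (- x) \<le> r x" if "r \<in> C" "x \<in> S" for r x
        using sublinear_on_ge_neg[OF S sub(1)[OF that(1)] that(2)] sub(2)[OF that(1), of "- x"] S that(2)
        by (simp add: subspace_neg)
      have bdd: "bdd_below ((\<lambda>r. r x) ` C)" for x
        by (rule bdd_belowI[of _ "if x \<in> S then - q0 (- x) else 0"]) (auto simp: lb sub(3))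
      have u_le: "u x \<le> r x" if "r \<in> C" for r x
        unfolding u_def using that bdd by (auto intro!: cINF_lower)
      have u_ge: "c \<le> u x" if "\<And>r. r \<in> C \<Longrightarrow> c \<le> r x" for c x
        unfolding u_def using that False by (auto intro!: cINF_greatest)
      have "sublinear_on S u"
      proof (rule sublinear_onI[OF S])
        fix x y assume xy: "x \<in> S" "y \<in> S"
        have *: "u (x + y) \<le> r x + r' y" if r: "r \<in> C" "r' \<in> C" for r r'
        proof -
          obtain s where s: "s \<in> C" "s \<le> r" "s \<le> r'" using chain[OF r] r by (metis order_refl)
          have "u (x + y) \<le> s (x + y)" by (rule u_le[OF s(1)])
          also have "\<dots> \<le> s x + s y" by (rule sublinear_on_add[OF sub(1)[OF s(1)] xy])
          also have "\<dots> \<le> r x + r' y" using s by (intro add_mono) (auto simp: le_fun_def)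
          finally show ?thesis .
        qed
        have "u (x + y) - r x \<le> u y" if "r \<in> C" for r
          using *[OF that] by (intro u_ge) (simp add: algebra_simps)
        then have "u (x + y) - u y \<le> u x" by (intro u_ge) (simp add: algebra_simps)
        then show "u (x + y) \<le> u x + u y" by simp
      next
        fix c :: real and x assume c: "0 < c" and x: "x \<in> S"
        have "inverse c * u (c *\<^sub>R x) \<le> u x"
        proof (rule u_ge)
          fix r assume r: "r \<in> C"
          have "u (c *\<^sub>R x) \<le> r (c *\<^sub>R x)" by (rule u_le[OF r])
          then show "inverse c * u (c *\<^sub>R x) \<le> r x"
            using c sublinear_on_scale[OF sub(1)[OF r] less_imp_le[OF c] x] by (simp add: field_simps)
        qed
        then show "u (c *\<^sub>R x) \<le> c * u x" using c by (simp add: field_simps)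
      next
        have "r 0 = 0" if "r \<in> C" for r using sublinear_on_0[OF S sub(1)[OF that]] .
        moreover obtain r where "r \<in> C" using False by blast
        ultimately show "u 0 = 0" using u_le[of r 0] u_ge[of 0 0] by fastforce
      qed
      moreover have "u x \<le> q0 x" if "x \<in> S" for x
        using False u_le sub(2) that by (meson ex_in_conv order_trans)
      moreover have "u x = 0" if "x \<notin> S" for x
        using u_le[of _ x] u_ge[of 0 x] sub(3)[OF _ that] False by (metis antisym ex_in_conv order_refl)
      ultimately show ?thesis using u_le by (auto simp: A_def le_fun_def intro!: bexI[of _ u])
    qed
  qed
  then obtain m where "m \<in> A" and min: "\<And>r. r \<in> A \<Longrightarrow> r \<le> m \<Longrightarrow> r = m" by blast
  then have m: "sublinear_on S m" "\<And>x. x \<in> S \<Longrightarrow> m x \<le> q0 x" "\<And>x. x \<notin> S \<Longrightarrow> m x = 0"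
    by (auto simp: A_def)
  have m_add: "m (x + y) = m x + m y" if xy: "x \<in> S" "y \<in> S" for x y
  proof -
    \<comment> \<open>By minimality, lowering \<open>m\<close> at \<open>y\<close> gives nothing
      new; the resulting m x \<le> m (x + y) - m y is the missing half of additivity.\<close>
    obtain r where r: "sublinear_on S r" "\<And>x. x \<in> S \<Longrightarrow> r x \<le> m x" "\<And>x. x \<notin> S \<Longrightarrow> r x = 0"
      "\<And>x. x \<in> S \<Longrightarrow> r x \<le> m (x + y) - m y"
      by (rule sublinear_on_shift[OF S m(1), of "{y}" "m y"]) (use xy(2) in \<open>auto intro: that\<close>)
    have "r = m"
    proof (rule min)
      have "r x \<le> q0 x" if "x \<in> S" for x using r(2)[OF that] m(2)[OF that] by simp
      then show "r \<in> A" using r by (auto simp: A_def)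
      show "r \<le> m" unfolding le_fun_def using r m(3) by (metis order_refl)
    qed
    with r(4)[OF xy(1)] sublinear_on_add[OF m(1) xy] show ?thesis by simp
  qed
  have m_neg: "m (- x) = - m x" if "x \<in> S" for x
    using m_add[OF that, of "- x"] sublinear_on_0[OF S m(1)] S that by (simp add: subspace_neg)
  show ?thesis
  proof (rule that[of m])
    show "m (c *\<^sub>R x) = c * m x" if "x \<in> S" for c x
    proof (cases "0 \<le> c")
      case False
      then have "m ((- c) *\<^sub>R x) = (- c) * m x" using sublinear_on_scale[OF m(1) _ that, of "- c"] by simp
      moreover have "m (c *\<^sub>R x) = - m ((- c) *\<^sub>R x)"
        using m_neg[of "c *\<^sub>R x"] S that by (simp add: subspace_scale)
      ultimately show ?thesis by simp
    qed (use sublinear_on_scale[OF m(1) _ that] in simp)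
    show "m x \<le> q x" if "x \<in> S" for x using m(2) q0(2) that by (meson order_trans)
    have "- m x0 \<le> - q x0"
      using m(2)[of "- x0"] q0(4)[of "- x0"] m_neg[OF x0] S x0 sublinear_on_0[OF S q]
      by (simp add: subspace_neg)
    moreover have "m x0 \<le> q x0" using m(2)[OF x0] q0(2)[OF x0] by simp
    ultimately show "m x0 = q x0" by simp
  qed (rule m_add)
qed

type_synonym 'a dual = "'a \<Rightarrow>\<^sub>L real"

lemma norming_functional:
  fixes x :: "'a::real_normed_vector"
  obtains f :: "'a dual" where "norm f \<le> 1" "f x = norm x"
proof -
  have "sublinear_on (UNIV :: 'a set) norm"
    by (intro sublinear_onI) (auto intro: norm_triangle_ineq)
  then obtain f where f: "\<And>x y. f (x + y) = f x + f y" "\<And>c x. f (c *\<^sub>R x) = c * f x"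
    "\<And>x. f x \<le> norm x" "f x = norm (x :: 'a)"
    using hahn_banach_sublinear[of UNIV norm x] by (metis UNIV_I subspace_UNIV)
  have "\<bar>f y\<bar> \<le> norm y" for y
    using f(3)[of y] f(3)[of "- y"] f(2)[of "-1" y] by simp
  then have b: "norm (f y) \<le> norm y * 1" for y by simp
  then have bl: "bounded_linear f" by (intro bounded_linear_intro[of f 1]) (auto simp: f)
  show ?thesis
  proof (rule that[of "Blinfun f"])
    show "norm (Blinfun f) \<le> 1"
      by (rule norm_blinfun_bound) (use b bl in \<open>auto simp: bounded_linear_Blinfun_apply mult.commute\<close>)
  qed (simp add: bl bounded_linear_Blinfun_apply f(4))
qed

text \<open>A linear functional f below the lowered r has f (- k) \<le> q 0 - c = - c, hence is at
  least \<open>c\<close> on \<open>K\<close>. The sublinear functional \<open>q\<close> takes the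
  place of a topology.\<close>

theorem hahn_banach_separation:
  assumes S: "subspace S" and q: "sublinear_on S q"
    and K: "convex K" "K \<subseteq> S" "K \<noteq> {}" and c: "\<And>k. k \<in> K \<Longrightarrow> c \<le> q k"
  obtains f where "\<And>x y. x \<in> S \<Longrightarrow> y \<in> S \<Longrightarrow> f (x + y) = f x + f y"
    "\<And>c x. x \<in> S \<Longrightarrow> f (c *\<^sub>R x) = c * f x"
    "\<And>x. x \<in> S \<Longrightarrow> f x \<le> q x" "\<And>k. k \<in> K \<Longrightarrow> c \<le> f k"
proof -
  obtain r where r: "sublinear_on S r" "\<And>x. x \<in> S \<Longrightarrow> r x \<le> q x"
    "\<And>x k. x \<in> S \<Longrightarrow> k \<in> K \<Longrightarrow> r x \<le> q (x + k) - c"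
    using sublinear_on_shift[OF S q K c] by metis
  obtain f where f: "\<And>x y. x \<in> S \<Longrightarrow> y \<in> S \<Longrightarrow> f (x + y) = f x + f y"
    "\<And>c x. x \<in> S \<Longrightarrow> f (c *\<^sub>R x) = c * f x" "\<And>x. x \<in> S \<Longrightarrow> f x \<le> r x"
    using hahn_banach_sublinear[OF S r(1) subspace_0[OF S]] by metis
  show ?thesis
  proof (rule that[of f])
    show "f x \<le> q x" if "x \<in> S" for x using f(3) r(2) that by (meson order_trans)
    show "c \<le> f k" if k: "k \<in> K" for k
    proof -
      have kS: "k \<in> S" "- k \<in> S" using k K S by (auto simp: subspace_neg)
      have "f (- k) \<le> - c" using f(3)[OF kS(2)] r(3)[OF kS(2) k] sublinear_on_0[OF S q] by simp
      then show ?thesis using f(2)[OF kS(1), of "- 1"] by simp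
    qed
  qed (use f in auto)
qed

section \<open>Bidual embedding and finite rank operators\<close>

definition bidual_embedding :: "'a::real_normed_vector \<Rightarrow>\<^sub>L 'a dual dual" where
  "bidual_embedding = Blinfun (\<lambda>x. Blinfun (\<lambda>f. blinfun_apply f x))"

lemma abs_blinfun_le:
  fixes f :: "('a::real_normed_vector) dual"
  shows "\<bar>f x\<bar> \<le> norm f * norm x" "\<bar>f x\<bar> \<le> norm x * norm f"
  using norm_blinfun[of f x] by (simp_all add: mult.commute)

lemma bidual_embedding_apply [simp]:
  fixes x :: "'a::real_normed_vector"
  shows "bidual_embedding x f = f x"
proof -
  define e :: "'a \<Rightarrow> 'a dual dual" where "e x = Blinfun (\<lambda>f. blinfun_apply f x)" for x
  have "bounded_linear (\<lambda>f :: 'a dual. f x)" for x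
    by (rule bounded_linear_intro[of _ "norm x"])
      (auto simp: blinfun.add_left blinfun.scaleR_left abs_blinfun_le)
  then have e: "e x f = f x" for x f by (simp add: e_def bounded_linear_Blinfun_apply)
  have "norm (e x) \<le> norm x * 1" for x
    by (rule norm_blinfun_bound) (auto simp: e abs_blinfun_le)
  then have "bounded_linear e"
    by (intro bounded_linear_intro[of _ 1])
      (auto intro!: blinfun_eqI simp: e blinfun.add_left blinfun.scaleR_left
        blinfun.add_right blinfun.scaleR_right)
  then have "blinfun_apply (Blinfun e) = e" by (rule bounded_linear_Blinfun_apply)
  then show ?thesis unfolding bidual_embedding_def e_def[symmetric] by (simp only: e)
qed

lemma norm_bidual_embedding_le: "norm (bidual_embedding x) \<le> norm x"
  by (rule norm_blinfun_bound) (auto simp: abs_blinfun_le)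

lemma norm_blinfun_adjoint_ge:
  fixes T :: "'a::real_normed_vector \<Rightarrow>\<^sub>L 'b::real_normed_vector"
  shows "norm T \<le> norm (blinfun_adjoint T)"
proof (rule norm_blinfun_bound)
  fix x
  obtain f :: "'b dual" where f: "norm f \<le> 1" "f (T x) = norm (T x)" by (rule norming_functional)
  have "norm (T x) = blinfun_adjoint T f x" using f by simp
  also have "\<dots> \<le> norm (blinfun_adjoint T f) * norm x" using norm_blinfun[of "blinfun_adjoint T f" x] by simp
  also have "norm (blinfun_adjoint T f) \<le> norm (blinfun_adjoint T)"
    using norm_blinfun[of "blinfun_adjoint T" f] mult_left_mono[OF f(1) norm_ge_zero[of "blinfun_adjoint T"]]
    by simp
  finally show "norm (T x) \<le> norm (blinfun_adjoint T) * norm x" by (simp add: mult_right_mono)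
qed simp

lemma norm_blinfun_adjoint_le:
  fixes T :: "'a::real_normed_vector \<Rightarrow>\<^sub>L 'b::real_normed_vector"
  shows "norm (blinfun_adjoint T) \<le> norm T"
  by (rule norm_blinfun_bound) (use norm_blinfun_compose[of _ T] in \<open>auto simp: mult.commute\<close>)

lemma norm_le_one_apply: "norm f \<le> 1 \<Longrightarrow> norm (blinfun_apply f x) \<le> norm x"
  using norm_blinfun[of f x] mult_right_mono[of "norm f" 1 "norm x"] by simp

text \<open>This is continuity of the coordinates in a finite-dimensional subspace. Induction over
  the basis: if combinations of \<open>B\<close> came arbitrarily close to the new vector
  \<open>b\<close>, their coefficients would be Cauchy by the induction hypothesis, and
  \<open>b\<close> would lie in the span of \<open>B\<close>.\<close>

lemma independent_lower_bound:
  fixes B :: "'a::real_normed_vector set"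
  assumes "finite B" "independent B"
  shows "\<exists>c>0. \<forall>a. c * (\<Sum>b\<in>B. \<bar>a b\<bar>) \<le> norm (\<Sum>b\<in>B. a b *\<^sub>R b)"
  using assms
proof (induction B rule: finite_induct)
  case empty
  then show ?case by (auto intro: exI[of _ 1])
next
  case (insert b B)
  have ind: "independent B" and b: "b \<notin> span B"
    using insert.prems insert.hyps by (simp_all add: independent_insert)
  obtain c where c: "c > 0" "\<And>a. c * (\<Sum>b\<in>B. \<bar>a b\<bar>) \<le> norm (\<Sum>b\<in>B. a b *\<^sub>R b)"
    using insert.IH[OF ind] by blast
  have "\<exists>d>0. \<forall>a. d \<le> norm (b - (\<Sum>b\<in>B. a b *\<^sub>R b))"
  proof (rule ccontr)
    assume "\<not> ?thesis"
    then have "\<forall>d>0. \<exists>a. norm (b - (\<Sum>b\<in>B. a b *\<^sub>R b)) < d" by (simp add: not_le)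
    then have "\<exists>a. norm (b - (\<Sum>b\<in>B. a b *\<^sub>R b)) < inverse (real (Suc n))" for n
      by (rule allE[where x = "inverse (real (Suc n))"]) simp
    then have "\<exists>a. \<forall>n. norm (b - (\<Sum>b\<in>B. a n b *\<^sub>R b)) < inverse (real (Suc n))" by (intro choice allI)
    then obtain a where a: "\<forall>n. norm (b - (\<Sum>b\<in>B. a n b *\<^sub>R b)) < inverse (real (Suc n))" ..
    have lim: "(\<lambda>n. \<Sum>b\<in>B. a n b *\<^sub>R b) \<longlonglongrightarrow> b"
    proof -
      have "(\<lambda>n. b - (\<Sum>b\<in>B. a n b *\<^sub>R b)) \<longlonglongrightarrow> 0"
      proof (rule Lim_null_comparison)
        show "\<forall>\<^sub>F n in sequentially. norm (b - (\<Sum>b\<in>B. a n b *\<^sub>R b)) \<le> inverse (real (Suc n))"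
          using a by (intro always_eventually allI less_imp_le) blast
      qed (rule LIMSEQ_inverse_real_of_nat)
      from tendsto_diff[OF tendsto_const[of b] this] show ?thesis by simp
    qed
    then have Cau: "Cauchy (\<lambda>n. \<Sum>b\<in>B. a n b *\<^sub>R b)" by (rule LIMSEQ_imp_Cauchy)
    have "convergent (\<lambda>n. a n b')" if b': "b' \<in> B" for b'
    proof -
      have "Cauchy (\<lambda>n. a n b')"
      proof (rule metric_CauchyI)
        fix e :: real assume "0 < e"
        then obtain M where M: "\<And>m n. m \<ge> M \<Longrightarrow> n \<ge> M \<Longrightarrow>
            norm ((\<Sum>b\<in>B. a m b *\<^sub>R b) - (\<Sum>b\<in>B. a n b *\<^sub>R b)) < c * e"
          using CauchyD[OF Cau, of "c * e"] c(1) by auto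
        have "dist (a m b') (a n b') < e" if mn: "m \<ge> M" "n \<ge> M" for m n
        proof -
          have "c * \<bar>a m b' - a n b'\<bar> \<le> c * (\<Sum>b\<in>B. \<bar>a m b - a n b\<bar>)"
            using c(1) b' insert.hyps(1) by (intro mult_left_mono member_le_sum) auto
          also have "\<dots> \<le> norm (\<Sum>b\<in>B. (a m b - a n b) *\<^sub>R b)" by (rule c(2))
          also have "\<dots> < c * e" using M[OF mn] by (simp add: scaleR_left_diff_distrib sum_subtractf)
          finally show ?thesis using c(1) by (simp add: dist_real_def)
        qed
        then show "\<exists>M. \<forall>m\<ge>M. \<forall>n\<ge>M. dist (a m b') (a n b') < e" by blast
      qed
      then show ?thesis by (simp add: Cauchy_convergent_iff)
    qed
    then have l: "(\<lambda>n. a n b') \<longlonglongrightarrow> lim (\<lambda>n. a n b')" if "b' \<in> B" for b'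
      using that by (simp add: convergent_LIMSEQ_iff)
    define l where "l b' = lim (\<lambda>n. a n b')" for b'
    note l = l[folded l_def]
    have "(\<lambda>n. \<Sum>b\<in>B. a n b *\<^sub>R b) \<longlonglongrightarrow> (\<Sum>b\<in>B. l b *\<^sub>R b)"
      by (intro tendsto_sum tendsto_scaleR l tendsto_const)
    then have "b = (\<Sum>b\<in>B. l b *\<^sub>R b)" using lim LIMSEQ_unique by blast
    also have "\<dots> \<in> span B" by (intro span_sum span_scale span_base)
    finally show False using b by simp
  qed
  then obtain d where d: "d > 0" "\<And>a. d \<le> norm (b - (\<Sum>b\<in>B. a b *\<^sub>R b))" by blast
  have d': "d * \<bar>t\<bar> \<le> norm (t *\<^sub>R b + (\<Sum>b\<in>B. a b *\<^sub>R b))" for t a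
  proof (cases "t = 0")
    case False
    have "d * \<bar>t\<bar> \<le> \<bar>t\<bar> * norm (b - (\<Sum>b\<in>B. (- a b / t) *\<^sub>R b))"
      using mult_right_mono[OF d(2)[of "\<lambda>b. - a b / t"], of "\<bar>t\<bar>"] by (simp add: mult.commute)
    also have "\<dots> = norm (t *\<^sub>R (b - (\<Sum>b\<in>B. (- a b / t) *\<^sub>R b)))" by simp
    also have "t *\<^sub>R (b - (\<Sum>b\<in>B. (- a b / t) *\<^sub>R b)) = t *\<^sub>R b + (\<Sum>b\<in>B. a b *\<^sub>R b)"
      using False by (simp add: scaleR_right_distrib scaleR_sum_right sum_negf)
    finally show ?thesis .
  qed simp
  \<comment> \<open>With n the norm of the full combination, the coefficient of \<open>b\<close> is
    at most n / d, and the moduli of the others add up to at most (n + (n / d) norm b) / c;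
    \<open>k\<close> is the reciprocal of the total factor.\<close>
  define k where "k = 1 / (1 / d + (1 + norm b / d) / c)"
  have k: "k > 0" unfolding k_def using c(1) d(1) by (auto intro!: add_pos_nonneg divide_pos_pos)
  have "k * (\<Sum>b\<in>insert b B. \<bar>a b\<bar>) \<le> norm (\<Sum>b\<in>insert b B. a b *\<^sub>R b)" for a
  proof -
    let ?n = "norm (a b *\<^sub>R b + (\<Sum>b\<in>B. a b *\<^sub>R b))"
    have 1: "\<bar>a b\<bar> \<le> ?n / d" using d'[of "a b" a] d(1) by (simp add: field_simps)
    have "c * (\<Sum>b\<in>B. \<bar>a b\<bar>) \<le> norm (\<Sum>b\<in>B. a b *\<^sub>R b)" by (rule c(2))
    also have "\<dots> \<le> ?n + norm (a b *\<^sub>R b)"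
      using norm_triangle_ineq4[of "a b *\<^sub>R b + (\<Sum>b\<in>B. a b *\<^sub>R b)" "a b *\<^sub>R b"] by simp
    also have "\<dots> \<le> ?n + ?n / d * norm b"
      using mult_right_mono[OF 1 norm_ge_zero[of b]] by simp
    finally have "(\<Sum>b\<in>B. \<bar>a b\<bar>) \<le> (?n + ?n / d * norm b) / c"
      using c(1) by (simp add: field_simps)
    with 1 have "\<bar>a b\<bar> + (\<Sum>b\<in>B. \<bar>a b\<bar>) \<le> ?n / d + (?n + ?n / d * norm b) / c" by linarith
    also have "\<dots> = ?n * (1 / d + (1 + norm b / d) / c)" by (simp add: field_simps)
    also have "\<dots> = ?n / k" by (simp add: k_def)
    finally show ?thesis using k insert.hyps by (simp add: field_simps)
  qed
  with k show ?case by blast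
qed

lemma finite_rank_expansion:
  fixes S :: "'a::real_normed_vector \<Rightarrow>\<^sub>L 'b::real_normed_vector"
  assumes "finite_rank S"
  obtains B :: "'b set" and g :: "'b \<Rightarrow> 'a dual"
  where "finite B" "\<And>x. S x = (\<Sum>b\<in>B. g b x *\<^sub>R b)"
proof -
  obtain B0 where B0: "finite B0" "range S \<subseteq> span B0" using assms by (auto simp: finite_rank_def)
  obtain B where B: "B \<subseteq> B0" "independent B" "span B = span B0"
    using maximal_independent_subset[of B0] by (metis span_eq span_minimal subspace_span span_superset order_trans)
  have fin: "finite B" using B B0 finite_subset by blast
  obtain c where c: "c > 0" "\<And>a. c * (\<Sum>b\<in>B. \<bar>a b\<bar>) \<le> norm (\<Sum>b\<in>B. a b *\<^sub>R b)"
    using independent_lower_bound[OF fin B(2)] by blast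
  define h where "h b x = representation B (S x) b" for b x
  have in_span: "S x \<in> span B" for x using B0 B by auto
  have S_eq: "S x = (\<Sum>b\<in>B. h b x *\<^sub>R b)" for x
    unfolding h_def using sum_representation_eq[OF B(2) in_span fin order_refl] by simp
  have bl: "bounded_linear (h b)" if "b \<in> B" for b
  proof (rule bounded_linear_intro[of _ "norm S / c"])
    show "h b (x + y) = h b x + h b y" for x y
      using representation_add[OF B(2) in_span in_span] by (simp add: h_def blinfun.add_right)
    show "h b (r *\<^sub>R x) = r *\<^sub>R h b x" for r x
      using representation_scale[OF B(2) in_span] by (simp add: h_def blinfun.scaleR_right)
    show "norm (h b x) \<le> norm x * (norm S / c)" for x
    proof -
      have "c * \<bar>h b x\<bar> \<le> c * (\<Sum>b\<in>B. \<bar>h b x\<bar>)"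
        using c(1) that fin by (intro mult_left_mono member_le_sum) auto
      also have "\<dots> \<le> norm (S x)" using c(2) S_eq[of x] by metis
      also have "\<dots> \<le> norm S * norm x" by (rule norm_blinfun)
      finally show ?thesis using c(1) by (simp add: field_simps)
    qed
  qed
  show ?thesis
    by (rule that[OF fin, of "\<lambda>b. Blinfun (h b)"])
      (auto simp: S_eq bounded_linear_Blinfun_apply bl intro!: sum.cong)
qed

section \<open>Maps dominated by a positive functional\<close>

lemma inf_add_le:
  fixes a b c :: "'a::banach_lattice"
  assumes "0 \<le> a" "0 \<le> b" "0 \<le> c"
  shows "inf (a + b) c \<le> inf a c + inf b c"
proof -
  have "inf (a + b) c - inf a c \<le> b"
  proof -
    have "inf (a + b) c \<le> inf (a + b) (c + b)" using assms by (intro inf_mono) auto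
    also have "\<dots> = inf a c + b" by (simp add: add_inf_distrib_right)
    finally show ?thesis by (simp only: diff_le_eq add.commute)
  qed
  moreover have "inf (a + b) c - inf a c \<le> c"
  proof -
    have "inf (a + b) c \<le> c" by simp
    also have "\<dots> \<le> c + inf a c" using assms by simp
    finally show ?thesis by (simp only: diff_le_eq add.commute)
  qed
  ultimately have "inf (a + b) c - inf a c \<le> inf b c" by simp
  then show ?thesis by (simp only: diff_le_eq add.commute)
qed

lemma pprt_le_iff: "pprt a \<le> b \<longleftrightarrow> a \<le> b \<and> (0::'a::lattice_ab_group_add) \<le> b"
  by (simp add: pprt_def)

lemma pprt_add_le: "pprt (a + b) \<le> pprt a + pprt (b :: 'a::lattice_ab_group_add)"
  by (simp add: pprt_le_iff add_mono add_nonneg_nonneg) (simp add: pprt_def add_mono)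

lemma inf_pprt_neg:
  fixes a :: "'a::banach_lattice"
  shows "inf (pprt a) (pprt (- a)) = 0"
proof -
  have "inf (pprt a) (pprt (- a)) = inf (a + pprt (- a)) (pprt (- a))"
  proof -
    have "pprt a + nprt a + - nprt a = a + - nprt a" by (simp only: prts[symmetric])
    then have "pprt a = a + pprt (- a)" by (simp add: pprt_neg)
    then show ?thesis by simp
  qed
  also have "\<dots> = inf a 0 + pprt (- a)" by (metis add.left_neutral add_inf_distrib_right)
  also have "\<dots> = nprt a + - nprt a" by (simp only: nprt_def[symmetric] pprt_neg)
  also have "\<dots> = 0" by simp
  finally show ?thesis .
qed

lemma of_nat_scaleR_add: "real (Suc n) *\<^sub>R (a::'a::real_vector) = real n *\<^sub>R a + a"
  by (simp add: scaleR_left_distrib)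

lemma inf_scaleR_eq_0:
  fixes a b :: "'a::banach_lattice"
  assumes "0 \<le> a" "0 \<le> b" "inf a b = 0"
  shows "inf a (real n *\<^sub>R b) = 0"
proof (induction n)
  case 0
  then show ?case using assms by (simp add: inf.absorb2)
next
  case (Suc n)
  have "inf a (real (Suc n) *\<^sub>R b) \<le> inf a (real n *\<^sub>R b) + inf a b"
    using inf_add_le[of "real n *\<^sub>R b" b a] assms
    by (simp add: of_nat_scaleR_add scaleR_nonneg_nonneg inf.commute del: of_nat_Suc)
  also have "\<dots> = 0" using Suc assms by simp
  finally show ?case using assms by (intro antisym) (auto simp: scaleR_nonneg_nonneg)
qed

text \<open>Additivity is required on the positive cone only, because the band components below are
  obtained as limits there and are never extended to differences. Such a \<open>D\<close> should be
  thought of as a contraction on the L1-space of \<open>\<rho>\<close>.\<close>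

definition dominated :: "('y::banach_lattice \<Rightarrow> 'z::banach) \<Rightarrow> ('y \<Rightarrow> real) \<Rightarrow> bool" where
  "dominated D \<rho> \<longleftrightarrow> (\<forall>a\<ge>0. \<forall>b\<ge>0. D (a + b) = D a + D b \<and> \<rho> (a + b) = \<rho> a + \<rho> b) \<and>
     (\<forall>a\<ge>0. norm (D a) \<le> \<rho> a)"

context
  fixes D :: "'y::banach_lattice \<Rightarrow> 'z::banach" and \<rho> :: "'y \<Rightarrow> real"
  assumes dom: "dominated D \<rho>"
begin

lemma dominated_add: "0 \<le> a \<Longrightarrow> 0 \<le> b \<Longrightarrow> D (a + b) = D a + D b"
  and dominated_functional_add: "0 \<le> a \<Longrightarrow> 0 \<le> b \<Longrightarrow> \<rho> (a + b) = \<rho> a + \<rho> b"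
  and dominated_norm: "0 \<le> a \<Longrightarrow> norm (D a) \<le> \<rho> a"
  using dom by (auto simp: dominated_def)

lemma dominated_nonneg: "0 \<le> a \<Longrightarrow> 0 \<le> \<rho> a"
  using dominated_norm[of a] norm_ge_zero[of "D a"] by linarith

lemma dominated_diff: "0 \<le> a \<Longrightarrow> a \<le> b \<Longrightarrow> D (b - a) = D b - D a"
  and dominated_functional_diff: "0 \<le> a \<Longrightarrow> a \<le> b \<Longrightarrow> \<rho> (b - a) = \<rho> b - \<rho> a"
  using dominated_add[of a "b - a"] dominated_functional_add[of a "b - a"] by auto

lemma dominated_mono: "0 \<le> a \<Longrightarrow> a \<le> b \<Longrightarrow> \<rho> a \<le> \<rho> b"
  using dominated_functional_diff[of a b] dominated_nonneg[of "b - a"] by simp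

lemma dominated_0: "D 0 = 0" "\<rho> 0 = 0"
  using dominated_add[of 0 0] dominated_functional_add[of 0 0] by auto

lemma dominated_mult: "0 \<le> a \<Longrightarrow> D (real n *\<^sub>R a) = real n *\<^sub>R D a"
  and dominated_functional_mult: "0 \<le> a \<Longrightarrow> \<rho> (real n *\<^sub>R a) = real n * \<rho> a"
  by (induction n)
    (simp_all add: scaleR_add_left dominated_add dominated_functional_add dominated_0 scaleR_nonneg_nonneg
      scaleR_left_distrib distrib_right)

lemma dominated_sum:
  assumes "\<And>i. i \<in> I \<Longrightarrow> 0 \<le> f i"
  shows "\<rho> (sum f I) = (\<Sum>i\<in>I. \<rho> (f i))"
  using assms
  by (induction I rule: infinite_finite_induct)
    (auto simp: dominated_0 dominated_functional_add sum_nonneg)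

text \<open>The band projection onto the band generated by \<open>w\<close>, applied to \<open>D\<close> and \<open>\<rho>\<close>.\<close>

lemma dominated_split:
  assumes w: "0 \<le> w" and Z: "closed Z" "subspace Z" "\<And>y. 0 \<le> y \<Longrightarrow> D y \<in> Z"
  obtains D1 \<rho>1 D2 \<rho>2 where "dominated D1 \<rho>1" "dominated D2 \<rho>2"
    "\<And>y. 0 \<le> y \<Longrightarrow> D y = D1 y + D2 y" "\<And>y. 0 \<le> y \<Longrightarrow> \<rho> y = \<rho>1 y + \<rho>2 y"
    "\<rho>2 w = 0" "\<And>v. 0 \<le> v \<Longrightarrow> inf v w = 0 \<Longrightarrow> \<rho>1 v = 0"
    "\<And>y. 0 \<le> y \<Longrightarrow> D1 y \<in> Z" "\<And>y. 0 \<le> y \<Longrightarrow> D2 y \<in> Z"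
proof -
  \<comment> \<open>The band component of \<open>y\<close> would be the supremum of the truncations
    \<open>t y n\<close>, which need not exist in the lattice. Their images under
    \<open>\<rho>\<close> increase and are bounded by \<open>\<rho> y\<close>, and domination makes
    their images under \<open>D\<close> a Cauchy sequence.\<close>
  define t where "t y n = inf y (real n *\<^sub>R w)" for y n
  define D1 where "D1 y = lim (\<lambda>n. D (t y n))" for y
  define \<rho>1 where "\<rho>1 y = lim (\<lambda>n. \<rho> (t y n))" for y
  have nw: "0 \<le> real n *\<^sub>R w" for n using w by (simp add: scaleR_nonneg_nonneg)
  have t0: "0 \<le> t y n" if "0 \<le> y" for y n using that nw by (simp add: t_def)
  have ty: "t y n \<le> y" for y n by (simp add: t_def)
  have t_mono: "t y m \<le> t y n" if "m \<le> n" for y m n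
    unfolding t_def using that w by (intro inf_mono) (auto intro: scaleR_right_mono)
  have diff: "norm (D (t y m) - D (t y n)) \<le> \<bar>\<rho> (t y m) - \<rho> (t y n)\<bar>" if y: "0 \<le> y" for y m n
  proof -
    have *: "norm (D (t y n) - D (t y m)) \<le> \<bar>\<rho> (t y n) - \<rho> (t y m)\<bar>" if "m \<le> n" for m n
    proof -
      have le: "0 \<le> t y n - t y m" using t_mono[OF that] by simp
      show ?thesis
        using dominated_norm[OF le] dominated_diff[OF t0[OF y] t_mono[OF that]]
          dominated_functional_diff[OF t0[OF y] t_mono[OF that]] by auto
    qed
    show ?thesis
      by (cases "m \<le> n") (use *[of m n] *[of n m] in \<open>auto simp: norm_minus_commute abs_minus_commute\<close>)
  qed
  have lim_\<rho>: "(\<lambda>n. \<rho> (t y n)) \<longlonglongrightarrow> \<rho>1 y" if y: "0 \<le> y" for y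
  proof -
    have "incseq (\<lambda>n. \<rho> (t y n))"
      using dominated_mono[OF t0[OF y] t_mono] by (auto simp: incseq_def)
    moreover have "\<rho> (t y n) \<le> \<rho> y" for n using dominated_mono[OF t0[OF y] ty] .
    ultimately obtain L where "(\<lambda>n. \<rho> (t y n)) \<longlonglongrightarrow> L"
      by (meson incseq_convergent)
    then have "convergent (\<lambda>n. \<rho> (t y n))" by (rule convergentI)
    then show ?thesis by (simp add: \<rho>1_def convergent_LIMSEQ_iff)
  qed
  have lim_D: "(\<lambda>n. D (t y n)) \<longlonglongrightarrow> D1 y" if y: "0 \<le> y" for y
  proof -
    have C: "Cauchy (\<lambda>n. \<rho> (t y n))" using lim_\<rho>[OF y] by (rule LIMSEQ_imp_Cauchy)
    have "Cauchy (\<lambda>n. D (t y n))"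
    proof (rule CauchyI)
      fix e :: real assume "0 < e"
      from CauchyD[OF C this] show "\<exists>M. \<forall>m\<ge>M. \<forall>n\<ge>M. norm (D (t y m) - D (t y n)) < e"
        using diff[OF y] by (metis le_less_trans real_norm_def)
    qed
    then have "convergent (\<lambda>n. D (t y n))" by (simp add: Cauchy_convergent_iff)
    then show ?thesis by (simp add: D1_def convergent_LIMSEQ_iff)
  qed
  \<comment> \<open>Truncation is subadditive but not additive; the reverse estimate holds at the
    doubled level \<open>2 * n\<close>, so the limits are additive.\<close>
  have t_add: "t (a + b) n \<le> t a n + t b n" "t a n + t b n \<le> t (a + b) (2 * n)" if "0 \<le> a" "0 \<le> b" for a b n
  proof -
    show "t (a + b) n \<le> t a n + t b n" unfolding t_def by (rule inf_add_le[OF that nw])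
    have "t a n + t b n \<le> a + b" by (intro add_mono ty)
    moreover have "t a n + t b n \<le> real n *\<^sub>R w + real n *\<^sub>R w" by (intro add_mono) (auto simp: t_def)
    moreover have "real n *\<^sub>R w + real n *\<^sub>R w = real (2 * n) *\<^sub>R w" by (simp flip: scaleR_left_distrib)
    ultimately show "t a n + t b n \<le> t (a + b) (2 * n)" by (simp add: t_def)
  qed
  have lim2: "(\<lambda>n. \<rho> (t y (2 * n))) \<longlonglongrightarrow> \<rho>1 y" if "0 \<le> y" for y
    using LIMSEQ_subseq_LIMSEQ[OF lim_\<rho>[OF that], of "\<lambda>n. 2 * n"] by (simp add: o_def strict_mono_def)
  have \<rho>_add: "\<rho> (t a n + t b n) = \<rho> (t a n) + \<rho> (t b n)" if "0 \<le> a" "0 \<le> b" for a b n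
    using t0 that by (intro dominated_functional_add) auto
  have \<rho>1_add: "\<rho>1 (a + b) = \<rho>1 a + \<rho>1 b" if ab: "0 \<le> a" "0 \<le> b" for a b
  proof (rule antisym)
    have ab': "0 \<le> a + b" using ab by simp
    show "\<rho>1 (a + b) \<le> \<rho>1 a + \<rho>1 b"
      using dominated_mono[OF t0[OF ab'] t_add(1)[OF ab]] \<rho>_add[OF ab]
      by (intro LIMSEQ_le[OF lim_\<rho>[OF ab'] tendsto_add[OF lim_\<rho>[OF ab(1)] lim_\<rho>[OF ab(2)]]]) auto
    have "0 \<le> t a n + t b n" for n using t0 ab by (intro add_nonneg_nonneg) auto
    from dominated_mono[OF this t_add(2)[OF ab]] show "\<rho>1 a + \<rho>1 b \<le> \<rho>1 (a + b)"
      using \<rho>_add[OF ab]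
      by (intro LIMSEQ_le[OF tendsto_add[OF lim_\<rho>[OF ab(1)] lim_\<rho>[OF ab(2)]] lim2[OF ab']]) auto
  qed
  have D1_add: "D1 (a + b) = D1 a + D1 b" if ab: "0 \<le> a" "0 \<le> b" for a b
  proof -
    have ab': "0 \<le> a + b" using ab by simp
    \<comment> \<open>The defect of additivity of \<open>D\<close> is dominated by that of
      \<open>\<rho>\<close>, which tends to 0.\<close>
    have "norm (D (t a n) + D (t b n) - D (t (a + b) n)) \<le> \<rho> (t a n) + \<rho> (t b n) - \<rho> (t (a + b) n)" for n
    proof -
      have "0 \<le> t a n + t b n - t (a + b) n" using t_add(1)[OF ab] by simp
      from dominated_norm[OF this] show ?thesis
        using dominated_diff[OF t0[OF ab'] t_add(1)[OF ab]] dominated_functional_diff[OF t0[OF ab'] t_add(1)[OF ab]]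
          \<rho>_add[OF ab] dominated_add[OF t0[OF ab(1)] t0[OF ab(2)]] by simp
    qed
    moreover have "(\<lambda>n. \<rho> (t a n) + \<rho> (t b n) - \<rho> (t (a + b) n)) \<longlonglongrightarrow> \<rho>1 a + \<rho>1 b - \<rho>1 (a + b)"
      by (intro tendsto_intros lim_\<rho> ab ab')
    then have "(\<lambda>n. \<rho> (t a n) + \<rho> (t b n) - \<rho> (t (a + b) n)) \<longlonglongrightarrow> 0"
      by (simp add: \<rho>1_add[OF ab])
    ultimately have "(\<lambda>n. D (t a n) + D (t b n) - D (t (a + b) n)) \<longlonglongrightarrow> 0"
      by (rule Lim_null_comparison[OF always_eventually[OF allI]])
    moreover have "(\<lambda>n. D (t a n) + D (t b n) - D (t (a + b) n)) \<longlonglongrightarrow> D1 a + D1 b - D1 (a + b)"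
      by (intro tendsto_intros lim_D ab ab')
    ultimately have "D1 a + D1 b - D1 (a + b) = 0" using LIMSEQ_unique by blast
    then show ?thesis by simp
  qed
  have D1_norm: "norm (D1 a) \<le> \<rho>1 a" if a: "0 \<le> a" for a
    by (rule LIMSEQ_le[OF tendsto_norm[OF lim_D[OF a]] lim_\<rho>[OF a]]) (use dominated_norm t0[OF a] in auto)
  have D2_norm: "norm (D a - D1 a) \<le> \<rho> a - \<rho>1 a" if a: "0 \<le> a" for a
  proof (rule LIMSEQ_le)
    show "(\<lambda>n. norm (D a - D (t a n))) \<longlonglongrightarrow> norm (D a - D1 a)" by (intro tendsto_intros lim_D a)
    show "(\<lambda>n. \<rho> a - \<rho> (t a n)) \<longlonglongrightarrow> \<rho> a - \<rho>1 a" by (intro tendsto_intros lim_\<rho> a)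
    have "norm (D a - D (t a n)) \<le> \<rho> a - \<rho> (t a n)" for n
      using dominated_norm[of "a - t a n"] ty[of a n] dominated_diff[OF t0[OF a] ty]
        dominated_functional_diff[OF t0[OF a] ty] by simp
    then show "\<exists>N. \<forall>n\<ge>N. norm (D a - D (t a n)) \<le> \<rho> a - \<rho> (t a n)" by blast
  qed
  have D1_Z: "D1 y \<in> Z" if "0 \<le> y" for y
    by (rule closed_sequentially[OF Z(1) _ lim_D[OF that]]) (use Z(3) t0[OF that] in auto)
  show ?thesis
  proof (rule that[of D1 \<rho>1 "\<lambda>y. D y - D1 y" "\<lambda>y. \<rho> y - \<rho>1 y"])
    show "dominated D1 \<rho>1" by (simp add: dominated_def D1_add \<rho>1_add D1_norm)
    show "dominated (\<lambda>y. D y - D1 y) (\<lambda>y. \<rho> y - \<rho>1 y)"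
      by (simp add: dominated_def D1_add \<rho>1_add D2_norm dominated_add dominated_functional_add)
    have "(\<lambda>n. \<rho> (t w n)) \<longlonglongrightarrow> \<rho> w"
    proof (rule tendsto_eventually)
      have "t w n = w" if "1 \<le> n" for n
      proof -
        have "1 *\<^sub>R w \<le> real n *\<^sub>R w" using that w by (intro scaleR_right_mono) auto
        then show ?thesis by (simp add: t_def inf.absorb1)
      qed
      then show "\<forall>\<^sub>F n in sequentially. \<rho> (t w n) = \<rho> w"
        by (auto simp: eventually_sequentially intro!: exI[of _ 1])
    qed
    then show "\<rho> w - \<rho>1 w = 0" using LIMSEQ_unique lim_\<rho>[OF w] by fastforce
    show "\<rho>1 v = 0" if "0 \<le> v" "inf v w = 0" for v
      unfolding \<rho>1_def t_def using inf_scaleR_eq_0[OF that(1) w that(2)] dominated_0 by simp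
    show "D y - D1 y \<in> Z" if "0 \<le> y" for y
      using subspace_diff[OF Z(2) Z(3) D1_Z] that by blast
  qed (use D1_Z in auto)
qed

end

text \<open>\<open>Z\<close> stands for the annihilator of E, which the values of the components,
  and later those of the finite rank approximants, must not leave.\<close>

definition splits :: "('y::banach_lattice \<Rightarrow> 'z::banach) \<Rightarrow> ('y \<Rightarrow> real) \<Rightarrow> 'z set \<Rightarrow>
    (('y \<Rightarrow> 'z) \<times> ('y \<Rightarrow> real)) list \<Rightarrow> bool" where
  "splits D \<rho> Z L \<longleftrightarrow> (\<forall>P\<in>set L. dominated (fst P) (snd P) \<and> (\<forall>y\<ge>0. fst P y \<in> Z)) \<and>
     (\<forall>y\<ge>0. D y = (\<Sum>P\<leftarrow>L. fst P y) \<and> \<rho> y = (\<Sum>P\<leftarrow>L. snd P y))"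

text \<open>If the elements of the L1-space of \<open>\<rho>\<close> are viewed as functions, the
  two conditions say that x lies between k e and (k + 1) e almost everywhere.\<close>

definition in_cell :: "('y::banach_lattice \<Rightarrow> real) \<Rightarrow> 'y \<Rightarrow> 'y \<Rightarrow> nat \<Rightarrow> bool" where
  "in_cell \<rho> e x k \<longleftrightarrow> \<rho> (pprt (x - real (Suc k) *\<^sub>R e)) = 0 \<and> \<rho> (pprt (real k *\<^sub>R e - x)) = 0"

lemma splits_mono:
  assumes "splits D \<rho> Z L" "P \<in> set L" "0 \<le> y"
  shows "snd P y \<le> \<rho> y"
proof -
  have "\<forall>Q\<in>set L. 0 \<le> snd Q y" using assms by (auto simp: splits_def intro: dominated_nonneg)
  then have "snd P y \<le> (\<Sum>P\<leftarrow>L. snd P y)"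
    using assms(2) by (intro member_le_sum_list) auto
  then show ?thesis using assms by (simp add: splits_def)
qed

lemma splits_concat:
  assumes "splits D \<rho> Z L" "\<And>P. P \<in> set L \<Longrightarrow> splits (fst P) (snd P) Z (M P)"
  shows "splits D \<rho> Z (concat (map M L))"
proof -
  have 1: "(\<Sum>P\<leftarrow>L. fst P y) = (\<Sum>Q\<leftarrow>concat (map M L). fst Q y)"
    "(\<Sum>P\<leftarrow>L. snd P y) = (\<Sum>Q\<leftarrow>concat (map M L). snd Q y)" if "0 \<le> y" for y
    using assms(2) that by (induction L) (auto simp: splits_def)
  show ?thesis using assms 1 unfolding splits_def by auto
qed

text \<open>Layers are peeled off from the top. Splitting along the band of the positive part of x -
  r e separates a component on which x lies between r e and (r + 1) e from one on which x is at most
  r e; the latter is left to the induction. At r = 0 the hypothesis says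
  \<open>\<rho> x = 0\<close>, which is a case of cell 0.\<close>

lemma dominated_cells_one:
  assumes "dominated D \<rho>" and Z: "closed Z" "subspace Z" and "\<And>y. 0 \<le> y \<Longrightarrow> D y \<in> Z"
    and x: "0 \<le> x" and e: "0 \<le> e" and "\<rho> (pprt (x - real r *\<^sub>R e)) = 0"
  shows "\<exists>L. splits D \<rho> Z L \<and> (\<forall>P\<in>set L. \<exists>k. in_cell (snd P) e x k)"
  using assms(1,4,7)
proof (induction r arbitrary: D \<rho>)
  case 0
  have "pprt (x - e) \<le> x" "pprt (- x) = 0" using x e by (simp_all add: pprt_le_iff)
  then have "\<rho> (pprt (x - e)) \<le> 0"
    using dominated_mono[OF 0(1) _, of "pprt (x - e)" x] 0(3) x by simp
  then have "in_cell \<rho> e x 0"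
    using dominated_nonneg[OF 0(1), of "pprt (x - e)"] \<open>pprt (- x) = 0\<close> dominated_0(2)[OF 0(1)]
    by (simp add: in_cell_def)
  then show ?case using 0 by (intro exI[of _ "[(D, \<rho>)]"]) (auto simp: splits_def)
next
  case (Suc r)
  let ?w = "pprt (x - real r *\<^sub>R e)"
  have w: "0 \<le> ?w" by simp
  obtain D1 \<rho>1 D2 \<rho>2 where s: "dominated D1 \<rho>1" "dominated D2 \<rho>2"
    "\<And>y. 0 \<le> y \<Longrightarrow> D y = D1 y + D2 y" "\<And>y. 0 \<le> y \<Longrightarrow> \<rho> y = \<rho>1 y + \<rho>2 y"
    "\<rho>2 ?w = 0" "\<And>v. 0 \<le> v \<Longrightarrow> inf v ?w = 0 \<Longrightarrow> \<rho>1 v = 0"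
    "\<And>y. 0 \<le> y \<Longrightarrow> D1 y \<in> Z" "\<And>y. 0 \<le> y \<Longrightarrow> D2 y \<in> Z"
    using dominated_split[OF Suc.prems(1) w Z Suc.prems(2)] by (metis (no_types, lifting))
  obtain L where L: "splits D2 \<rho>2 Z L" "\<forall>P\<in>set L. \<exists>k. in_cell (snd P) e x k"
    using Suc.IH[OF s(2) s(8) s(5)] by blast
  have "\<rho>1 (pprt (real r *\<^sub>R e - x)) = 0"
    using inf_pprt_neg[of "real r *\<^sub>R e - x"] by (intro s(6)) simp_all
  moreover have "\<rho>1 (pprt (x - real (Suc r) *\<^sub>R e)) = 0"
    using s(4)[of "pprt (x - real (Suc r) *\<^sub>R e)"] Suc.prems(3)
      dominated_nonneg[OF s(1), of "pprt (x - real (Suc r) *\<^sub>R e)"]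
      dominated_nonneg[OF s(2), of "pprt (x - real (Suc r) *\<^sub>R e)"]
    by (simp del: of_nat_Suc)
  ultimately have "in_cell \<rho>1 e x r" by (simp add: in_cell_def)
  then show ?case
    using L s by (intro exI[of _ "(D1, \<rho>1) # L"]) (auto simp: splits_def)
qed

text \<open>The cells are refined for one vector after another. A cell condition passes to the
  components of a further splitting, since these are smaller than the functional that is
  split.\<close>

lemma dominated_cells:
  assumes dom: "dominated D \<rho>" and Z: "closed Z" "subspace Z" and D: "\<And>y. 0 \<le> y \<Longrightarrow> D y \<in> Z"
    and e: "0 \<le> e" and "\<And>x. x \<in> set xs \<Longrightarrow> 0 \<le> x \<and> x \<le> real r *\<^sub>R e"
  shows "\<exists>L. splits D \<rho> Z L \<and> (\<forall>P\<in>set L. \<forall>x\<in>set xs. \<exists>k. in_cell (snd P) e x k)"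
  using assms(6)
proof (induction xs)
  case Nil
  then show ?case using dom D by (intro exI[of _ "[(D, \<rho>)]"]) (auto simp: splits_def)
next
  case (Cons x xs)
  then obtain L where L: "splits D \<rho> Z L" "\<forall>P\<in>set L. \<forall>x\<in>set xs. \<exists>k. in_cell (snd P) e x k" by auto
  have x: "0 \<le> x" "x \<le> real r *\<^sub>R e" using Cons.prems by auto
  have "\<exists>M. splits (fst P) (snd P) Z M \<and> (\<forall>Q\<in>set M. \<exists>k. in_cell (snd Q) e x k)" if P: "P \<in> set L" for P
  proof (rule dominated_cells_one[OF _ Z _ x(1) e])
    show dP: "dominated (fst P) (snd P)" "\<And>y. 0 \<le> y \<Longrightarrow> fst P y \<in> Z"
      using L P by (auto simp: splits_def)
    have "pprt (x - real r *\<^sub>R e) = 0" using x by simp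
    then show "snd P (pprt (x - real r *\<^sub>R e)) = 0" using dominated_0(2)[OF dP(1)] by simp
  qed
  then have "\<exists>M. \<forall>P\<in>set L. splits (fst P) (snd P) Z (M P) \<and> (\<forall>Q\<in>set (M P). \<exists>k. in_cell (snd Q) e x k)"
    by (intro bchoice ballI)
  then obtain M where M: "\<And>P. P \<in> set L \<Longrightarrow> splits (fst P) (snd P) Z (M P)"
    "\<And>P Q. P \<in> set L \<Longrightarrow> Q \<in> set (M P) \<Longrightarrow> \<exists>k. in_cell (snd Q) e x k" by blast
  have "\<exists>k. in_cell (snd Q) e x' k" if "P \<in> set L" "Q \<in> set (M P)" "x' \<in> set xs" for P Q x'
  proof -
    obtain k where k: "in_cell (snd P) e x' k" using L(2) \<open>P \<in> set L\<close> \<open>x' \<in> set xs\<close> by blast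
    have dQ: "dominated (fst Q) (snd Q)" using M(1)[OF that(1)] that(2) by (auto simp: splits_def)
    have "snd Q (pprt v) = 0" if "snd P (pprt v) = 0" for v
      using splits_mono[OF M(1)[OF \<open>P \<in> set L\<close>] \<open>Q \<in> set (M P)\<close>, of "pprt v"] that
        dominated_nonneg[OF dQ, of "pprt v"] by simp
    with k have "in_cell (snd Q) e x' k" by (simp add: in_cell_def del: of_nat_Suc)
    then show ?thesis ..
  qed
  then have "\<forall>Q\<in>set (concat (map M L)). \<forall>x\<in>set (x # xs). \<exists>k. in_cell (snd Q) e x k"
    using M(2) by auto
  with splits_concat[OF L(1) M(1)] show ?case by blast
qed

text \<open>The positive part of x - k e is at most that of x - (k + 1) e plus e, so its
  \<open>\<rho>\<close>-value is at most that of e; the negative part has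
  \<open>\<rho>\<close>-value 0 and is therefore invisible to \<open>D\<close> as well.\<close>

lemma in_cell_approx:
  assumes dom: "dominated D \<rho>" and x: "0 \<le> x" and e: "0 \<le> e" and c: "in_cell \<rho> e x k"
  shows "norm (D x - real k *\<^sub>R D e) \<le> \<rho> e" "\<bar>\<rho> x - real k * \<rho> e\<bar> \<le> \<rho> e"
proof -
  let ?p = "pprt (x - real k *\<^sub>R e)" and ?m = "pprt (real k *\<^sub>R e - x)"
  have nn: "0 \<le> ?p" "0 \<le> ?m" "0 \<le> real k *\<^sub>R e" using e by (simp_all add: scaleR_nonneg_nonneg)
  have "?p + - ?m = x - real k *\<^sub>R e"
    using prts[of "x - real k *\<^sub>R e"] pprt_neg[of "x - real k *\<^sub>R e"] by simp
  then have eq: "x + ?m = real k *\<^sub>R e + ?p" by (simp add: algebra_simps)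
  have "?p = pprt ((x - real (Suc k) *\<^sub>R e) + e)" by (simp add: scaleR_left_distrib)
  also have "\<dots> \<le> pprt (x - real (Suc k) *\<^sub>R e) + e"
    using pprt_add_le[of "x - real (Suc k) *\<^sub>R e" e] e by (simp del: of_nat_Suc)
  finally have "\<rho> ?p \<le> \<rho> (pprt (x - real (Suc k) *\<^sub>R e) + e)"
    using nn by (intro dominated_mono[OF dom])
  also have "\<dots> = \<rho> e" using c e dominated_functional_add[OF dom, of "pprt (x - real (Suc k) *\<^sub>R e)" e]
    by (simp add: in_cell_def del: of_nat_Suc)
  finally have p: "\<rho> ?p \<le> \<rho> e" .
  have m: "\<rho> ?m = 0" using c by (simp add: in_cell_def)
  then have Dm: "D ?m = 0" using dominated_norm[OF dom nn(2)] by simp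
  have "D (x + ?m) = D (real k *\<^sub>R e + ?p)" "\<rho> (x + ?m) = \<rho> (real k *\<^sub>R e + ?p)" by (simp_all only: eq)
  then have "D x = real k *\<^sub>R D e + D ?p" "\<rho> x = real k * \<rho> e + \<rho> ?p"
    using nn x e m Dm by (simp_all add: dominated_add[OF dom] dominated_functional_add[OF dom]
        dominated_mult[OF dom] dominated_functional_mult[OF dom])
  then show "norm (D x - real k *\<^sub>R D e) \<le> \<rho> e" "\<bar>\<rho> x - real k * \<rho> e\<bar> \<le> \<rho> e"
    using p dominated_norm[OF dom nn(1)] dominated_nonneg[OF dom nn(1)] by simp_all
qed

lemma norm_sum_list_le:
  fixes f :: "'i \<Rightarrow> 'z::real_normed_vector"
  assumes "\<And>i. i \<in> set L \<Longrightarrow> norm (f i) \<le> g i"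
  shows "norm (\<Sum>i\<leftarrow>L. f i) \<le> (\<Sum>i\<leftarrow>L. g i)"
  using assms
  by (induction L) (auto intro: order_trans[OF norm_triangle_ineq] add_mono)

text \<open>
  This is the approximation property of the \<open>L\<^sub>1\<close>-space obtained by completing \<open>'y\<close> for the
  seminorm given by \<open>\<rho>\<close>.
\<close>

lemma dominated_finite_rank_approx:
  fixes x :: "nat \<Rightarrow> 'y::banach_lattice" and D :: "'y \<Rightarrow> 'z::banach"
  assumes dom: "dominated D \<rho>" and Z: "closed Z" "subspace Z" and D: "\<And>y. 0 \<le> y \<Longrightarrow> D y \<in> Z"
    and x: "\<And>j. 0 \<le> x j" and \<epsilon>: "0 < \<epsilon>"
  obtains L where "\<And>P. P \<in> set L \<Longrightarrow> fst P \<in> Z \<and> dominated (\<lambda>y. snd P y) (snd P)"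
    "\<And>y P. 0 \<le> y \<Longrightarrow> P \<in> set L \<Longrightarrow> snd P y \<le> \<rho> y"
    "\<And>y. 0 \<le> y \<Longrightarrow> norm (\<Sum>P\<leftarrow>L. snd P y *\<^sub>R fst P) \<le> \<rho> y"
    "\<And>j. j < N \<Longrightarrow> norm (D (x j) - (\<Sum>P\<leftarrow>L. snd P (x j) *\<^sub>R fst P)) \<le> \<epsilon>"
proof -
  \<comment> \<open>The sum dominates each of the first \<open>N\<close> vectors, so finitely many
    layers of thickness \<open>e\<close> cover them; \<open>r\<close> is chosen to make the total
    error \<open>2 * \<rho> e\<close> at most \<open>\<epsilon>\<close>.\<close>
  define e0 where "e0 = (\<Sum>j<N. x j)"
  obtain r0 where r0: "2 * \<rho> e0 / \<epsilon> \<le> real r0" using real_arch_simple by blast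
  define r where "r = Suc r0"
  define e where "e = (1 / real r) *\<^sub>R e0"
  have r: "0 < real r" "2 * \<rho> e0 \<le> \<epsilon> * real r" using r0 \<epsilon> by (auto simp: r_def field_simps)
  have e0: "0 \<le> e0" unfolding e0_def by (intro sum_nonneg x)
  then have e: "0 \<le> e" by (simp add: e_def scaleR_nonneg_nonneg)
  have re: "real r *\<^sub>R e = e0" using r by (simp add: e_def)
  then have \<rho>e: "2 * \<rho> e \<le> \<epsilon>"
    using dominated_functional_mult[OF dom e, of r] r by (simp add: mult.commute)
  have "x j \<le> e0" if "j < N" for j
    unfolding e0_def using that x by (subst sum.remove[of _ j]) (auto intro: sum_nonneg)
  then have "\<exists>L. splits D \<rho> Z L \<and> (\<forall>P\<in>set L. \<forall>x'\<in>set (map x [0..<N]). \<exists>k. in_cell (snd P) e x' k)"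
    using x re by (intro dominated_cells[OF dom Z D e, of "map x [0..<N]" r]) auto
  then obtain L where L: "splits D \<rho> Z L"
    and cells: "\<forall>P\<in>set L. \<forall>x'\<in>set (map x [0..<N]). \<exists>k. in_cell (snd P) e x' k" by blast
  have dP: "dominated (fst P) (snd P)" if "P \<in> set L" for P using L that by (auto simp: splits_def)
  \<comment> \<open>The mean value of \<open>D\<close> over the cell, so that the approximant is a
    conditional expectation. If \<open>snd P e = 0\<close>, then \<open>fst P e = 0\<close> by
    domination, and the convention that the inverse of 0 is 0 yields the right value.\<close>
  define f where "f P = fst P e /\<^sub>R snd P e" for P :: "('y \<Rightarrow> 'z) \<times> ('y \<Rightarrow> real)"
  have f_norm: "norm (f P) \<le> 1" and f_eq: "snd P e *\<^sub>R f P = fst P e" if "P \<in> set L" for P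
    using dominated_norm[OF dP[OF that] e] dominated_nonneg[OF dP[OF that] e]
    by (cases "snd P e = 0"; auto simp: f_def divide_le_eq_1 divide_inverse_commute[symmetric])+
  have sum_\<rho>: "(\<Sum>P\<leftarrow>L. snd P y) = \<rho> y" "(\<Sum>P\<leftarrow>L. fst P y) = D y" if "0 \<le> y" for y
    using L that by (auto simp: splits_def)
  define M where "M = map (\<lambda>P. (f P, snd P)) L"
  have M_sum: "(\<Sum>P\<leftarrow>M. snd P y *\<^sub>R fst P) = (\<Sum>P\<leftarrow>L. snd P y *\<^sub>R f P)" for y
    by (simp add: M_def o_def)
  show ?thesis
  proof (rule that[of M])
    show "fst P \<in> Z \<and> dominated (\<lambda>y. snd P y) (snd P)" if "P \<in> set M" for P
    proof -
      obtain Q where Q: "Q \<in> set L" "P = (f Q, snd Q)" using \<open>P \<in> set M\<close> by (auto simp: M_def)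
      have "fst Q e \<in> Z" using L Q(1) e by (auto simp: splits_def)
      then have "f Q \<in> Z" unfolding f_def by (rule subspace_scale[OF Z(2)])
      with Q dP[OF Q(1)] show ?thesis
        by (auto simp: dominated_def intro!: abs_of_nonneg[THEN eq_refl] dominated_nonneg[OF dP[OF Q(1)]])
    qed
    show "snd P y \<le> \<rho> y" if "0 \<le> y" "P \<in> set M" for y P
      using that splits_mono[OF L] by (auto simp: M_def)
    show "norm (\<Sum>P\<leftarrow>M. snd P y *\<^sub>R fst P) \<le> \<rho> y" if y: "0 \<le> y" for y
    proof -
      have "norm (\<Sum>P\<leftarrow>L. snd P y *\<^sub>R f P) \<le> (\<Sum>P\<leftarrow>L. snd P y)"
      proof (rule norm_sum_list_le)
        fix P assume P: "P \<in> set L"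
        show "norm (snd P y *\<^sub>R f P) \<le> snd P y"
          using mult_left_mono[OF f_norm[OF P] dominated_nonneg[OF dP[OF P] y]]
            dominated_nonneg[OF dP[OF P] y] by simp
      qed
      then show ?thesis by (simp add: M_sum sum_\<rho> y)
    qed
    show "norm (D (x j) - (\<Sum>P\<leftarrow>M. snd P (x j) *\<^sub>R fst P)) \<le> \<epsilon>" if j: "j < N" for j
    proof -
      have "D (x j) - (\<Sum>P\<leftarrow>L. snd P (x j) *\<^sub>R f P) = (\<Sum>P\<leftarrow>L. fst P (x j) - snd P (x j) *\<^sub>R f P)"
        using sum_\<rho>(2)[OF x[of j]] by (simp add: sum_list_subtractf)
      also have "norm \<dots> \<le> (\<Sum>P\<leftarrow>L. 2 * snd P e)"
      proof (rule norm_sum_list_le)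
        fix P assume P: "P \<in> set L"
        obtain k where k: "in_cell (snd P) e (x j) k" using bspec[OF bspec[OF cells P], of "x j"] j by auto
        note ap = in_cell_approx[OF dP[OF P] x e k]
        \<comment> \<open>Both terms are compared with their values at k e, where they agree by the
          choice of \<open>f P\<close>; this leaves two errors of size at most
          \<open>snd P e\<close>.\<close>
        have "fst P (x j) - snd P (x j) *\<^sub>R f P =
            (fst P (x j) - real k *\<^sub>R fst P e) - (snd P (x j) - real k * snd P e) *\<^sub>R f P"
          using f_eq[OF P] by (simp add: scaleR_left_diff_distrib flip: scaleR_scaleR)
        also have "norm \<dots> \<le> snd P e + \<bar>snd P (x j) - real k * snd P e\<bar> * norm (f P)"
          by (rule order_trans[OF norm_triangle_ineq4]) (use ap(1) in simp)
        also have "\<dots> \<le> snd P e + snd P e * 1"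
          using ap(2) f_norm[OF P] by (intro add_mono mult_mono order_refl) auto
        finally show "norm (fst P (x j) - snd P (x j) *\<^sub>R f P) \<le> 2 * snd P e" by simp
      qed
      also have "\<dots> = 2 * \<rho> e" by (simp add: sum_list_const_mult sum_\<rho> e)
      finally show ?thesis using \<rho>e by (simp add: M_sum)
    qed
  qed
qed

section \<open>The variation of an operator on a Banach lattice\<close>

lemma riesz_decomposition_list:
  fixes ys :: "'y::banach_lattice list"
  assumes "\<And>y. y \<in> set ys \<Longrightarrow> 0 \<le> y" "sum_list ys = a + b" "0 \<le> a" "0 \<le> b"
  shows "\<exists>ps. ys = map (\<lambda>p. fst p + snd p) ps \<and> (\<forall>p\<in>set ps. 0 \<le> fst p \<and> 0 \<le> snd p) \<and>
    sum_list (map fst ps) = a \<and> sum_list (map snd ps) = b"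
  using assms
proof (induction ys arbitrary: a b)
  case Nil
  then have "a = 0" "b = 0" by (simp_all add: add_nonneg_eq_0_iff)
  then show ?case by simp
next
  case (Cons y ys)
  define a1 where "a1 = inf y a"
  have nn: "0 \<le> y" "0 \<le> sum_list ys" using Cons.prems by (auto intro: sum_list_nonneg)
  have a1: "0 \<le> a1" "a1 \<le> a" "a1 \<le> y" using nn Cons.prems by (auto simp: a1_def)
  have "y \<le> a + b" using Cons.prems(2) nn(2) by (metis le_add_same_cancel1 sum_list.Cons)
  then have "y \<le> inf y a + b"
    using Cons.prems(4) by (simp add: add_inf_distrib_right)
  then have b1: "y - a1 \<le> b" unfolding a1_def diff_le_eq by (simp only: add.commute)
  have "sum_list ys = (a - a1) + (b - (y - a1))" using Cons.prems(2) by (simp add: algebra_simps)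
  then obtain ps where "ys = map (\<lambda>p. fst p + snd p) ps" "\<forall>p\<in>set ps. 0 \<le> fst p \<and> 0 \<le> snd p"
    "sum_list (map fst ps) = a - a1" "sum_list (map snd ps) = b - (y - a1)"
    using Cons.IH[of "a - a1" "b - (y - a1)"] Cons.prems a1 b1 by auto
  then show ?case using a1 by (intro exI[of _ "(a1, y - a1) # ps"]) auto
qed

text \<open>The hypothesis is that \<open>D\<close> is cone absolutely summing. The functional
  \<open>\<rho>\<close> is its variation, the supremum of the sums of norms over all finite positive
  decompositions of a vector; the Riesz decomposition property makes it additive.\<close>

lemma variation_dominated:
  fixes D :: "'y::banach_lattice \<Rightarrow>\<^sub>L 'z::banach"
  assumes bound: "\<And>ys. (\<And>y. y \<in> set ys \<Longrightarrow> 0 \<le> y) \<Longrightarrow> (\<Sum>y\<leftarrow>ys. norm (D y)) \<le> C * norm (sum_list ys)"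
  obtains \<rho> where "dominated (blinfun_apply D) \<rho>" "\<And>y. 0 \<le> y \<Longrightarrow> \<rho> y \<le> C * norm y"
proof -
  define V where "V y = {ys. (\<forall>y\<in>set ys. 0 \<le> y) \<and> sum_list ys = y}" for y :: 'y
  define n where "n ys = (\<Sum>y\<leftarrow>ys. norm (D y))" for ys
  define \<rho> where "\<rho> y = (SUP ys\<in>V y. n ys)" for y
  have ne: "[y] \<in> V y" if "0 \<le> y" for y using that by (simp add: V_def)
  have ub: "n ys \<le> C * norm y" if "ys \<in> V y" for ys y
    using bound[of ys] that by (auto simp: V_def n_def)
  have up: "n ys \<le> \<rho> y" if "ys \<in> V y" for ys y
    unfolding \<rho>_def using that ub by (auto intro!: cSUP_upper bdd_aboveI[of _ "C * norm y"])
  have least: "\<rho> y \<le> c" if "0 \<le> y" "\<And>ys. ys \<in> V y \<Longrightarrow> n ys \<le> c" for y c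
    unfolding \<rho>_def using ne[OF that(1)] that(2) by (intro cSUP_least) auto
  have add: "\<rho> (a + b) = \<rho> a + \<rho> b" if ab: "0 \<le> a" "0 \<le> b" for a b
  proof (rule antisym)
    show "\<rho> (a + b) \<le> \<rho> a + \<rho> b"
    proof (rule least)
      fix ys assume "ys \<in> V (a + b)"
      then obtain ps where ps: "ys = map (\<lambda>p. fst p + snd p) ps" "\<forall>p\<in>set ps. 0 \<le> fst p \<and> 0 \<le> snd p"
        "sum_list (map fst ps) = a" "sum_list (map snd ps) = b"
        using riesz_decomposition_list[of ys a b] ab by (auto simp: V_def)
      have "n ys \<le> n (map fst ps) + n (map snd ps)"
        unfolding ps(1) n_def
        by (simp add: o_def blinfun.add_right sum_list_addf[symmetric] sum_list_mono norm_triangle_ineq)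
      also have "\<dots> \<le> \<rho> a + \<rho> b"
        using ps by (intro add_mono up) (auto simp: V_def)
      finally show "n ys \<le> \<rho> a + \<rho> b" .
    qed (use ab in simp)
    have *: "n xs + n ys \<le> \<rho> (a + b)" if "xs \<in> V a" "ys \<in> V b" for xs ys
    proof -
      have "xs @ ys \<in> V (a + b)" using that by (auto simp: V_def)
      from up[OF this] show ?thesis by (simp add: n_def)
    qed
    have "\<rho> b \<le> \<rho> (a + b) - n xs" if "xs \<in> V a" for xs
      using *[OF that] by (intro least ab) (simp add: algebra_simps)
    then have "n xs \<le> \<rho> (a + b) - \<rho> b" if "xs \<in> V a" for xs using that by (simp add: algebra_simps)
    then have "\<rho> a \<le> \<rho> (a + b) - \<rho> b" by (intro least ab)
    then show "\<rho> a + \<rho> b \<le> \<rho> (a + b)" by simp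
  qed
  show ?thesis
  proof (rule that[of \<rho>])
    have "norm (D y) \<le> \<rho> y" if "0 \<le> y" for y using up[OF ne[OF that]] by (simp add: n_def)
    then show "dominated (blinfun_apply D) \<rho>" by (simp add: dominated_def add blinfun.add_right)
    show "\<rho> y \<le> C * norm y" if "0 \<le> y" for y using least[OF that] ub by blast
  qed
qed

section \<open>The cost of a finite tensor\<close>

text \<open>
  With \<open>a = 1/p\<close>, the condition \<open>\<Sum>\<^sub>j pcost a (c\<^sub>j) \<le> t\<close> says that the \<open>\<ell>\<^sub>p\<close>-norm of \<open>c\<close> is at most
  \<open>t powr a\<close>. For \<open>p = \<infinity>\<close> it says that all \<open>c\<^sub>j\<close> are bounded by \<open>1\<close>, whatever \<open>t\<close> is. In this
  normalisation costs add up under concatenation for all exponents alike.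
\<close>

definition pcost :: "real \<Rightarrow> real \<Rightarrow> ennreal" where
  "pcost a t = (if a = 0 then (if \<bar>t\<bar> \<le> 1 then 0 else \<infinity>) else ennreal (\<bar>t\<bar> powr (1 / a)))"

lemma pcost_zero [simp]: "pcost a 0 = 0"
  by (simp add: pcost_def)

lemma pcost_le_one: "0 \<le> a \<Longrightarrow> \<bar>t\<bar> \<le> 1 \<Longrightarrow> pcost a t \<le> 1"
  using powr_mono2[of "1 / a" "\<bar>t\<bar>" 1] by (auto simp: pcost_def)

lemma pcost_mono: "0 \<le> a \<Longrightarrow> \<bar>s\<bar> \<le> \<bar>t\<bar> \<Longrightarrow> pcost a s \<le> pcost a t"
  by (auto simp: pcost_def intro!: ennreal_leI powr_mono2)

lemma pcost_abs [simp]: "pcost a \<bar>t\<bar> = pcost a t"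
  by (simp add: pcost_def)

lemma pcost_scale:
  assumes "0 \<le> a" "0 \<le> s"
  shows "pcost a (s powr a * t) \<le> ennreal s * pcost a t"
proof (cases "a = 0 \<or> s = 0")
  case True
  then show ?thesis using assms by (auto simp: pcost_def ennreal_mult_top)
next
  case False
  then have "\<bar>s powr a * t\<bar> powr (1 / a) = s * \<bar>t\<bar> powr (1 / a)"
    using assms by (simp add: abs_mult powr_mult powr_powr)
  then show ?thesis using False assms by (simp add: pcost_def ennreal_mult)
qed

text \<open>Young's inequality with both weights enlarged to 1. The lost constant shows up as the
  factor 2 in \<open>norm_tensor_le\<close>, where only smallness matters. If one exponent is 0,
  finite cost means that the factor is at most 1.\<close>

lemma mult_le_pcost_sum:
  assumes "0 \<le> a" "0 \<le> b" "a + b = 1" "0 \<le> s" "0 \<le> t"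
  shows "ennreal (s * t) \<le> pcost a s + pcost b t"
proof -
  consider "a = 0" "b = 1" | "a = 1" "b = 0" | "0 < a" "0 < b" "0 < s" "0 < t" | "s = 0 \<or> t = 0" using assms
      by fastforce
  then show ?thesis
  proof cases
    case 1
    then show ?thesis using assms mult_right_mono[of s 1 t] by (auto simp: pcost_def)
  next
    case 2
    then show ?thesis using assms mult_left_mono[of t 1 s] by (auto simp: pcost_def)
  next
    case 3
    have "s * t = (s powr (1 / a)) powr a * (t powr (1 / b)) powr b"
      using 3 assms by (simp add: powr_powr)
    also have "\<dots> \<le> a * s powr (1 / a) + b * t powr (1 / b)"
      using 3 assms by (intro Youngs_inequality_0) auto
    also have "\<dots> \<le> 1 * s powr (1 / a) + 1 * t powr (1 / b)"
      using 3 assms by (intro add_mono mult_right_mono) auto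
    finally have "s * t \<le> s powr (1 / a) + t powr (1 / b)" by simp
    then have "ennreal (s * t) \<le> ennreal (s powr (1 / a) + t powr (1 / b))" by (rule ennreal_leI)
    then show ?thesis using 3 assms by (simp add: pcost_def ennreal_plus)
  qed auto
qed

definition tensor :: "(('f::real_normed_vector) dual \<times> 'y::real_normed_vector) list \<Rightarrow> 'f \<Rightarrow>\<^sub>L 'y" where
  "tensor ps = (\<Sum>P\<leftarrow>ps. rank_one (fst P) (snd P))"

text \<open>Only the sizes of the first components are kept, so that norms of \<open>D y\<close> can
  be summed before vectors almost attaining them are chosen.\<close>

definition weight_bound :: "real \<Rightarrow> real \<Rightarrow> real \<Rightarrow> (real \<times> 'y::banach_lattice) list \<Rightarrow> bool" where
  "weight_bound a b t cs \<longleftrightarrow> (\<forall>C\<in>set cs. 0 \<le> snd C) \<and> (\<Sum>C\<leftarrow>cs. pcost a (fst C)) \<le> ennreal t \<and>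
     (\<forall>F :: 'y dual. norm F \<le> 1 \<longrightarrow> (\<Sum>C\<leftarrow>cs. pcost b (blinfun_apply F (snd C))) \<le> ennreal t)"

text \<open>One bound \<open>t\<close> serves for both costs: the strong norm is then at most
  \<open>t powr a\<close> and the weak one at most \<open>t powr b\<close>, with product
  \<open>t\<close> because a + b = 1 in all applications. Scaling the two components inversely
  brings a representation into this balanced form.\<close>

definition admissible :: "real \<Rightarrow> real \<Rightarrow> real \<Rightarrow> (('f::real_normed_vector) dual \<times> 'y::banach_lattice) list \<Rightarrow> bool" where
  "admissible a b t ps \<longleftrightarrow> weight_bound a b t (map (\<lambda>P. (norm (fst P), snd P)) ps)"

lemma admissible_iff:
  "admissible a b t ps \<longleftrightarrow> (\<forall>P\<in>set ps. 0 \<le> snd P) \<and> (\<Sum>P\<leftarrow>ps. pcost a (norm (fst P))) \<le> ennreal t \<and>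
     (\<forall>F. norm F \<le> 1 \<longrightarrow> (\<Sum>P\<leftarrow>ps. pcost b (blinfun_apply F (snd P))) \<le> ennreal t)"
  by (simp add: admissible_def weight_bound_def o_def)

lemma tensor_Nil [simp]: "tensor [] = 0"
  and tensor_Cons [simp]: "tensor (P # ps) = rank_one (fst P) (snd P) + tensor ps"
  and tensor_append [simp]: "tensor (ps @ qs) = tensor ps + tensor qs"
  by (simp_all add: tensor_def)

lemma rank_one_scaleR:
  "rank_one (c *\<^sub>R w) y = c *\<^sub>R rank_one w y" "rank_one w (c *\<^sub>R y) = c *\<^sub>R rank_one w y"
  by (auto intro!: blinfun_eqI simp: blinfun.scaleR_left)

lemma rank_one_add:
  "rank_one (v + w) y = rank_one v y + rank_one w y" "rank_one w (x + y) = rank_one w x + rank_one w y"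
  by (auto intro!: blinfun_eqI simp: blinfun.add_left scaleR_left_distrib scaleR_right_distrib)

lemma rank_one_diff: "rank_one (v - w) y = rank_one v y - rank_one w y"
  by (auto intro!: blinfun_eqI simp: blinfun.diff_left scaleR_left_diff_distrib)

lemma rank_one_minus:
  "rank_one (- w) y = - rank_one w y" "rank_one w (- y) = - rank_one w y"
  by (auto intro!: blinfun_eqI simp: blinfun.minus_left)

lemma rank_one_zero [simp]: "rank_one 0 y = 0" "rank_one w 0 = 0"
  by (auto intro!: blinfun_eqI)

lemma admissible_Nil [simp]: "admissible a b t []"
  by (simp add: admissible_iff)

lemma admissible_append:
  assumes "admissible a b s ps" "admissible a b t qs" "0 \<le> s" "0 \<le> t"
  shows "admissible a b (s + t) (ps @ qs)"
  using assms by (auto simp: admissible_iff ennreal_plus intro!: add_mono)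

lemma admissible_mono: "admissible a b s ps \<Longrightarrow> s \<le> t \<Longrightarrow> admissible a b t ps"
  using ennreal_leI[of s t] by (fastforce simp: admissible_iff intro: order_trans)

text \<open>The exponents are chosen so that the tensor is multiplied by c and both costs by at most
  c. Since \<open>0 powr a = 0\<close> for every \<open>a\<close>, the factor 0 gives the zero pair
  even when an exponent is 0.\<close>

definition scale_pair :: "real \<Rightarrow> real \<Rightarrow> real \<Rightarrow> 'w::real_vector \<times> 'y::real_vector \<Rightarrow> 'w \<times> 'y" where
  "scale_pair a b c P = (c powr a *\<^sub>R fst P, c powr b *\<^sub>R snd P)"

lemma rank_one_scale_pair:
  assumes "a + b = 1" "0 \<le> c"
  shows "rank_one (fst (scale_pair a b c P)) (snd (scale_pair a b c P)) = c *\<^sub>R rank_one (fst P) (snd P)"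
proof -
  have "c powr a * c powr b = c" using assms by (simp flip: powr_add)
  then show ?thesis by (simp add: scale_pair_def rank_one_scaleR mult.commute)
qed

lemma tensor_scale_pair:
  assumes "a + b = 1" "0 \<le> c"
  shows "tensor (map (scale_pair a b c) ps) = c *\<^sub>R tensor ps"
  by (induction ps) (simp_all add: rank_one_scale_pair[OF assms] scaleR_right_distrib)

lemma scale_pair_cost:
  assumes "0 \<le> a" "0 \<le> b" "0 \<le> c"
  shows "pcost a (norm (fst (scale_pair a b c P))) \<le> ennreal c * pcost a (norm (fst P))"
    and "pcost b (blinfun_apply F (snd (scale_pair a b c P))) \<le> ennreal c * pcost b (blinfun_apply F (snd P))"
  using pcost_scale[of a c "norm (fst P)"] pcost_scale[of b c "F (snd P)"] assms
  by (simp_all add: scale_pair_def blinfun.scaleR_right)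

lemma scale_pair_costs:
  assumes "0 \<le> a" "0 \<le> b" "0 \<le> c"
  shows "(\<Sum>P\<leftarrow>map (scale_pair a b c) ps. pcost a (norm (fst P))) \<le> ennreal c * (\<Sum>P\<leftarrow>ps. pcost a (norm (fst P)))"
    and "(\<Sum>P\<leftarrow>map (scale_pair a b c) ps. pcost b (blinfun_apply F (snd P)))
        \<le> ennreal c * (\<Sum>P\<leftarrow>ps. pcost b (blinfun_apply F (snd P)))"
  by (induction ps) (simp_all add: distrib_left add_mono scale_pair_cost(1,2)[OF assms])

lemma admissible_scale:
  assumes "0 \<le> a" "0 \<le> b" "0 \<le> c" "0 \<le> t" "admissible a b t ps"
  shows "admissible a b (c * t) (map (scale_pair a b c) ps)"
  unfolding admissible_iff
proof (intro conjI allI impI)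
  show "\<forall>P\<in>set (map (scale_pair a b c) ps). 0 \<le> snd P"
    using assms by (auto simp: admissible_iff scale_pair_def scaleR_nonneg_nonneg)
  have *: "ennreal c * x \<le> ennreal (c * t)" if "x \<le> ennreal t" for x
    using that assms by (simp add: ennreal_mult mult_left_mono)
  show "(\<Sum>P\<leftarrow>map (scale_pair a b c) ps. pcost a (norm (fst P))) \<le> ennreal (c * t)"
    using assms(5) by (intro order_trans[OF scale_pair_costs(1)[OF assms(1-3)] *]) (simp add: admissible_iff)
  show "(\<Sum>P\<leftarrow>map (scale_pair a b c) ps. pcost b (blinfun_apply F (snd P))) \<le> ennreal (c * t)" if "norm F \<le> 1" for F
    using assms(5) that by (intro order_trans[OF scale_pair_costs(2)[OF assms(1-3)] *]) (simp add: admissible_iff)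
qed

lemma sum_list_ennreal_le:
  assumes "\<And>x. x \<in> set xs \<Longrightarrow> ennreal (f x) \<le> g x" "(\<Sum>x\<leftarrow>xs. g x) \<le> ennreal t"
    and "\<And>x. x \<in> set xs \<Longrightarrow> 0 \<le> f x" "0 \<le> t"
  shows "(\<Sum>x\<leftarrow>xs. f x) \<le> t"
proof -
  have "ennreal (\<Sum>x\<leftarrow>xs. f x) = (\<Sum>x\<leftarrow>xs. ennreal (f x))"
    using assms(3) by (induction xs) (auto intro!: ennreal_plus sum_list_nonneg)
  also have "\<dots> \<le> (\<Sum>x\<leftarrow>xs. g x)" using assms(1) by (intro sum_list_mono) auto
  also note assms(2)
  finally show ?thesis using assms(4) by simp
qed

lemma norm_tensor_le:
  assumes ab: "0 \<le> a" "0 \<le> b" "a + b = 1" and t: "0 \<le> t" and ps: "admissible a b t ps"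
  shows "norm (tensor ps) \<le> 2 * t"
proof (rule norm_blinfun_bound)
  fix f
  obtain F :: "'b dual" where F: "norm F \<le> 1" "F (tensor ps f) = norm (tensor ps f)"
    by (rule norming_functional)
  have "F (tensor ps f) = (\<Sum>P\<leftarrow>ps. blinfun_apply (fst P) f * F (snd P))"
    by (induction ps) (simp_all add: blinfun.add_left blinfun.add_right blinfun.scaleR_right)
  also have "\<dots> \<le> (\<Sum>P\<leftarrow>ps. norm f * (norm (fst P) * \<bar>F (snd P)\<bar>))"
  proof (rule sum_list_mono)
    fix P :: "'a dual \<times> 'b"
    have "fst P f * F (snd P) \<le> \<bar>fst P f\<bar> * \<bar>F (snd P)\<bar>" by (metis abs_ge_self abs_mult)
    also have "\<dots> \<le> (norm (fst P) * norm f) * \<bar>F (snd P)\<bar>"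
      using norm_blinfun[of "fst P" f] by (intro mult_right_mono) auto
    finally show "fst P f * F (snd P) \<le> norm f * (norm (fst P) * \<bar>F (snd P)\<bar>)" by (simp add: ac_simps)
  qed
  also have "\<dots> = norm f * (\<Sum>P\<leftarrow>ps. norm (fst P) * \<bar>F (snd P)\<bar>)" by (simp add: sum_list_const_mult)
  also have "\<dots> \<le> norm f * (2 * t)"
  proof (intro mult_left_mono sum_list_ennreal_le)
    show "ennreal (norm (fst P) * \<bar>F (snd P)\<bar>) \<le> pcost a (norm (fst P)) + pcost b (blinfun_apply F (snd P))" for P
      using mult_le_pcost_sum[OF ab, of "norm (fst P)" "\<bar>F (snd P)\<bar>"] by simp
    have "(\<Sum>P\<leftarrow>ps. pcost a (norm (fst P)) + pcost b (blinfun_apply F (snd P))) \<le> ennreal t + ennreal t"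
      using ps F(1) unfolding sum_list_addf by (intro add_mono) (auto simp: admissible_iff)
    then show "(\<Sum>P\<leftarrow>ps. pcost a (norm (fst P)) + pcost b (blinfun_apply F (snd P))) \<le> ennreal (2 * t)"
      using t by (simp flip: ennreal_plus)
  qed (use t in auto)
  finally show "norm (tensor ps f) \<le> 2 * t * norm f"
    using F(2) by (simp add: mult.commute)
qed (use t in simp)

text \<open>Unit vectors have cost at most 1 for every exponent; the product of the norms is then
  put back by \<open>scale_pair\<close>.\<close>

lemma admissible_single:
  fixes w :: "('f::real_normed_vector) dual" and y :: "'y::banach_lattice"
  assumes ab: "0 \<le> a" "0 \<le> b" "a + b = 1" and y: "0 \<le> y"
  obtains P where "admissible a b (norm w * norm y) [P]" "tensor [P] = rank_one w y"
proof (cases "w = 0 \<or> y = 0")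
  case True
  then show ?thesis by (intro that[of "(0, 0)"]) (auto simp: admissible_iff blinfun.zero_right)
next
  case False
  let ?t = "norm w * norm y" and ?P = "(w /\<^sub>R norm w, y /\<^sub>R norm y)"
  have "admissible a b 1 [?P]"
    using ab y False norm_le_one_apply[where 'b = real, of _ "y /\<^sub>R norm y"]
    by (auto simp: admissible_iff scaleR_nonneg_nonneg intro!: pcost_le_one)
  then have "admissible a b (?t * 1) (map (scale_pair a b ?t) [?P])"
    using ab by (intro admissible_scale) auto
  moreover have "tensor (map (scale_pair a b ?t) [?P]) = rank_one w y"
  proof -
    have "?t * (inverse (norm y) * inverse (norm w)) = 1" using False by (simp add: field_simps)
    then show ?thesis using tensor_scale_pair[OF ab(3), of ?t "[?P]"] by (simp add: rank_one_scaleR)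
  qed
  ultimately show ?thesis by (intro that[of "scale_pair a b ?t ?P"]) simp_all
qed

section \<open>Separation in the space of finite tensors\<close>

definition finite_tensors :: "('f::real_normed_vector \<Rightarrow>\<^sub>L 'y::banach_lattice) set" where
  "finite_tensors = {tensor ps |ps. \<forall>P\<in>set ps. 0 \<le> snd P}"

text \<open>The nuclear norm on finite tensors, which are identified with the operators they induce.
  Outside \<open>finite_tensors\<close> it is the infimum of an empty set; this is why sublinearity
  is formulated relative to a subspace.\<close>

definition tensor_gauge :: "real \<Rightarrow> real \<Rightarrow> ('f::real_normed_vector \<Rightarrow>\<^sub>L 'y::banach_lattice) \<Rightarrow> real" where
  "tensor_gauge a b R = Inf {t. 0 \<le> t \<and> (\<exists>ps. admissible a b t ps \<and> tensor ps = R)}"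

lemma subspace_finite_tensors: "subspace (finite_tensors :: ('f::real_normed_vector \<Rightarrow>\<^sub>L 'y::banach_lattice) set)"
proof (rule subspaceI)
  show "0 \<in> (finite_tensors :: ('f \<Rightarrow>\<^sub>L 'y) set)" by (auto simp: finite_tensors_def intro!: exI[of _ "[]"])
  show "R + R' \<in> finite_tensors" if "R \<in> finite_tensors" "R' \<in> finite_tensors" for R R' :: "'f \<Rightarrow>\<^sub>L 'y"
  proof -
    obtain ps ps' where "R = tensor ps" "\<forall>P\<in>set ps. 0 \<le> snd P" "R' = tensor ps'" "\<forall>P\<in>set ps'. 0 \<le> snd P"
      using \<open>R \<in> finite_tensors\<close> \<open>R' \<in> finite_tensors\<close> unfolding finite_tensors_def by blast
    then show ?thesis unfolding finite_tensors_def by (intro CollectI exI[of _ "ps @ ps'"]) (simp add: ball_Un)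
  qed
  show "c *\<^sub>R R \<in> finite_tensors" if "R \<in> finite_tensors" for c and R :: "'f \<Rightarrow>\<^sub>L 'y"
  proof -
    obtain ps where ps: "R = tensor ps" "\<forall>P\<in>set ps. 0 \<le> snd P"
      using \<open>R \<in> finite_tensors\<close> unfolding finite_tensors_def by blast
    have "c *\<^sub>R tensor ps = tensor (map (\<lambda>P. (c *\<^sub>R fst P, snd P)) ps)"
      by (induction ps) (auto simp: rank_one_scaleR scaleR_right_distrib)
    then show ?thesis using ps by (auto simp: finite_tensors_def intro!: exI[of _
        "map (\<lambda>P. (c *\<^sub>R fst P, snd P)) ps"])
  qed
qed

lemma rank_one_finite_tensors: "rank_one w y \<in> (finite_tensors :: ('f::real_normed_vector \<Rightarrow>\<^sub>L
    'y::banach_lattice) set)"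
proof -
  have "rank_one w y = rank_one w (pprt y + nprt y)" by (simp flip: prts)
  also have "\<dots> = tensor [(w, pprt y), (- w, - nprt y)]" by (simp add: rank_one_add rank_one_minus)
  finally show ?thesis unfolding finite_tensors_def
    by (intro CollectI exI[of _ "[(w, pprt y), (- w, - nprt y)]"]) auto
qed

lemma tensor_finite_tensors: "tensor ps \<in> finite_tensors"
  by (induction ps)
    (auto intro: subspace_add[OF subspace_finite_tensors] subspace_0[OF subspace_finite_tensors]
        rank_one_finite_tensors)

context
  fixes a b :: real
  assumes ab: "0 \<le> a" "0 \<le> b" "a + b = 1"
begin

lemma finite_tensors_admissible:
  assumes "R \<in> finite_tensors"
  shows "\<exists>t ps. 0 \<le> t \<and> admissible a b t ps \<and> tensor ps = R"
proof -
  obtain ps where R: "R = tensor ps" "\<forall>P\<in>set ps. 0 \<le> snd P" using assms by (auto simp: finite_tensors_def)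
  from R(2) have "\<exists>t qs. 0 \<le> t \<and> admissible a b t qs \<and> tensor qs = tensor ps"
  proof (induction ps)
    case Nil
    then show ?case by (auto intro!: exI[of _ 0] exI[of _ "[]"])
  next
    case (Cons P ps)
    then obtain t qs where 1: "0 \<le> t" "admissible a b t qs" "tensor qs = tensor ps" by auto
    obtain Q where 2: "admissible a b (norm (fst P) * norm (snd P)) [Q]" "tensor [Q] = rank_one (fst P) (snd P)"
      using admissible_single[OF ab, of "snd P" "fst P"] Cons.prems by auto
    have "admissible a b (norm (fst P) * norm (snd P) + t) ([Q] @ qs)"
      using 1 2 by (intro admissible_append) auto
    with 1 2 show ?case
      by (intro exI[of _ "norm (fst P) * norm (snd P) + t"] exI[of _ "Q # qs"]) auto
  qed
  with R show ?thesis by simp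
qed

lemma tensor_gauge_le: "admissible a b t ps \<Longrightarrow> 0 \<le> t \<Longrightarrow> tensor_gauge a b (tensor ps) \<le> t"
  unfolding tensor_gauge_def by (rule cInf_lower) (auto intro: bdd_belowI[of _ 0])

lemma tensor_gauge_greatest:
  assumes "R \<in> finite_tensors" "\<And>t ps. 0 \<le> t \<Longrightarrow> admissible a b t ps \<Longrightarrow> tensor ps = R \<Longrightarrow> c \<le> t"
  shows "c \<le> tensor_gauge a b R"
  unfolding tensor_gauge_def
  by (rule cInf_greatest) (use finite_tensors_admissible[OF assms(1)] assms(2) in auto)

lemma sublinear_tensor_gauge: "sublinear_on finite_tensors (tensor_gauge a b)"
proof (rule sublinear_onI[OF subspace_finite_tensors])
  fix R R' :: "'a \<Rightarrow>\<^sub>L 'b" assume R: "R \<in> finite_tensors" "R' \<in> finite_tensors"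
  have *: "tensor_gauge a b (R + R') \<le> t + t'"
    if "0 \<le> t" "admissible a b t ps" "tensor ps = R" "0 \<le> t'" "admissible a b t' ps'" "tensor ps' = R'"
    for t t' ps ps'
    using tensor_gauge_le[OF admissible_append[OF that(2,5,1,4)]] that by simp
  have "tensor_gauge a b (R + R') - tensor_gauge a b R' \<le> t"
    if "0 \<le> t" "admissible a b t ps" "tensor ps = R" for t ps
  proof -
    have "tensor_gauge a b (R + R') - t \<le> tensor_gauge a b R'"
      using *[OF that] by (intro tensor_gauge_greatest R) (simp add: algebra_simps)
    then show ?thesis by simp
  qed
  then have "tensor_gauge a b (R + R') - tensor_gauge a b R' \<le> tensor_gauge a b R"
    by (intro tensor_gauge_greatest R)
  then show "tensor_gauge a b (R + R') \<le> tensor_gauge a b R + tensor_gauge a b R'" by simp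
next
  fix c :: real and R :: "'a \<Rightarrow>\<^sub>L 'b" assume c: "0 < c" and R: "R \<in> finite_tensors"
  have "inverse c * tensor_gauge a b (c *\<^sub>R R) \<le> tensor_gauge a b R"
  proof (rule tensor_gauge_greatest[OF R])
    fix t ps assume t: "0 \<le> t" "admissible a b t ps" "tensor ps = R"
    have "tensor_gauge a b (c *\<^sub>R R) \<le> c * t"
      using tensor_gauge_le[OF admissible_scale[OF ab(1,2) _ t(1,2), of c]] c t
      by (simp add: tensor_scale_pair[OF ab(3)])
    then show "inverse c * tensor_gauge a b (c *\<^sub>R R) \<le> t" using c by (simp add: field_simps)
  qed
  then show "tensor_gauge a b (c *\<^sub>R R) \<le> c * tensor_gauge a b R" using c by (simp add: field_simps)
next
  have "0 \<le> tensor_gauge a b (0 :: 'a \<Rightarrow>\<^sub>L 'b)"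
    by (intro tensor_gauge_greatest subspace_0[OF subspace_finite_tensors])
  then show "tensor_gauge a b (0 :: 'a \<Rightarrow>\<^sub>L 'b) = 0"
    using tensor_gauge_le[of 0 "[] :: ('a dual \<times> 'b) list"] by simp
qed

lemma norm_pprt_le: "norm (pprt y) \<le> norm (y::'y::banach_lattice)"
  and norm_nprt_le: "norm (nprt y) \<le> norm y"
proof -
  have 0: "0 \<le> pprt y" "0 \<le> - nprt y" by simp_all
  have "- (pprt y + - nprt y) \<le> pprt y" "pprt y \<le> pprt y + - nprt y"
    using 0 add_nonneg_nonneg[OF 0] by (auto intro: order_trans[of _ 0])
  from norm_le_of_order_interval[OF this] norm_prts_le[of y]
  show "norm (pprt y) \<le> norm y" by simp
  have "- (pprt y + - nprt y) \<le> - nprt y" "- nprt y \<le> pprt y + - nprt y"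
    using 0 add_nonneg_nonneg[OF 0] by (auto intro: order_trans[of _ 0])
  from norm_le_of_order_interval[OF this] norm_prts_le[of y]
  show "norm (nprt y) \<le> norm y" by simp
qed

text \<open>Trace duality: through its values at \<open>rank_one w y\<close>, a functional dominated
  by the gauge is a bilinear form in w and y, that is, an operator. For positive y the form is
  bounded by the product of the norms; splitting y into positive and negative parts gives twice this
  bound in general.\<close>

theorem tensor_separation:
  fixes K :: "('f::real_normed_vector \<Rightarrow>\<^sub>L 'y::banach_lattice) set"
  assumes K: "convex K" "K \<subseteq> finite_tensors" "K \<noteq> {}"
    and far: "\<And>t ps. 0 \<le> t \<Longrightarrow> admissible a b t ps \<Longrightarrow> tensor ps \<in> K \<Longrightarrow> c \<le> t"
  obtains D :: "'y \<Rightarrow>\<^sub>L 'f dual dual"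
  where "\<And>t ps. 0 \<le> t \<Longrightarrow> admissible a b t ps \<Longrightarrow> (\<Sum>P\<leftarrow>ps. D (snd P) (fst P)) \<le> t"
    "\<And>ps. tensor ps \<in> K \<Longrightarrow> c \<le> (\<Sum>P\<leftarrow>ps. D (snd P) (fst P))"
proof -
  have "c \<le> tensor_gauge a b k" if "k \<in> K" for k
    using that K far by (intro tensor_gauge_greatest) auto
  then obtain f where f: "\<And>R R'. R \<in> finite_tensors \<Longrightarrow> R' \<in> finite_tensors \<Longrightarrow> f (R + R') = f R + f R'"
    "\<And>r R. R \<in> finite_tensors \<Longrightarrow> f (r *\<^sub>R R) = r * f R"
    "\<And>R. R \<in> finite_tensors \<Longrightarrow> f R \<le> tensor_gauge a b R" "\<And>k. k \<in> K \<Longrightarrow> c \<le> f k"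
    using hahn_banach_separation[OF subspace_finite_tensors sublinear_tensor_gauge K] by metis
  note R1 = rank_one_finite_tensors
  define B where "B y w = f (rank_one w y)" for w :: "'f dual" and y :: 'y
  have B_pos: "B y w \<le> norm w * norm y" if y: "0 \<le> y" for y w
  proof -
    obtain P where P: "admissible a b (norm w * norm y) [P]" "tensor [P] = rank_one w y"
      using admissible_single[OF ab y] by blast
    have "B y w \<le> tensor_gauge a b (rank_one w y)" unfolding B_def by (rule f(3)[OF R1])
    also have "\<dots> \<le> norm w * norm y" using tensor_gauge_le[OF P(1)] P(2) by simp
    finally show ?thesis .
  qed
  have B_add: "B y (v + w) = B y v + B y w" "B (x + y) w = B x w + B y w" for x y v w
    by (simp_all add: B_def rank_one_add f(1) R1)
  have B_scale: "B y (r *\<^sub>R w) = r * B y w" "B (r *\<^sub>R y) w = r * B y w" for y w r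
    by (simp_all add: B_def rank_one_scaleR f(2) R1)
  have B_le: "B y w \<le> 2 * norm y * norm w" for y w
  proof -
    have "B y w = B (pprt y + (- 1) *\<^sub>R (- nprt y)) w" by (simp flip: prts)
    also have "\<dots> = B (pprt y) w + B (- nprt y) ((- 1) *\<^sub>R w)" by (simp only: B_add B_scale)
    also have "\<dots> \<le> norm w * norm (pprt y) + norm ((- 1) *\<^sub>R w) * norm (- nprt y)"
      by (intro add_mono B_pos) simp_all
    also have "\<dots> \<le> norm w * norm y + norm w * norm y"
      using add_mono[OF mult_left_mono[OF norm_pprt_le[of y] norm_ge_zero[of w]]
          mult_left_mono[OF norm_nprt_le[of y] norm_ge_zero[of w]]] by simp
    finally show ?thesis by simp
  qed
  have B_abs: "\<bar>B y w\<bar> \<le> 2 * norm y * norm w" for y w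
    using B_le[of y w] B_le[of y "(- 1) *\<^sub>R w"] B_scale(1)[of y "- 1" w] by simp
  define d where "d y = Blinfun (B y)" for y
  have "bounded_linear (B y)" for y
    by (rule bounded_linear_intro[of _ "2 * norm y"])
      (use B_abs in \<open>auto simp: B_add B_scale mult.commute[of "norm _"]\<close>)
  then have d: "blinfun_apply (d y) = B y" for y by (simp add: d_def bounded_linear_Blinfun_apply)
  have "norm (d y) \<le> norm y * 2" for y
    by (rule norm_blinfun_bound) (use B_abs[of y] in \<open>auto simp: d mult.commute\<close>)
  then have "bounded_linear d"
    by (intro bounded_linear_intro[of _ 2])
      (auto intro!: blinfun_eqI simp: d B_add B_scale blinfun.add_left blinfun.scaleR_left)
  then have D: "Blinfun d y w = f (rank_one w y)" for y w
    by (simp add: bounded_linear_Blinfun_apply d B_def)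
  have f0: "f 0 = 0" using f(1)[of 0 0] subspace_0[OF subspace_finite_tensors] by simp
  have sum: "(\<Sum>P\<leftarrow>ps. Blinfun d (snd P) (fst P)) = f (tensor ps)" for ps
    by (induction ps) (simp_all add: D f0 f(1) R1 tensor_finite_tensors)
  show ?thesis
  proof (rule that[of "Blinfun d"])
    show "(\<Sum>P\<leftarrow>ps. Blinfun d (snd P) (fst P)) \<le> t" if "0 \<le> t" "admissible a b t ps" for t ps
      using f(3)[OF tensor_finite_tensors, of ps] tensor_gauge_le[OF that(2,1)] by (simp add: sum)
    show "c \<le> (\<Sum>P\<leftarrow>ps. Blinfun d (snd P) (fst P))" if "tensor ps \<in> K" for ps
      using f(4)[OF that] by (simp add: sum)
  qed
qed

end

lemma almost_norming:
  fixes g :: "('w::real_normed_vector) dual"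
  assumes "0 < \<delta>"
  shows "\<exists>w. norm w \<le> 1 \<and> (1 - \<delta>) * norm g \<le> g w"
proof (rule ccontr)
  assume "\<not> ?thesis"
  then have lt: "g w < (1 - \<delta>) * norm g" if "norm w \<le> 1" for w using that by force
  from lt[of 0] have pos: "0 < (1 - \<delta>) * norm g" by simp
  have "norm g \<le> (1 - \<delta>) * norm g"
  proof (rule norm_blinfun_bound)
    fix w
    show "norm (g w) \<le> (1 - \<delta>) * norm g * norm w"
    proof (cases "w = 0")
      case False
      have "g (w /\<^sub>R norm w) < (1 - \<delta>) * norm g" "g (- (w /\<^sub>R norm w)) < (1 - \<delta>) * norm g"
        using False by (intro lt; simp)+
      then show ?thesis
        using False by (auto simp: blinfun.scaleR_right blinfun.minus_right field_simps abs_le_iff)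
    qed simp
  qed (use pos in simp)
  then have "\<delta> * norm g \<le> 0" by (simp add: algebra_simps)
  with assms have "norm g = 0" by (simp add: mult_le_0_iff)
  with pos show False by simp
qed

text \<open>Multiplying each weight by a vector that almost norms \<open>D y\<close> turns a bound
  on traces into one on sums of norms. These vectors have norm at most 1, so the cost does not grow;
  the deficiency \<open>\<delta>\<close> then tends to 0.\<close>

lemma weight_bound_norm_sum:
  fixes D :: "'y::banach_lattice \<Rightarrow>\<^sub>L ('f::real_normed_vector) dual dual"
  assumes a: "0 \<le> a" and D: "\<And>t ps. 0 \<le> t \<Longrightarrow> admissible a b t ps \<Longrightarrow> (\<Sum>P\<leftarrow>ps. D (snd P) (fst P)) \<le> t"
    and t: "0 \<le> t" and cs: "weight_bound a b t cs" and nn: "\<And>C. C \<in> set cs \<Longrightarrow> 0 \<le> fst C"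
  shows "(\<Sum>C\<leftarrow>cs. fst C * norm (D (snd C))) \<le> t"
proof -
  let ?s = "\<Sum>C\<leftarrow>cs. fst C * norm (D (snd C))"
  have *: "(1 - \<delta>) * ?s \<le> t" if \<delta>: "0 < \<delta>" for \<delta>
  proof -
    obtain W where W: "\<And>g :: 'f dual dual. norm (W g) \<le> 1 \<and> (1 - \<delta>) * norm g \<le> blinfun_apply g (W g)"
      using almost_norming[OF \<delta>] by metis
    define ps where "ps = map (\<lambda>C. (fst C *\<^sub>R W (D (snd C)), snd C)) cs"
    have "(\<Sum>P\<leftarrow>ps. pcost a (norm (fst P))) \<le> (\<Sum>C\<leftarrow>cs. pcost a (fst C))"
      unfolding ps_def map_map o_def
    proof (rule sum_list_mono)
      fix C assume "C \<in> set cs"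
      then have "\<bar>fst C\<bar> * norm (W (D (snd C))) \<le> \<bar>fst C\<bar> * 1" using W by (intro mult_left_mono) auto
      then show "pcost a (norm (fst (fst C *\<^sub>R W (D (snd C)), snd C))) \<le> pcost a (fst C)"
        using a by (intro pcost_mono) (auto simp: abs_mult)
    qed
    then have "admissible a b t ps"
      using cs by (auto simp: admissible_iff weight_bound_def ps_def o_def)
    from D[OF t this] have "(\<Sum>C\<leftarrow>cs. fst C * D (snd C) (W (D (snd C)))) \<le> t"
      by (simp add: ps_def o_def blinfun.scaleR_right)
    moreover have "(\<Sum>C\<leftarrow>cs. (1 - \<delta>) * (fst C * norm (D (snd C)))) \<le> (\<Sum>C\<leftarrow>cs. fst C * D (snd C) (W (D (snd C))))"
    proof (rule sum_list_mono)
      fix C assume "C \<in> set cs"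
      from mult_left_mono[OF conjunct2[OF W[of "D (snd C)"]] nn[OF this]]
      show "(1 - \<delta>) * (fst C * norm (D (snd C))) \<le> fst C * D (snd C) (W (D (snd C)))"
        by (simp add: ac_simps)
    qed
    ultimately show ?thesis by (simp add: sum_list_const_mult)
  qed
  have "((\<lambda>\<delta>. (1 - \<delta>) * ?s) \<longlongrightarrow> (1 - 0) * ?s) (at_right 0)" by (intro tendsto_intros)
  then have "(1 - 0) * ?s \<le> t"
  proof (rule tendsto_upperbound)
    show "\<forall>\<^sub>F \<delta> in at_right 0. (1 - \<delta>) * ?s \<le> t"
      unfolding eventually_at_filter by (rule always_eventually) (use * in auto)
  qed simp
  then show ?thesis by simp
qed

section \<open>Vanishing traces\<close>

lemma norm_bidual_embedding [simp]: "norm (bidual_embedding x) = norm (x :: 'a::real_normed_vector)"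
proof (rule antisym[OF norm_bidual_embedding_le])
  obtain f :: "'a dual" where f: "norm f \<le> 1" "f x = norm x" by (rule norming_functional)
  have "norm x = bidual_embedding x f" using f by simp
  also have "\<dots> \<le> norm (bidual_embedding x) * norm f" using abs_blinfun_le(1)[of "bidual_embedding x" f] by simp
  also have "\<dots> \<le> norm (bidual_embedding x) * 1" using f(1) by (intro mult_left_mono) auto
  finally show "norm x \<le> norm (bidual_embedding x)" by simp
qed

definition bidual_annihilator :: "('e::real_normed_vector) dual dual dual set" where
  "bidual_annihilator = {G. \<forall>v. blinfun_apply G (bidual_embedding v) = 0}"

text \<open>The complement of Dixmier's projection: composing with the embedding restricts a
  functional on the bidual to E, and the canonical extension of this restriction is
  subtracted.\<close>

definition annihilator_part ::
  "('e::real_normed_vector) dual dual dual \<Rightarrow>\<^sub>L 'e dual dual dual" where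
  "annihilator_part = Blinfun (\<lambda>G. G - bidual_embedding (G o\<^sub>L bidual_embedding))"

lemma annihilator_part_eq:
  fixes G :: "('e::real_normed_vector) dual dual dual"
  shows "annihilator_part G = G - bidual_embedding (G o\<^sub>L bidual_embedding)"
proof -
  have "bounded_linear (\<lambda>G :: 'e dual dual dual. G - bidual_embedding (G o\<^sub>L bidual_embedding))"
    by (intro bounded_linear_sub bounded_linear_ident bounded_linear_compose[OF blinfun.bounded_linear_right]
        bounded_bilinear.bounded_linear_left[OF bounded_bilinear_blinfun_compose])
  then show ?thesis by (simp add: annihilator_part_def bounded_linear_Blinfun_apply)
qed

lemma annihilator_part_apply: "annihilator_part G w = G w - w (G o\<^sub>L bidual_embedding)"
  by (simp add: annihilator_part_eq blinfun.diff_left)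

lemma norm_annihilator_part_le: "norm (annihilator_part G) \<le> 2 * norm G"
proof -
  have "norm (bidual_embedding (G o\<^sub>L bidual_embedding)) \<le> norm G"
  proof (simp, rule norm_blinfun_bound)
    show "norm ((G o\<^sub>L bidual_embedding) v) \<le> norm G * norm v" for v
      using abs_blinfun_le(1)[of G "bidual_embedding v"] by simp
  qed simp
  then show ?thesis
    using norm_triangle_ineq4[of G "bidual_embedding (G o\<^sub>L bidual_embedding)"] by (simp add: annihilator_part_eq)
qed

lemma annihilator_part_in: "annihilator_part G \<in> bidual_annihilator"
  by (simp add: bidual_annihilator_def annihilator_part_apply)

lemma annihilator_part_id: "G \<in> bidual_annihilator \<Longrightarrow> annihilator_part G = G"
proof -
  assume "G \<in> bidual_annihilator"
  then have "G o\<^sub>L bidual_embedding = 0" by (auto simp: bidual_annihilator_def intro!: blinfun_eqI)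
  then show ?thesis by (simp add: annihilator_part_eq blinfun.zero_right)
qed

lemma subspace_bidual_annihilator: "subspace bidual_annihilator"
  by (auto simp: subspace_def bidual_annihilator_def blinfun.add_left blinfun.scaleR_left)

lemma closed_bidual_annihilator: "closed (bidual_annihilator :: ('e::real_normed_vector) dual dual dual set)"
proof -
  have "closed {G. blinfun_apply G (blinfun_apply bidual_embedding v) = (0 :: real)}" for v :: 'e
    by (intro closed_Collect_eq continuous_on_const linear_continuous_on blinfun.bounded_linear_left)
  then have "closed (\<Inter>v. {G. blinfun_apply G (blinfun_apply bidual_embedding (v :: 'e)) = (0 :: real)})"
      by (intro closed_INT) simp
  also have "(\<Inter>v. {G. blinfun_apply G (blinfun_apply bidual_embedding (v :: 'e)) = (0 :: real)}) = bidual_annihilator"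
    by (auto simp: bidual_annihilator_def)
  finally show ?thesis .
qed

text \<open>Restrict the adjoint of S to X and apply f to its values. This sends
  \<open>rank_one v y\<close> to the multiple f(v) of y, and it sends the adjoint of T to 0, because
  the biadjoint of T maps X into E. The dependence on S is continuous, so the partial sums converge
  in the norm of the dual of X.\<close>

lemma annihilator_series_tendsto_0:
  fixes T :: "'x::real_normed_vector \<Rightarrow>\<^sub>L 'e::real_normed_vector"
  assumes T: "(\<lambda>j. rank_one (u j) (x j)) sums blinfun_adjoint T" and f: "f \<in> bidual_annihilator"
  shows "(\<lambda>k. \<Sum>j<k. f (u j) *\<^sub>R x j) \<longlonglongrightarrow> 0"
proof -
  define \<Phi> where "\<Phi> S = f o\<^sub>L (blinfun_adjoint S o\<^sub>L bidual_embedding)" for S :: "'e dual \<Rightarrow>\<^sub>L 'x dual"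
  have \<Phi>: "\<Phi> S z = f (bidual_embedding z o\<^sub>L S)" for S z by (simp add: \<Phi>_def)
  have bl: "bounded_linear \<Phi>"
  proof (rule bounded_linear_intro[of _ "norm f"])
    show "\<Phi> (S + S') = \<Phi> S + \<Phi> S'" for S S'
      by (rule blinfun_eqI)
        (simp add: \<Phi> blinfun.add_left bounded_bilinear.add_right[OF bounded_bilinear_blinfun_compose]
            blinfun.add_right)
    show "\<Phi> (r *\<^sub>R S) = r *\<^sub>R \<Phi> S" for r S
      by (rule blinfun_eqI)
        (simp add: \<Phi> blinfun.scaleR_left bounded_bilinear.scaleR_right[OF bounded_bilinear_blinfun_compose]
            blinfun.scaleR_right)
    show "norm (\<Phi> S) \<le> norm S * norm f" for S
    proof (rule norm_blinfun_bound)
      fix z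
      have "norm (\<Phi> S z) \<le> norm f * norm (bidual_embedding z o\<^sub>L S)" by (simp add: \<Phi> abs_blinfun_le)
      also have "\<dots> \<le> norm f * (norm z * norm S)"
        using norm_blinfun_compose[of "bidual_embedding z" S] by (intro mult_left_mono) auto
      finally show "norm (\<Phi> S z) \<le> norm S * norm f * norm z" by (simp add: ac_simps)
    qed simp
  qed
  have "(\<lambda>k. \<Phi> (\<Sum>j<k. rank_one (u j) (x j))) \<longlonglongrightarrow> \<Phi> (blinfun_adjoint T)"
    using T by (intro bounded_linear.tendsto[OF bl]) (simp add: sums_def)
  moreover have "\<Phi> (\<Sum>j<k. rank_one (u j) (x j)) = (\<Sum>j<k. f (u j) *\<^sub>R x j)" for k
  proof -
    have "\<Phi> (rank_one v y) = f v *\<^sub>R y" for v y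
    proof (rule blinfun_eqI)
      fix z
      have "bidual_embedding z o\<^sub>L rank_one v y = y z *\<^sub>R v"
        by (rule blinfun_eqI) (simp add: blinfun.scaleR_left mult.commute)
      then show "\<Phi> (rank_one v y) z = (f v *\<^sub>R y) z"
        by (simp add: \<Phi> blinfun.scaleR_right blinfun.scaleR_left)
    qed
    then show ?thesis by (simp add: linear_sum[OF bounded_linear.linear[OF bl]])
  qed
  moreover have "\<Phi> (blinfun_adjoint T) = 0"
  proof (rule blinfun_eqI)
    fix z
    have "bidual_embedding z o\<^sub>L blinfun_adjoint T = bidual_embedding (T z)"
      by (rule blinfun_eqI) simp
    then show "\<Phi> (blinfun_adjoint T) z = blinfun_apply 0 z" using f by (simp add: \<Phi> bidual_annihilator_def)
  qed
  ultimately show ?thesis by simp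
qed

definition seq_admissible ::
  "real \<Rightarrow> real \<Rightarrow> real \<Rightarrow> (nat \<Rightarrow> ('f::real_normed_vector) dual) \<Rightarrow> (nat \<Rightarrow> 'y::banach_lattice) \<Rightarrow> bool" where
  "seq_admissible a b t u x \<longleftrightarrow> (\<forall>k. admissible a b t (map (\<lambda>j. (u j, x j)) [0..<k]))"

lemma sum_list_upt: "(\<Sum>j\<leftarrow>[m..<n]. f j) = sum f {m..<n}"
  by (simp add: interv_sum_list_conv_sum_set_nat)

lemma seq_admissible_iff:
  "seq_admissible a b t u x \<longleftrightarrow> (\<forall>j. 0 \<le> x j) \<and> (\<forall>k. (\<Sum>j<k. pcost a (norm (u j))) \<le> ennreal t) \<and>
     (\<forall>F. norm F \<le> 1 \<longrightarrow> (\<forall>k. (\<Sum>j<k. pcost b (blinfun_apply F (x j))) \<le> ennreal t))"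
  by (auto simp: seq_admissible_def admissible_iff o_def sum_list_upt atLeast0LessThan)

text \<open>No convergent series converges slowest: the inverse square roots of the tails
  \<open>t j\<close> serve as multipliers, since the new terms are dominated by the telescoping
  differences of \<open>2 * sqrt (t j)\<close>.\<close>

lemma summable_multiplier:
  fixes c :: "nat \<Rightarrow> real"
  assumes c: "\<And>j. 0 < c j" "summable c"
  obtains m where "\<And>j. 0 < m j" "(\<lambda>j. 1 / m j) \<longlonglongrightarrow> 0" "summable (\<lambda>j. m j * c j)"
proof -
  define t where "t j = (\<Sum>i. c (i + j))" for j
  have t_Suc: "t j = c j + t (Suc j)" for j
    using suminf_split_head[of "\<lambda>i. c (i + j)"] summable_ignore_initial_segment[OF c(2), of j] by (simp add: t_def)
  have t_pos: "0 < t j" for j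
    unfolding t_def using summable_ignore_initial_segment[OF c(2), of j] c(1) by (intro suminf_pos) auto
  have t_lim: "t \<longlonglongrightarrow> 0" unfolding t_def[abs_def] by (rule suminf_exist_split2[OF c(2)])
  define m where "m j = 1 / sqrt (t j)" for j
  have s_lim: "(\<lambda>j. sqrt (t j)) \<longlonglongrightarrow> 0" using tendsto_real_sqrt[OF t_lim] by simp
  have le: "m j * c j \<le> 2 * (sqrt (t j) - sqrt (t (Suc j)))" for j
  proof -
    let ?s = "sqrt (t j)" and ?r = "sqrt (t (Suc j))"
    have sr: "0 < ?s" "0 < ?r" "?r \<le> ?s" using t_pos[of j] t_pos[of "Suc j"] t_Suc[of j] c(1)[of j] by simp_all
    have "c j = ?s * ?s - ?r * ?r" using t_Suc[of j] t_pos[of j] t_pos[of "Suc j"] by simp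
    also have "\<dots> = (?s - ?r) * (?s + ?r)" by (simp add: algebra_simps)
    also have "\<dots> \<le> (?s - ?r) * (2 * ?s)" using sr by (intro mult_left_mono) auto
    finally show ?thesis using sr by (simp add: m_def field_simps)
  qed
  show ?thesis
  proof (rule that[of m])
    show "0 < m j" for j using t_pos by (simp add: m_def)
    show "(\<lambda>j. 1 / m j) \<longlonglongrightarrow> 0" using s_lim by (simp add: m_def)
    have "summable (\<lambda>j. 2 * (sqrt (t j) - sqrt (t (Suc j))))"
      using telescope_summable'[OF s_lim] by (intro summable_mult)
    then show "summable (\<lambda>j. m j * c j)"
      by (rule summable_comparison_test') (use le c(1) t_pos in \<open>auto simp: m_def abs_mult less_imp_le\<close>)
  qed
qed

lemma compact_insert_limit:
  fixes l :: "'a::topological_space"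
  assumes "f \<longlonglongrightarrow> l"
  shows "compact (insert l (range f))"
proof (rule compactI)
  fix C assume C: "\<forall>U\<in>C. open U" "insert l (range f) \<subseteq> \<Union>C"
  then obtain U where U: "U \<in> C" "l \<in> U" by auto
  with assms C(1) have "\<forall>\<^sub>F n in sequentially. f n \<in> U" by (intro topological_tendstoD) auto
  then obtain N where N: "\<And>n. n \<ge> N \<Longrightarrow> f n \<in> U" by (auto simp: eventually_sequentially)
  have "\<forall>n\<in>{..<N}. \<exists>V\<in>C. f n \<in> V" using C(2) by auto
  then obtain V where V: "\<And>n. n < N \<Longrightarrow> V n \<in> C \<and> f n \<in> V n" by (metis lessThan_iff)
  have "f n \<in> \<Union>(insert U (V ` {..<N}))" for n by (cases "n < N") (use N V in auto)
  with U V show "\<exists>C'\<subseteq>C. finite C' \<and> insert l (range f) \<subseteq> \<Union>C'"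
    by (intro exI[of _ "insert U (V ` {..<N})"]) auto
qed

text \<open>Additivity gives homogeneity for natural factors. Monotonicity squeezes m c between
  consecutive integers, which leaves an error \<open>\<rho> y / m\<close> after division by
  m.\<close>

lemma dominated_homogeneous:
  assumes dom: "dominated D \<rho>" and y: "0 \<le> y" and c: "0 \<le> c"
  shows "\<rho> (c *\<^sub>R y) = c * \<rho> y"
proof -
  have cy: "0 \<le> c *\<^sub>R y" using y c by (simp add: scaleR_nonneg_nonneg)
  have *: "\<bar>\<rho> (c *\<^sub>R y) - c * \<rho> y\<bar> \<le> \<rho> y / real m" if m: "0 < m" for m :: nat
  proof -
    define k where "k = nat \<lfloor>real m * c\<rfloor>"
    have k: "real k \<le> real m * c" "real m * c \<le> real (Suc k)"
      using c real_of_int_floor_add_one_ge[of "real m * c"] by (auto simp: k_def add.commute)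
    have "real k *\<^sub>R y \<le> real m *\<^sub>R (c *\<^sub>R y)" "real m *\<^sub>R (c *\<^sub>R y) \<le> real (Suc k) *\<^sub>R y"
      using k y by (auto intro: scaleR_right_mono simp del: of_nat_Suc)
    then have "\<rho> (real k *\<^sub>R y) \<le> \<rho> (real m *\<^sub>R (c *\<^sub>R y))" "\<rho> (real m *\<^sub>R (c *\<^sub>R y)) \<le> \<rho> (real (Suc k) *\<^sub>R y)"
      using y cy c by (auto intro!: dominated_mono[OF dom] scaleR_nonneg_nonneg simp del: of_nat_Suc)
    then have "real k * \<rho> y \<le> real m * \<rho> (c *\<^sub>R y)" "real m * \<rho> (c *\<^sub>R y) \<le> real (Suc k) * \<rho> y"
      unfolding dominated_functional_mult[OF dom y] dominated_functional_mult[OF dom cy] by simp_all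
    moreover have "real k * \<rho> y \<le> (real m * c) * \<rho> y" "(real m * c) * \<rho> y \<le> real (Suc k) * \<rho> y"
      using k dominated_nonneg[OF dom y] by (auto intro: mult_right_mono simp del: of_nat_Suc)
    ultimately have "\<bar>real m * \<rho> (c *\<^sub>R y) - real m * c * \<rho> y\<bar> \<le> \<rho> y"
      by (simp add: algebra_simps abs_le_iff)
    also have "real m * \<rho> (c *\<^sub>R y) - real m * c * \<rho> y = real m * (\<rho> (c *\<^sub>R y) - c * \<rho> y)"
      by (simp add: algebra_simps)
    finally show ?thesis using m by (simp add: abs_mult pos_le_divide_eq mult.commute)
  qed
  have "(\<lambda>m. \<rho> y / real m) \<longlonglongrightarrow> 0" by (rule lim_const_over_n)
  then have "\<bar>\<rho> (c *\<^sub>R y) - c * \<rho> y\<bar> \<le> 0"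
    by (rule tendsto_lowerbound) (auto intro!: eventually_sequentiallyI[of 1] *)
  then show ?thesis by simp
qed

text \<open>Exchanging the sums turns the trace into finitely many continuous functionals, evaluated
  at partial sums that tend to 0 by \<open>annihilator_series_tendsto_0\<close>.\<close>

lemma finite_rank_trace_tendsto_0:
  fixes T :: "'x::real_normed_vector \<Rightarrow>\<^sub>L 'e::real_normed_vector"
    and g :: "'i \<Rightarrow> 'x dual dual"
  assumes T: "(\<lambda>j. rank_one (u j) (x j)) sums blinfun_adjoint T"
    and f: "\<And>i. i \<in> I \<Longrightarrow> f i \<in> bidual_annihilator"
  shows "(\<lambda>k. \<Sum>j<k. (\<Sum>i\<in>I. g i (x j) *\<^sub>R f i) (u j)) \<longlonglongrightarrow> 0"
proof -
  have "(\<lambda>k. \<Sum>i\<in>I. g i (\<Sum>j<k. f i (u j) *\<^sub>R x j)) \<longlonglongrightarrow> (\<Sum>i\<in>I. g i 0)"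
    by (intro tendsto_sum blinfun.tendsto tendsto_const annihilator_series_tendsto_0[OF T f])
  moreover have "(\<Sum>i\<in>I. g i (\<Sum>j<k. f i (u j) *\<^sub>R x j)) = (\<Sum>j<k. (\<Sum>i\<in>I. g i (x j) *\<^sub>R f i) (u j))" for k
    by (simp add: blinfun.sum_right blinfun.sum_left blinfun.scaleR_right blinfun.scaleR_left mult.commute)
      (rule sum.swap)
  ultimately show ?thesis by (simp add: blinfun.zero_right)
qed

text \<open>The common frame of the three cases below: it suffices to approximate the
  \<open>H j\<close>, in the l1-norm weighted by \<open>norm (u j)\<close>, by functionals with
  vanishing trace.\<close>

lemma pairing_sum_tendsto_0:
  fixes H :: "nat \<Rightarrow> ('w::real_normed_vector) dual"
  assumes "\<And>\<eta>. 0 < \<eta> \<Longrightarrow> \<exists>G. (\<forall>k. (\<Sum>j<k. norm (u j) * norm (H j - G j)) \<le> \<eta>) \<and>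
    (\<lambda>k. \<Sum>j<k. blinfun_apply (G j) (u j)) \<longlonglongrightarrow> 0"
  shows "(\<lambda>k. \<Sum>j<k. H j (u j)) \<longlonglongrightarrow> 0"
proof (rule LIMSEQ_I)
  fix \<epsilon> :: real assume \<epsilon>: "0 < \<epsilon>"
  then obtain G where G: "\<And>k. (\<Sum>j<k. norm (u j) * norm (H j - G j)) \<le> \<epsilon> / 2"
    "(\<lambda>k. \<Sum>j<k. blinfun_apply (G j) (u j)) \<longlonglongrightarrow> 0" using assms[of "\<epsilon> / 2"] by auto
  obtain N where N: "\<And>k. k \<ge> N \<Longrightarrow> \<bar>\<Sum>j<k. G j (u j)\<bar> < \<epsilon> / 2" using LIMSEQ_D[OF G(2), of "\<epsilon> / 2"] \<epsilon> by auto
  have "norm ((\<Sum>j<k. H j (u j)) - 0) < \<epsilon>" if "k \<ge> N" for k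
  proof -
    have "(\<Sum>j<k. H j (u j)) - (\<Sum>j<k. G j (u j)) = (\<Sum>j<k. (H j - G j) (u j))"
      by (simp add: blinfun.diff_left sum_subtractf)
    also have "\<bar>\<dots>\<bar> \<le> (\<Sum>j<k. norm (u j) * norm (H j - G j))"
      by (intro order_trans[OF sum_abs] sum_mono) (rule abs_blinfun_le)
    finally show ?thesis using G(1)[of k] N[OF that] by (simp only: real_norm_def diff_0_right)
  qed
  then show "\<exists>no. \<forall>k\<ge>no. norm ((\<Sum>j<k. H j (u j)) - 0) < \<epsilon>" by blast
qed

lemma sum_lessThan_split_le:
  fixes f :: "nat \<Rightarrow> real"
  assumes "\<And>j. 0 \<le> f j"
  shows "(\<Sum>j<k. f j) \<le> (\<Sum>j<N. f j) + (\<Sum>j\<in>{N..<k}. f j)"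
proof -
  have "(\<Sum>j<k. f j) \<le> (\<Sum>j\<in>{..<N} \<union> {N..<k}. f j)" using assms by (intro sum_mono2) auto
  also have "\<dots> = (\<Sum>j<N. f j) + (\<Sum>j\<in>{N..<k}. f j)" by (intro sum.union_disjoint) auto
  finally show ?thesis .
qed

section \<open>The trace of an operator into the annihilator, in three cases\<close>

context
  fixes T :: "'x::banach_lattice \<Rightarrow>\<^sub>L 'e::banach"
    and u :: "nat \<Rightarrow> 'e dual dual" and x :: "nat \<Rightarrow> 'x dual"
    and D :: "'x dual \<Rightarrow>\<^sub>L 'e dual dual dual" and a b A :: real
  assumes ab: "0 \<le> a" "0 \<le> b" "a + b = 1"
    and T: "(\<lambda>j. rank_one (u j) (x j)) sums blinfun_adjoint T"
    and adm: "seq_admissible a b A u x" and A: "0 < A"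
    and D_in: "\<And>y. D y \<in> bidual_annihilator"
    and D_bound: "\<And>t cs. 0 \<le> t \<Longrightarrow> weight_bound a b t cs \<Longrightarrow> (\<And>C. C \<in> set cs \<Longrightarrow> 0 \<le> fst C) \<Longrightarrow>
       (\<Sum>C\<leftarrow>cs. fst C * norm (D (snd C))) \<le> 2 * t"
begin

lemma seq_terms_nonneg: "0 \<le> x j"
  using adm by (simp add: seq_admissible_iff)

lemma trace_weight_sum: "(\<Sum>j<k. norm (u j) * norm (D (x j))) \<le> 2 * A"
proof -
  have "weight_bound a b A (map (\<lambda>j. (norm (u j), x j)) [0..<k])"
    using adm by (simp add: seq_admissible_def admissible_def o_def)
  then have "(\<Sum>C\<leftarrow>map (\<lambda>j. (norm (u j), x j)) [0..<k]. fst C * norm (D (snd C))) \<le> 2 * A"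
    using A by (intro D_bound) auto
  then show ?thesis by (simp add: o_def sum_list_upt atLeast0LessThan)
qed

text \<open>Since the products \<open>norm (u j) * norm (D (x j))\<close> are summable, there are
  positive \<open>d j\<close> such that \<open>d j * norm (u j)\<close> is still summable and
  \<open>D (x j)\<close> divided by \<open>d j\<close> tends to 0. Approximating the identity on
  this null sequence gives errors of at most \<open>\<delta> * d j\<close>, and
  \<open>annihilator_part\<close> moves the approximants back into the annihilator.\<close>

lemma trace_tendsto_0_ap:
  assumes AP: "approximation_property TYPE('e dual dual dual)"
  shows "(\<lambda>k. \<Sum>j<k. D (x j) (u j)) \<longlonglongrightarrow> 0"
proof (rule pairing_sum_tendsto_0)
  fix \<eta> :: real assume \<eta>: "0 < \<eta>"
  \<comment> \<open>The geometric term keeps \<open>c j\<close> positive even when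
    \<open>u j\<close> or \<open>D (x j)\<close> vanishes.\<close>
  define c where "c j = norm (u j) * norm (D (x j)) + (1 / 2) ^ j" for j
  have "summable (\<lambda>j. norm (u j) * norm (D (x j)))"
    by (rule summableI_nonneg_bounded[OF _ trace_weight_sum]) simp
  then have "summable c" unfolding c_def[abs_def] by (intro summable_add) auto
  moreover have "0 < c j" for j unfolding c_def by (intro add_nonneg_pos) auto
  ultimately obtain m where m: "\<And>j. 0 < m j" "(\<lambda>j. 1 / m j) \<longlonglongrightarrow> 0" "summable (\<lambda>j. m j * c j)"
    using summable_multiplier by blast
  \<comment> \<open>Chosen so that \<open>m j * norm (D (x j))\<close> is at most \<open>d j\<close>
    and \<open>d j * norm (u j)\<close> is at most \<open>m j * c j\<close>; the second summand
    keeps \<open>d j\<close> positive.\<close>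
  define d where "d j = m j * (norm (D (x j)) + (1 / 2) ^ j / (1 + norm (u j)))" for j
  have pos: "0 < (1 / 2) ^ j / (1 + norm (u j))" for j by (simp add: add_pos_nonneg)
  have d_pos: "0 < d j" for j
    unfolding d_def using m(1) pos by (intro mult_pos_pos add_nonneg_pos) auto
  have d_le: "d j * norm (u j) \<le> m j * c j" for j
  proof -
    have "(1 / 2) ^ j / (1 + norm (u j)) * norm (u j) \<le> (1 / 2) ^ j"
      by (simp add: field_simps add_pos_nonneg)
    then have "(norm (D (x j)) + (1 / 2) ^ j / (1 + norm (u j))) * norm (u j) \<le> c j"
      by (simp add: c_def algebra_simps)
    from mult_left_mono[OF this less_imp_le[OF m(1)[of j]]] show ?thesis by (simp add: d_def ac_simps)
  qed
  have "(\<lambda>j. (1 / d j) *\<^sub>R D (x j)) \<longlonglongrightarrow> 0"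
  proof (rule Lim_null_comparison[OF always_eventually[OF allI] m(2)])
    fix j
    have "m j * norm (D (x j)) \<le> d j"
      unfolding d_def using m(1)[of j] pos[of j] by (intro mult_left_mono) auto
    then show "norm ((1 / d j) *\<^sub>R D (x j)) \<le> 1 / m j"
      using d_pos[of j] m(1)[of j] by (simp add: field_simps)
  qed
  then have "compact (insert 0 (range (\<lambda>j. (1 / d j) *\<^sub>R D (x j))))" by (rule compact_insert_limit)
  moreover define \<delta> where "\<delta> = \<eta> / (2 * (suminf (\<lambda>j. m j * c j) + 1))"
  have s0: "0 \<le> suminf (\<lambda>j. m j * c j)"
    using m(1) by (intro suminf_nonneg m(3)) (auto simp: c_def less_imp_le)
  have \<delta>: "0 < \<delta>" unfolding \<delta>_def using \<eta> s0 by (intro divide_pos_pos) auto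
  ultimately obtain S :: "'e dual dual dual \<Rightarrow>\<^sub>L 'e dual dual dual" where S: "finite_rank S"
      "\<forall>k\<in>insert 0 (range (\<lambda>j. (1 / d j) *\<^sub>R D (x j))). norm (S k - k) < \<delta>"
    using AP unfolding approximation_property_def by blast
  obtain B g where B: "finite B" "\<And>G. S G = (\<Sum>b\<in>B. blinfun_apply (g b) G *\<^sub>R b)"
    using finite_rank_expansion[OF S(1)] by blast
  have S_le: "norm (D (x j) - S (D (x j))) \<le> \<delta> * d j" for j
  proof -
    have "norm (S ((1 / d j) *\<^sub>R D (x j)) - (1 / d j) *\<^sub>R D (x j)) < \<delta>" using S(2) by blast
    also have "S ((1 / d j) *\<^sub>R D (x j)) - (1 / d j) *\<^sub>R D (x j) = (1 / d j) *\<^sub>R (S (D (x j)) - D (x j))"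
      by (simp only: blinfun.scaleR_right scaleR_right_diff_distrib)
    also have "norm \<dots> = norm (D (x j) - S (D (x j))) / d j"
      using d_pos[of j] by (simp add: norm_minus_commute)
    finally show ?thesis using d_pos[of j] by (simp add: divide_less_eq)
  qed
  let ?G = "\<lambda>j. annihilator_part (S (D (x j)))"
  have G: "?G j = (\<Sum>b\<in>B. (g b o\<^sub>L D) (x j) *\<^sub>R annihilator_part b)" for j
    by (simp add: B(2) blinfun.sum_right blinfun.scaleR_right)
  show "\<exists>G. (\<forall>k. (\<Sum>j<k. norm (u j) * norm (D (x j) - G j)) \<le> \<eta>) \<and>
      (\<lambda>k. \<Sum>j<k. blinfun_apply (G j) (u j)) \<longlonglongrightarrow> 0"
  proof (intro exI[of _ ?G] conjI allI)
    show "(\<lambda>k. \<Sum>j<k. ?G j (u j)) \<longlonglongrightarrow> 0"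
      unfolding G by (rule finite_rank_trace_tendsto_0[OF T annihilator_part_in])
    fix k
    have "(\<Sum>j<k. norm (u j) * norm (D (x j) - ?G j)) \<le> (\<Sum>j<k. 2 * \<delta> * (m j * c j))"
    proof (rule sum_mono)
      fix j
      have "D (x j) - ?G j = annihilator_part (D (x j) - S (D (x j)))"
        using annihilator_part_id[OF D_in[of "x j"]] by (simp add: blinfun.diff_right)
      then have "norm (D (x j) - ?G j) \<le> 2 * (\<delta> * d j)"
        using norm_annihilator_part_le[of "D (x j) - S (D (x j))"] S_le[of j] by simp
      then have "norm (u j) * norm (D (x j) - ?G j) \<le> norm (u j) * (2 * (\<delta> * d j))"
        by (rule mult_left_mono) simp
      also have "\<dots> = 2 * \<delta> * (d j * norm (u j))" by (simp add: ac_simps)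
      also have "\<dots> \<le> 2 * \<delta> * (m j * c j)" using d_le \<delta> by (intro mult_left_mono) auto
      finally show "norm (u j) * norm (D (x j) - ?G j) \<le> 2 * \<delta> * (m j * c j)" .
    qed
    also have "\<dots> = 2 * \<delta> * (\<Sum>j<k. m j * c j)" by (simp add: sum_distrib_left)
    also have "\<dots> \<le> 2 * \<delta> * (suminf (\<lambda>j. m j * c j) + 1)"
    proof -
      have "(\<Sum>j<k. m j * c j) \<le> suminf (\<lambda>j. m j * c j)"
        using m(1) by (intro sum_le_suminf m(3)) (auto simp: c_def less_imp_le)
      then show ?thesis using \<delta> by (intro mult_left_mono) auto
    qed
    also have "\<dots> = \<eta>" using s0 by (simp add: \<delta>_def field_simps add_nonneg_eq_0_iff)
    finally show "(\<Sum>j<k. norm (u j) * norm (D (x j) - ?G j)) \<le> \<eta>" .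
  qed
qed

text \<open>For positive \<open>a\<close> the strong cost of a late tail is small. Scaling the two
  components by inverse factors leaves the products unchanged and transfers this smallness to the
  weak cost. The estimate is uniform in \<open>R\<close>: positivity keeps the vectors in the cone,
  and composing a functional with a contraction keeps it in the unit ball.\<close>

lemma trace_tail:
  assumes a: "0 < a" and \<eta>: "0 < \<eta>"
  shows "\<exists>N. \<forall>k (R :: 'x dual \<Rightarrow>\<^sub>L 'x dual). (\<forall>y\<ge>0. 0 \<le> blinfun_apply R y) \<longrightarrow> norm R \<le> 1 \<longrightarrow>
    (\<Sum>j\<in>{N..<k}. norm (u j) * norm (D (blinfun_apply R (x j)))) \<le> \<eta>"
proof -
  \<comment> \<open>\<open>s\<close> brings the weak cost \<open>A\<close> to
    \<open>\<eta> / 2\<close>; \<open>r\<close> is the factor by which the compensating scaling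
    multiplies the strong cost.\<close>
  define s where "s = \<eta> / (2 * A)"
  have s: "0 < s" "s * A = \<eta> / 2" using \<eta> A by (simp_all add: s_def)
  define r where "r = s powr (- b / a)"
  have r: "0 < r" "r powr a = s powr (- b)" using s a by (simp_all add: r_def powr_powr)
  define h where "h j = norm (u j) powr (1 / a)" for j
  have pc: "pcost a (norm (u j)) = ennreal (h j)" for j using a by (simp add: pcost_def h_def)
  have "(\<Sum>j<k. h j) \<le> A" for k
  proof -
    have "ennreal (\<Sum>j<k. h j) = (\<Sum>j<k. pcost a (norm (u j)))"
      by (simp add: pc h_def)
    also have "\<dots> \<le> ennreal A" using adm by (simp add: seq_admissible_iff)
    finally show ?thesis using A by simp
  qed
  then have "summable h" by (intro summableI_nonneg_bounded[where x = A]) (auto simp: h_def)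
  moreover have "0 < \<eta> / (2 * r)" using \<eta> r by simp
  ultimately obtain N where N: "\<And>m n. m \<ge> N \<Longrightarrow> norm (sum h {m..<n}) < \<eta> / (2 * r)"
    unfolding summable_Cauchy by blast
  show ?thesis
  proof (intro exI[of _ N] allI impI)
    fix k and R :: "'x dual \<Rightarrow>\<^sub>L 'x dual"
    assume R: "\<forall>y\<ge>0. 0 \<le> R y" "norm R \<le> 1"
    let ?cs = "map (\<lambda>j. (s powr (- b) * norm (u j), s powr b *\<^sub>R R (x j))) [N..<k]"
    have "weight_bound a b (\<eta> / 2) ?cs"
      unfolding weight_bound_def
    proof (intro conjI allI impI)
      show "\<forall>C\<in>set ?cs. 0 \<le> snd C" using R(1) seq_terms_nonneg by (auto intro: scaleR_nonneg_nonneg)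
      have "(\<Sum>C\<leftarrow>?cs. pcost a (fst C)) = (\<Sum>j\<in>{N..<k}. pcost a (r powr a * norm (u j)))"
        by (simp add: o_def sum_list_upt r)
      also have "\<dots> \<le> (\<Sum>j\<in>{N..<k}. ennreal r * pcost a (norm (u j)))"
        using ab r by (intro sum_mono pcost_scale) auto
      also have "\<dots> = ennreal (r * sum h {N..<k})"
        using r by (simp add: pc sum_distrib_left[symmetric] ennreal_mult sum_nonneg h_def)
      also have "\<dots> \<le> ennreal (\<eta> / 2)"
      proof (rule ennreal_leI)
        have "sum h {N..<k} \<le> \<eta> / (2 * r)" using N[of N k] by simp
        then show "r * sum h {N..<k} \<le> \<eta> / 2" using r by (simp add: field_simps)
      qed
      finally show "(\<Sum>C\<leftarrow>?cs. pcost a (fst C)) \<le> ennreal (\<eta> / 2)" .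
    next
      fix F :: "'x dual dual" assume F: "norm F \<le> 1"
      have FR: "norm (F o\<^sub>L R) \<le> 1"
        using norm_blinfun_compose[of F R] mult_mono[OF F R(2)] by simp
      have "(\<Sum>C\<leftarrow>?cs. pcost b (F (snd C))) = (\<Sum>j\<in>{N..<k}. pcost b (s powr b * (F o\<^sub>L R) (x j)))"
        by (simp add: o_def sum_list_upt blinfun.scaleR_right)
      also have "\<dots> \<le> (\<Sum>j\<in>{N..<k}. ennreal s * pcost b ((F o\<^sub>L R) (x j)))"
        using ab s by (intro sum_mono pcost_scale) auto
      also have "\<dots> = ennreal s * (\<Sum>j\<in>{N..<k}. pcost b ((F o\<^sub>L R) (x j)))" by (simp add: sum_distrib_left)
      also have "\<dots> \<le> ennreal s * (\<Sum>j<k. pcost b ((F o\<^sub>L R) (x j)))"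
        by (intro mult_left_mono sum_mono2) auto
      also have "\<dots> \<le> ennreal s * ennreal A"
        using adm FR by (intro mult_left_mono) (auto simp: seq_admissible_iff)
      also have "\<dots> = ennreal (s * A)" using s(1) A by (simp add: ennreal_mult)
      finally have "(\<Sum>C\<leftarrow>?cs. pcost b (F (snd C))) \<le> ennreal (s * A)" .
      then show "(\<Sum>C\<leftarrow>?cs. pcost b (F (snd C))) \<le> ennreal (\<eta> / 2)" by (simp only: s(2))
    qed
    then have "(\<Sum>C\<leftarrow>?cs. fst C * norm (D (snd C))) \<le> 2 * (\<eta> / 2)"
      using \<eta> by (intro D_bound) auto
    moreover have "s powr (- b) * norm (u j) * norm (D (s powr b *\<^sub>R R (x j)))
        = norm (u j) * norm (D (R (x j)))" for j
      using s by (simp add: blinfun.scaleR_right powr_minus)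
    ultimately show "(\<Sum>j\<in>{N..<k}. norm (u j) * norm (D (R (x j)))) \<le> \<eta>"
      by (simp add: o_def sum_list_upt)
  qed
qed

text \<open>A positive contraction close to the identity at the first \<open>N\<close> vectors
  settles the head; by \<open>trace_tail\<close> the tails of \<open>D (x j)\<close> and of
  \<open>D (R (x j))\<close> are both small.\<close>

lemma trace_tendsto_0_pmap:
  assumes PMAP: "positive_metric_approximation_property TYPE('x dual)" and a: "0 < a"
  shows "(\<lambda>k. \<Sum>j<k. D (x j) (u j)) \<longlonglongrightarrow> 0"
proof (rule pairing_sum_tendsto_0)
  fix \<eta> :: real assume \<eta>: "0 < \<eta>"
  obtain N where N: "(\<Sum>j\<in>{N..<k}. norm (u j) * norm (D (R (x j)))) \<le> \<eta> / 3"
    if "\<forall>y\<ge>0. 0 \<le> R y" "norm R \<le> 1" for k and R :: "'x dual \<Rightarrow>\<^sub>L 'x dual"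
    using trace_tail[OF a, of "\<eta> / 3"] \<eta> by auto
  define M where "M = (\<Sum>j<N. norm (u j) * norm D) + 1"
  have M: "0 < M" unfolding M_def by (intro add_nonneg_pos sum_nonneg) auto
  have "finite (x ` {..<N})" by simp
  then have cpt: "compact (x ` {..<N})" by (rule finite_imp_compact)
  have pos: "0 < \<eta> / (3 * M)" using \<eta> M by simp
  have "\<exists>R :: 'x dual \<Rightarrow>\<^sub>L 'x dual. finite_rank R \<and> (\<forall>y\<ge>0. 0 \<le> R y) \<and> norm R \<le> 1 \<and>
      (\<forall>y\<in>x ` {..<N}. norm (R y - y) < \<eta> / (3 * M))"
    by (rule PMAP[unfolded positive_metric_approximation_property_def, rule_format, OF pos cpt])
  then obtain R :: "'x dual \<Rightarrow>\<^sub>L 'x dual" where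
    R: "finite_rank R" "\<forall>y\<ge>0. 0 \<le> R y" "norm R \<le> 1" "\<forall>y\<in>x ` {..<N}. norm (R y - y) < \<eta> / (3 * M)"
    by (elim exE conjE)
  obtain B g where B: "finite B" "\<And>y. R y = (\<Sum>b\<in>B. blinfun_apply (g b) y *\<^sub>R b)"
    using finite_rank_expansion[OF R(1)] by blast
  let ?G = "\<lambda>j. D (R (x j))"
  have G: "?G j = (\<Sum>b\<in>B. g b (x j) *\<^sub>R D b)" for j
    by (simp add: B(2) blinfun.sum_right blinfun.scaleR_right)
  show "\<exists>G. (\<forall>k. (\<Sum>j<k. norm (u j) * norm (D (x j) - G j)) \<le> \<eta>) \<and>
      (\<lambda>k. \<Sum>j<k. blinfun_apply (G j) (u j)) \<longlonglongrightarrow> 0"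
  proof (intro exI[of _ ?G] conjI allI)
    show "(\<lambda>k. \<Sum>j<k. ?G j (u j)) \<longlonglongrightarrow> 0"
      unfolding G by (rule finite_rank_trace_tendsto_0[OF T D_in])
    fix k
    have head: "(\<Sum>j<N. norm (u j) * norm (D (x j) - ?G j)) \<le> \<eta> / 3"
    proof -
      have "(\<Sum>j<N. norm (u j) * norm (D (x j) - ?G j)) \<le> (\<Sum>j<N. norm (u j) * norm D * (\<eta> / (3 * M)))"
      proof (rule sum_mono)
        fix j assume "j \<in> {..<N}"
        then have "norm (x j - R (x j)) \<le> \<eta> / (3 * M)" using R(4) by (auto simp: norm_minus_commute less_imp_le)
        then have "norm (D (x j - R (x j))) \<le> norm D * (\<eta> / (3 * M))"
          by (intro order_trans[OF norm_blinfun] mult_left_mono) auto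
        then show "norm (u j) * norm (D (x j) - ?G j) \<le> norm (u j) * norm D * (\<eta> / (3 * M))"
          unfolding mult.assoc blinfun.diff_right[symmetric] by (rule mult_left_mono) simp
      qed
      also have "\<dots> = (M - 1) * (\<eta> / (3 * M))" by (simp only: M_def add_diff_cancel_right' sum_distrib_right)
      also have "\<dots> \<le> M * (\<eta> / (3 * M))" using \<eta> M by (intro mult_right_mono) auto
      also have "\<dots> = \<eta> / 3" using M by simp
      finally show ?thesis .
    qed
    have tail: "(\<Sum>j\<in>{N..<k}. norm (u j) * norm (D (x j) - ?G j)) \<le> \<eta> / 3 + \<eta> / 3"
    proof -
      \<comment> \<open>Inserting \<open>id_blinfun\<close> makes the identity one of the positive
        contractions to which the choice of \<open>N\<close> applies.\<close>
      have "(\<Sum>j\<in>{N..<k}. norm (u j) * norm (D (x j) - ?G j)) \<le>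
          (\<Sum>j\<in>{N..<k}. norm (u j) * norm (D (id_blinfun (x j))) + norm (u j) * norm (?G j))"
        by (intro sum_mono) (simp add: norm_triangle_ineq4 mult_left_mono flip: distrib_left)
      also have "\<dots> \<le> \<eta> / 3 + \<eta> / 3"
        unfolding sum.distrib using R by (intro add_mono N) (auto simp: norm_blinfun_id_le)
      finally show ?thesis .
    qed
    show "(\<Sum>j<k. norm (u j) * norm (D (x j) - ?G j)) \<le> \<eta>"
      using order_trans[OF sum_lessThan_split_le add_mono[OF head tail]] by simp
  qed
qed

text \<open>Here \<open>b = 1\<close>, and \<open>D_bound\<close> with unit weights bounds the
  variation of \<open>D\<close>. The values \<open>\<rho> (x j)\<close> are summable, so tails are
  small in the seminorm of \<open>\<rho>\<close> although the \<open>u j\<close> need not tend to 0;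
  the head is settled by the approximants built from cells.\<close>

lemma trace_tendsto_0_infinity:
  assumes a: "a = 0"
  shows "(\<lambda>k. \<Sum>j<k. D (x j) (u j)) \<longlonglongrightarrow> 0"
proof (rule pairing_sum_tendsto_0)
  fix \<eta> :: real assume \<eta>: "0 < \<eta>"
  have b: "b = 1" using a ab by simp
  have "(\<Sum>y\<leftarrow>ys. norm (D y)) \<le> 2 * norm (sum_list ys)" if ys: "\<And>y. y \<in> set ys \<Longrightarrow> 0 \<le> y" for ys
  proof -
    have "weight_bound a b (norm (sum_list ys)) (map (\<lambda>y. (1, y)) ys)"
      unfolding weight_bound_def
    proof (intro conjI allI impI)
      fix F :: "'x dual dual" assume F: "norm F \<le> 1"
      \<comment> \<open>The modulus of \<open>F\<close> is additive along \<open>ys\<close>, so the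
        weak cost of \<open>ys\<close> is at most the norm of the sum.\<close>
      obtain M :: "'x dual dual" where M: "\<forall>y\<ge>0. \<bar>F y\<bar> \<le> M y" "norm M \<le> norm F"
        using modulus_functional[of F] by blast
      have "(\<Sum>y\<leftarrow>ys. \<bar>F y\<bar>) \<le> (\<Sum>y\<leftarrow>ys. M y)" using M(1) ys by (intro sum_list_mono) auto
      also have "\<dots> = M (sum_list ys)" by (induction ys) (auto simp: blinfun.add_right)
      also have "\<dots> \<le> norm (sum_list ys)" using norm_le_one_apply[of M "sum_list ys"] M(2) F by simp
      finally have "ennreal (\<Sum>y\<leftarrow>ys. \<bar>F y\<bar>) \<le> ennreal (norm (sum_list ys))" by (rule ennreal_leI)
      moreover have "(\<Sum>y\<leftarrow>ys. pcost b (F y)) = ennreal (\<Sum>y\<leftarrow>ys. \<bar>F y\<bar>)"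
        by (induction ys) (auto simp: pcost_def b intro!: ennreal_plus[symmetric] sum_list_nonneg)
      ultimately show "(\<Sum>C\<leftarrow>map (\<lambda>y. (1, y)) ys. pcost b (F (snd C))) \<le> ennreal (norm (sum_list ys))"
        by (simp add: o_def)
    qed (use ys in \<open>auto simp: o_def pcost_def a\<close>)
    then have "(\<Sum>C\<leftarrow>map (\<lambda>y. (1, y)) ys. fst C * norm (D (snd C))) \<le> 2 * norm (sum_list ys)"
      by (intro D_bound) auto
    then show ?thesis by (simp add: o_def)
  qed
  then obtain \<rho> where \<rho>: "dominated (blinfun_apply D) \<rho>" "\<And>y. 0 \<le> y \<Longrightarrow> \<rho> y \<le> 2 * norm y"
    using variation_dominated[of D 2] by blast
  have u_norm: "norm (u j) \<le> 1" for j
  proof (rule ccontr)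
    assume "\<not> norm (u j) \<le> 1"
    then have "pcost a (norm (u j)) = \<infinity>" by (simp add: pcost_def a)
    then have "(\<Sum>i<Suc j. pcost a (norm (u i))) = \<infinity>" by simp
    then show False using adm unfolding seq_admissible_iff by (metis ennreal_less_top infinity_ennreal_def leD)
  qed
  have sum_le: "(\<Sum>j<k. \<rho> (x j)) \<le> 2 * A" for k
  proof -
    have nn: "0 \<le> (\<Sum>j<k. x j)" by (intro sum_nonneg seq_terms_nonneg)
    obtain F :: "'x dual dual" where F: "norm F \<le> 1" "F (\<Sum>j<k. x j) = norm (\<Sum>j<k. x j)"
      by (rule norming_functional)
    have "ennreal (\<Sum>j<k. \<bar>F (x j)\<bar>) = (\<Sum>j<k. pcost b (F (x j)))" by (simp add: pcost_def b)
    also have "\<dots> \<le> ennreal A" using adm F(1) by (auto simp: seq_admissible_iff)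
    finally have "(\<Sum>j<k. \<bar>F (x j)\<bar>) \<le> A" using A by simp
    then have "norm (\<Sum>j<k. x j) \<le> A"
      using F(2) sum_abs[of "\<lambda>j. F (x j)" "{..<k}"] by (simp add: blinfun.sum_right)
    then show ?thesis using dominated_sum[OF \<rho>(1), of "{..<k}" x] seq_terms_nonneg \<rho>(2)[OF nn] by simp
  qed
  have \<rho>_nonneg: "0 \<le> \<rho> (x j)" for j using dominated_nonneg[OF \<rho>(1) seq_terms_nonneg] .
  then have "summable (\<lambda>j. \<rho> (x j))" by (intro summableI_nonneg_bounded[where x = "2 * A"] sum_le)
  moreover have "0 < \<eta> / 4" using \<eta> by simp
  ultimately obtain N where N: "\<And>m n. m \<ge> N \<Longrightarrow> norm (\<Sum>j=m..<n. \<rho> (x j)) < \<eta> / 4"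
    unfolding summable_Cauchy by blast
  have "0 < \<eta> / (2 * (real N + 1))" using \<eta> by simp
  then obtain L where L: "\<And>P. P \<in> set L \<Longrightarrow> fst P \<in> bidual_annihilator \<and> dominated (\<lambda>y. snd P y) (snd P)"
    "\<And>y P. 0 \<le> y \<Longrightarrow> P \<in> set L \<Longrightarrow> snd P y \<le> \<rho> y"
    "\<And>y. 0 \<le> y \<Longrightarrow> norm (\<Sum>P\<leftarrow>L. snd P y *\<^sub>R fst P) \<le> \<rho> y"
    "\<And>j. j < N \<Longrightarrow> norm (D (x j) - (\<Sum>P\<leftarrow>L. snd P (x j) *\<^sub>R fst P)) \<le> \<eta> / (2 * (real N + 1))"
    by (rule dominated_finite_rank_approx[OF \<rho>(1) closed_bidual_annihilator subspace_bidual_annihilator D_in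
        seq_terms_nonneg,
          where N = N]) (rule that; assumption)
  let ?G = "\<lambda>j. \<Sum>P\<leftarrow>L. snd P (x j) *\<^sub>R fst P"
  have lim: "(\<lambda>k. \<Sum>j<k. snd P (x j) * fst P (u j)) \<longlonglongrightarrow> 0" if P: "P \<in> set L" for P
  proof (rule Lim_null_comparison[OF always_eventually[OF allI]])
    note dP = conjunct2[OF L(1)[OF P]]
    define s where "s k = (\<Sum>j<k. fst P (u j) *\<^sub>R x j)" for k
    have "s \<longlonglongrightarrow> 0"
      unfolding s_def[abs_def] using annihilator_series_tendsto_0[OF T conjunct1[OF L(1)[OF P]]] .
    from tendsto_mult_right[OF tendsto_norm[OF this], of 2]
    show "(\<lambda>k. 2 * norm (s k)) \<longlonglongrightarrow> 0" by simp
    fix k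
    \<comment> \<open>\<open>?m\<close> is the modulus of \<open>s k\<close>. As
      \<open>snd P\<close> is additive on the positive cone only, the coefficients are split by
      sign; each of \<open>p\<close> and \<open>q\<close> is at most the other plus
      \<open>?m\<close>.\<close>
    let ?m = "pprt (s k) + - nprt (s k)"
    define p where "p = (\<Sum>j<k. max (fst P (u j)) 0 *\<^sub>R x j)"
    define q where "q = (\<Sum>j<k. max (- fst P (u j)) 0 *\<^sub>R x j)"
    have pq: "p - q = s k"
      unfolding p_def q_def s_def sum_subtractf[symmetric] scaleR_left_diff_distrib[symmetric]
      by (intro sum.cong refl arg_cong2[where f = scaleR]) auto
    have nn: "0 \<le> p" "0 \<le> q" unfolding p_def q_def by (auto intro!: sum_nonneg scaleR_nonneg_nonneg seq_terms_nonneg)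
    have m0: "0 \<le> - nprt (s k)" "0 \<le> pprt (s k)" by simp_all
    have m: "0 \<le> ?m" by (intro add_nonneg_nonneg m0)
    have \<rho>m: "snd P ?m \<le> 2 * norm (s k)"
      using L(2)[OF m P] \<rho>(2)[OF m] norm_prts_le[of "s k"] by simp
    have sk: "s k + - nprt (s k) = pprt (s k)"
      using prts[of "s k"] by (metis add.assoc add.right_inverse add.right_neutral)
    have "s k \<le> ?m" using m0 sk by (metis add_increasing2 le_add_same_cancel1 order_trans)
    then have "p \<le> q + ?m" using pq by (simp add: algebra_simps)
    from dominated_mono[OF dP nn(1) this] have 1: "snd P p \<le> snd P q + snd P ?m"
      by (simp only: dominated_functional_add[OF dP nn(2) m])
    have "s k + ?m = pprt (s k) + pprt (s k)" using sk by (metis add.left_commute)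
    then have "0 \<le> s k + ?m" using m0(2) by (metis add_nonneg_nonneg)
    then have "q \<le> p + ?m" using pq by (simp add: algebra_simps)
    from dominated_mono[OF dP nn(2) this] have 2: "snd P q \<le> snd P p + snd P ?m"
      by (simp only: dominated_functional_add[OF dP nn(1) m])
    have "snd P p = (\<Sum>j<k. max (fst P (u j)) 0 * snd P (x j))" "snd P q = (\<Sum>j<k. max (- fst P (u j)) 0 * snd P (x j))"
      unfolding p_def q_def
      by (subst dominated_sum[OF dP]; simp add: scaleR_nonneg_nonneg seq_terms_nonneg dominated_homogeneous[OF dP])+
    then have "snd P p - snd P q = (\<Sum>j<k. (max (fst P (u j)) 0 - max (- fst P (u j)) 0) * snd P (x j))"
      by (simp add: sum_subtractf left_diff_distrib)
    also have "\<dots> = (\<Sum>j<k. snd P (x j) * fst P (u j))"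
      by (intro sum.cong) auto
    finally show "norm (\<Sum>j<k. snd P (x j) * fst P (u j)) \<le> 2 * norm (s k)"
      using 1 2 \<rho>m by simp
  qed
  show "\<exists>G. (\<forall>k. (\<Sum>j<k. norm (u j) * norm (D (x j) - G j)) \<le> \<eta>) \<and>
      (\<lambda>k. \<Sum>j<k. blinfun_apply (G j) (u j)) \<longlonglongrightarrow> 0"
  proof (intro exI[of _ ?G] conjI allI)
    have eq: "(\<Sum>j<k. ?G j (u j)) = (\<Sum>P\<leftarrow>L. \<Sum>j<k. snd P (x j) * blinfun_apply (fst P) (u j))" for k
      by (induction L) (simp_all add: blinfun.add_left blinfun.scaleR_left sum.distrib)
    show "(\<lambda>k. \<Sum>j<k. ?G j (u j)) \<longlonglongrightarrow> 0"
      unfolding eq using lim by (induction L) (auto intro!: tendsto_eq_intros)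
    fix k
    have "(\<Sum>j<k. norm (u j) * norm (D (x j) - ?G j)) \<le> (\<Sum>j<k. norm (D (x j) - ?G j))"
      using u_norm by (intro sum_mono mult_left_le_one_le) auto
    also have "\<dots> \<le> (\<Sum>j<N. norm (D (x j) - ?G j)) + (\<Sum>j\<in>{N..<k}. norm (D (x j) - ?G j))"
      by (rule sum_lessThan_split_le) simp
    also have "\<dots> \<le> (\<Sum>j<N. \<eta> / (2 * (real N + 1))) + (\<Sum>j\<in>{N..<k}. 2 * \<rho> (x j))"
    proof (intro add_mono sum_mono)
      fix j
      show "norm (D (x j) - ?G j) \<le> 2 * \<rho> (x j)"
        using norm_triangle_ineq4[of "D (x j)" "?G j"] dominated_norm[OF \<rho>(1) seq_terms_nonneg[of j]] L(3)[OF
            seq_terms_nonneg[of j]]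
        by simp
    qed (use L(4) in auto)
    also have "(\<Sum>j<N. \<eta> / (2 * (real N + 1))) \<le> \<eta> / 2" using \<eta> by (simp add: field_simps)
    also have "(\<Sum>j\<in>{N..<k}. 2 * \<rho> (x j)) \<le> \<eta> / 2"
      using N[of N k] by (simp add: sum_distrib_left[symmetric])
    finally show "(\<Sum>j<k. norm (u j) * norm (D (x j) - ?G j)) \<le> \<eta>" by simp
  qed
qed

end

section \<open>Splitting off a finite part\<close>

lemma blinfun_adjoint_rank_one: "blinfun_adjoint (rank_one y v) = rank_one (bidual_embedding v) y"
  by (intro blinfun_eqI) (simp add: blinfun.scaleR_left blinfun.scaleR_right mult.commute)

lemma blinfun_adjoint_add: "blinfun_adjoint (S + S') = blinfun_adjoint S + blinfun_adjoint S'"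
  by (intro blinfun_eqI) (simp add: blinfun.add_left blinfun.add_right)

lemma blinfun_adjoint_diff: "blinfun_adjoint (S - S') = blinfun_adjoint S - blinfun_adjoint S'"
  by (intro blinfun_eqI) (simp add: blinfun.diff_left blinfun.diff_right)

lemma bounded_linear_blinfun_adjoint: "bounded_linear blinfun_adjoint"
proof (rule bounded_linear_intro[of _ 1])
  show "blinfun_adjoint (r *\<^sub>R S) = r *\<^sub>R blinfun_adjoint S" for r and S :: "'a \<Rightarrow>\<^sub>L 'b"
    by (intro blinfun_eqI) (simp add: blinfun.scaleR_left blinfun.scaleR_right)
qed (simp_all add: blinfun_adjoint_add norm_blinfun_adjoint_le)

definition op_tensor :: "('e::real_normed_vector \<times> ('x::real_normed_vector) dual) list \<Rightarrow> 'x \<Rightarrow>\<^sub>L 'e" where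
  "op_tensor L = (\<Sum>P\<leftarrow>L. rank_one (snd P) (fst P))"

definition embed_pair ::
  "'e::real_normed_vector \<times> 'y \<Rightarrow> 'e dual dual \<times> 'y" where
  "embed_pair P = (bidual_embedding (fst P), snd P)"

lemma op_tensor_simps [simp]:
  "op_tensor [] = 0" "op_tensor (P # L) = rank_one (snd P) (fst P) + op_tensor L"
  "op_tensor (L @ L') = op_tensor L + op_tensor L'"
  by (simp_all add: op_tensor_def)

text \<open>Passing to \<open>annihilator_part\<close> at most doubles the norm of
  \<open>D y\<close>, which is the factor 2 in the bound assumed for the three cases.\<close>

lemma trace_tendsto_0:
  fixes T :: "'x::banach_lattice \<Rightarrow>\<^sub>L 'e::banach"
    and D :: "'x dual \<Rightarrow>\<^sub>L 'e dual dual dual"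
  assumes ab: "0 \<le> a" "0 \<le> b" "a + b = 1"
    and AP: "approximation_property TYPE('e dual dual dual) \<or>
         positive_metric_approximation_property TYPE('x dual)"
    and T: "(\<lambda>j. rank_one (u j) (x j)) sums blinfun_adjoint T"
    and adm: "seq_admissible a b A u x" and A: "0 < A"
    and D: "\<And>t ps. 0 \<le> t \<Longrightarrow> admissible a b t ps \<Longrightarrow> (\<Sum>P\<leftarrow>ps. D (snd P) (fst P)) \<le> t"
  shows "(\<lambda>k. \<Sum>j<k. annihilator_part (D (x j)) (u j)) \<longlonglongrightarrow> 0"
proof -
  define D' where "D' = annihilator_part o\<^sub>L D"
  have in': "D' y \<in> bidual_annihilator" for y by (simp add: D'_def annihilator_part_in)
  have bound: "(\<Sum>C\<leftarrow>cs. fst C * norm (D' (snd C))) \<le> 2 * t"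
    if "0 \<le> t" "weight_bound a b t cs" "\<And>C. C \<in> set cs \<Longrightarrow> 0 \<le> fst C" for t cs
  proof -
    have "(\<Sum>C\<leftarrow>cs. fst C * norm (D' (snd C))) \<le> (\<Sum>C\<leftarrow>cs. 2 * (fst C * norm (D (snd C))))"
    proof (rule sum_list_mono)
      fix C assume "C \<in> set cs"
      from mult_left_mono[OF norm_annihilator_part_le[of "D (snd C)"] that(3)[OF this]]
      show "fst C * norm (D' (snd C)) \<le> 2 * (fst C * norm (D (snd C)))" by (simp add: D'_def)
    qed
    also have "\<dots> = 2 * (\<Sum>C\<leftarrow>cs. fst C * norm (D (snd C)))" by (simp add: sum_list_const_mult)
    also have "\<dots> \<le> 2 * t" using weight_bound_norm_sum[OF ab(1) D that] by simp
    finally show ?thesis .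
  qed
  have "(\<lambda>k. \<Sum>j<k. D' (x j) (u j)) \<longlonglongrightarrow> 0"
  proof (cases "a = 0")
    case True
    show ?thesis by (rule trace_tendsto_0_infinity[OF ab T adm A in' bound True])
  next
    case False
    with ab have a: "0 < a" by simp
    from AP show ?thesis
    proof
      assume ap: "approximation_property TYPE('e dual dual dual)"
      show ?thesis by (rule trace_tendsto_0_ap[OF ab T adm A in' bound ap])
    next
      assume pmap: "positive_metric_approximation_property TYPE('x dual)"
      show ?thesis by (rule trace_tendsto_0_pmap[OF ab T adm A in' bound pmap a])
    qed
  qed
  then show ?thesis by (simp add: D'_def)
qed

text \<open>The conditions are jointly convex in the weights and the vectors. The bound on
  \<open>w j\<close> is proportional to its weight, so that \<open>w j\<close> divided by the weight
  is no larger than \<open>u j\<close>.\<close>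

definition truncations :: "('x::banach_lattice \<Rightarrow>\<^sub>L 'e::banach) \<Rightarrow> (nat \<Rightarrow> 'e dual dual) \<Rightarrow>
    (nat \<Rightarrow> 'x dual) \<Rightarrow> real \<Rightarrow> nat \<Rightarrow> (nat \<Rightarrow> real) \<Rightarrow> (nat \<Rightarrow> 'e) \<Rightarrow> bool" where
  "truncations T u x \<delta> k \<mu> w \<longleftrightarrow>
     (\<forall>j. 0 \<le> \<mu> j \<and> \<mu> j \<le> 1 \<and> norm (w j) \<le> \<mu> j * norm (u j)) \<and> (\<forall>j\<ge>k. \<mu> j = 0) \<and>
     norm (blinfun_adjoint T - (\<Sum>j<k. \<mu> j *\<^sub>R rank_one (u j) (x j))) \<le> \<delta>"

definition truncation_errors :: "('x::banach_lattice \<Rightarrow>\<^sub>L 'e::banach) \<Rightarrow> (nat \<Rightarrow> 'e dual dual) \<Rightarrow>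
    (nat \<Rightarrow> 'x dual) \<Rightarrow> real \<Rightarrow> ('e dual \<Rightarrow>\<^sub>L 'x dual) set" where
  "truncation_errors T u x \<delta> =
     {\<Sum>j<k. rank_one (\<mu> j *\<^sub>R u j - bidual_embedding (w j)) (x j) |k \<mu> w. truncations T u x \<delta> k \<mu> w}"

lemma truncations_w_zero: "truncations T u x \<delta> k \<mu> w \<Longrightarrow> j \<ge> k \<Longrightarrow> w j = 0"
  unfolding truncations_def by (metis mult_zero_left norm_le_zero_iff)

lemma sum_lessThan_extend:
  fixes f :: "nat \<Rightarrow> 'a::comm_monoid_add"
  assumes "k \<le> K" "\<And>j. j \<ge> k \<Longrightarrow> f j = 0"
  shows "(\<Sum>j<k. f j) = (\<Sum>j<K. f j)"
  by (rule sum.mono_neutral_left) (use assms in auto)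

lemma truncations_extend:
  assumes "truncations T u x \<delta> k \<mu> w" "k \<le> K"
  shows "truncations T u x \<delta> K \<mu> w"
    "(\<Sum>j<k. rank_one (\<mu> j *\<^sub>R u j - bidual_embedding (w j)) (x j)) =
     (\<Sum>j<K. rank_one (\<mu> j *\<^sub>R u j - bidual_embedding (w j)) (x j))"
proof -
  have "(\<Sum>j<k. \<mu> j *\<^sub>R rank_one (u j) (x j)) = (\<Sum>j<K. \<mu> j *\<^sub>R rank_one (u j) (x j))"
    using assms by (intro sum_lessThan_extend) (auto simp: truncations_def)
  then show "truncations T u x \<delta> K \<mu> w" using assms by (simp add: truncations_def)
  show "(\<Sum>j<k. rank_one (\<mu> j *\<^sub>R u j - bidual_embedding (w j)) (x j)) =
     (\<Sum>j<K. rank_one (\<mu> j *\<^sub>R u j - bidual_embedding (w j)) (x j))"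
    using assms truncations_w_zero[OF assms(1)]
    by (intro sum_lessThan_extend) (auto simp: truncations_def blinfun.zero_right)
qed

lemma convex_truncation_errors:
  fixes T :: "'x::banach_lattice \<Rightarrow>\<^sub>L 'e::banach"
  shows "convex (truncation_errors T u x \<delta>)"
proof (rule convexI)
  fix R R' :: "'e dual \<Rightarrow>\<^sub>L 'x dual" and l l' :: real
  assume R: "R \<in> truncation_errors T u x \<delta>" "R' \<in> truncation_errors T u x \<delta>" and l: "0 \<le> l" "0 \<le> l'" "l + l' = 1"
  obtain k \<mu> w where 1: "truncations T u x \<delta> k \<mu> w" "R = (\<Sum>j<k. rank_one (\<mu> j *\<^sub>R u j - bidual_embedding (w j))
      (x j))"
    using R(1) unfolding truncation_errors_def by blast
  obtain k' \<mu>' w' where 2: "truncations T u x \<delta> k' \<mu>' w'" "R'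
      = (\<Sum>j<k'. rank_one (\<mu>' j *\<^sub>R u j - bidual_embedding (w' j)) (x j))"
    using R(2) unfolding truncation_errors_def by blast
  define K where "K = max k k'"
  note t = truncations_extend[OF 1(1), of K, OF max.cobounded1[of k k', folded K_def]]
  note t' = truncations_extend[OF 2(1), of K, OF max.cobounded2[of k' k, folded K_def]]
  define \<nu> where "\<nu> j = l * \<mu> j + l' * \<mu>' j" for j
  define v where "v j = l *\<^sub>R w j + l' *\<^sub>R w' j" for j
  have "truncations T u x \<delta> K \<nu> v"
    unfolding truncations_def
  proof (intro conjI allI impI)
    fix j
    show "0 \<le> \<nu> j" using t(1) t'(1) l by (auto simp: truncations_def \<nu>_def intro!: add_nonneg_nonneg)
    have "\<nu> j \<le> l * 1 + l' * 1"
      unfolding \<nu>_def using t(1) t'(1) l by (intro add_mono mult_left_mono) (auto simp: truncations_def)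
    then show "\<nu> j \<le> 1" using l by simp
    have "norm (v j) \<le> l * norm (w j) + l' * norm (w' j)"
      unfolding v_def using l by (intro order_trans[OF norm_triangle_ineq]) simp
    also have "\<dots> \<le> l * (\<mu> j * norm (u j)) + l' * (\<mu>' j * norm (u j))"
      using t(1) t'(1) l by (intro add_mono mult_left_mono) (auto simp: truncations_def)
    finally show "norm (v j) \<le> \<nu> j * norm (u j)" by (simp add: \<nu>_def algebra_simps)
    show "\<nu> j = 0" if "K \<le> j" using t(1) t'(1) that by (simp add: truncations_def \<nu>_def)
  next
    let ?S = "\<lambda>\<mu>. \<Sum>j<K. \<mu> j *\<^sub>R rank_one (u j) (x j)"
    have "?S \<nu> = l *\<^sub>R ?S \<mu> + l' *\<^sub>R ?S \<mu>'"
      by (simp add: \<nu>_def scaleR_left_distrib sum.distrib scaleR_sum_right)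
    moreover have "blinfun_adjoint T = l *\<^sub>R blinfun_adjoint T + l' *\<^sub>R blinfun_adjoint T"
      using l by (simp flip: scaleR_left_distrib)
    ultimately have "blinfun_adjoint T - ?S \<nu> =
        (l *\<^sub>R blinfun_adjoint T + l' *\<^sub>R blinfun_adjoint T) - (l *\<^sub>R ?S \<mu> + l' *\<^sub>R ?S \<mu>')"
      by (rule arg_cong2[where f = minus, rotated])
    also have "\<dots> = l *\<^sub>R (blinfun_adjoint T - ?S \<mu>) + l' *\<^sub>R (blinfun_adjoint T - ?S \<mu>')"
      by (simp only: scaleR_right_diff_distrib add_diff_add)
    finally have "blinfun_adjoint T - ?S \<nu> = \<dots>" .
    also have "norm \<dots> \<le> l * norm (blinfun_adjoint T - ?S \<mu>) + l' * norm (blinfun_adjoint T - ?S \<mu>')"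
      using l by (intro order_trans[OF norm_triangle_ineq]) simp
    also have "\<dots> \<le> l * \<delta> + l' * \<delta>"
      using t(1) t'(1) l by (intro add_mono mult_left_mono) (auto simp: truncations_def)
    also have "\<dots> = \<delta>" using l by (simp flip: distrib_right)
    finally show "norm (blinfun_adjoint T - ?S \<nu>) \<le> \<delta>" .
  qed
  moreover have "l *\<^sub>R R + l' *\<^sub>R R' = (\<Sum>j<K. rank_one (\<nu> j *\<^sub>R u j - bidual_embedding (v j)) (x j))"
  proof -
    have "l *\<^sub>R rank_one (\<mu> j *\<^sub>R u j - bidual_embedding (w j)) (x j)
        + l' *\<^sub>R rank_one (\<mu>' j *\<^sub>R u j - bidual_embedding (w' j)) (x j) =
        rank_one (\<nu> j *\<^sub>R u j - bidual_embedding (v j)) (x j)" for j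
    proof -
      have "\<nu> j *\<^sub>R u j - bidual_embedding (v j) =
          l *\<^sub>R (\<mu> j *\<^sub>R u j - bidual_embedding (w j)) + l' *\<^sub>R (\<mu>' j *\<^sub>R u j - bidual_embedding (w' j))"
        by (simp add: \<nu>_def v_def algebra_simps blinfun.add_right blinfun.scaleR_right)
      then show ?thesis by (simp only: rank_one_add rank_one_scaleR)
    qed
    then show ?thesis unfolding 1(2) 2(2) t(2) t'(2) scaleR_sum_right sum.distrib[symmetric] by simp
  qed
  ultimately show "l *\<^sub>R R + l' *\<^sub>R R' \<in> truncation_errors T u x \<delta>"
    unfolding truncation_errors_def by blast
qed

lemma truncation_errors_finite_tensors: "truncation_errors T u x \<delta> \<subseteq> finite_tensors"
  unfolding truncation_errors_def
  by (auto intro!: subspace_sum[OF subspace_finite_tensors] rank_one_finite_tensors)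

text \<open>Otherwise a separating \<open>D\<close> exists. Vectors \<open>v j\<close> of E, no
  larger than \<open>u j\<close>, are chosen so that the restriction of \<open>D (x j)\<close> to E
  is at \<open>v j\<close> almost as large as \<open>u j\<close> evaluated at this restriction. What
  then remains of the separated quantity is the trace of the annihilator part, which would stay
  above \<open>\<epsilon> / 2\<close> although it tends to 0.\<close>

lemma truncation_tensor_small:
  fixes T :: "'x::banach_lattice \<Rightarrow>\<^sub>L 'e::banach"
  assumes ab: "0 \<le> a" "0 \<le> b" "a + b = 1"
    and AP: "approximation_property TYPE('e dual dual dual) \<or>
         positive_metric_approximation_property TYPE('x dual)"
    and T: "(\<lambda>j. rank_one (u j) (x j)) sums blinfun_adjoint T"
    and adm: "seq_admissible a b A u x" and A: "0 < A" and \<delta>: "0 < \<delta>" and \<epsilon>: "0 < \<epsilon>"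
  shows "\<exists>t ps k \<mu> w. 0 \<le> t \<and> t < \<epsilon> \<and> admissible a b t ps \<and> truncations T u x \<delta> k \<mu> w \<and>
    tensor ps = (\<Sum>j<k. rank_one (\<mu> j *\<^sub>R u j - bidual_embedding (w j)) (x j))"
proof (rule ccontr)
  assume neg: "\<not> ?thesis"
  define K where "K = truncation_errors T u x \<delta>"
  have far: "\<epsilon> \<le> t" if "0 \<le> t" "admissible a b t ps" "tensor ps \<in> K" for t ps
  proof (rule ccontr)
    assume "\<not> \<epsilon> \<le> t"
    then have "t < \<epsilon>" by simp
    with that neg show False unfolding K_def truncation_errors_def by blast
  qed
  obtain k0 where k0: "\<And>k. k \<ge> k0 \<Longrightarrow> norm ((\<Sum>j<k. rank_one (u j) (x j)) - blinfun_adjoint T) < \<delta>"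
    using LIMSEQ_D[OF T[unfolded sums_def] \<delta>] by auto
  have in_K: "(\<Sum>j<k. rank_one (u j - bidual_embedding (v j)) (x j)) \<in> K"
    if k: "k \<ge> k0" and v: "\<And>j. norm (v j) \<le> norm (u j)" for k v
  proof -
    \<comment> \<open>All weights are 1 up to \<open>k\<close>: for large \<open>k\<close> the
      truncated series is close to the adjoint of \<open>T\<close>, whatever the \<open>v j\<close>
      are in their balls.\<close>
    let ?\<mu> = "\<lambda>j. if j < k then 1 else 0 :: real" and ?w = "\<lambda>j. if j < k then v j else 0"
    have "truncations T u x \<delta> k ?\<mu> ?w"
      using k0[OF k] v by (simp add: truncations_def norm_minus_commute less_imp_le)
    then show ?thesis unfolding K_def truncation_errors_def
      by (intro CollectI exI[of _ k] exI[of _ ?\<mu>] exI[of _ ?w] conjI) simp_all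
  qed
  have ne: "K \<noteq> {}" using in_K[of k0 "\<lambda>_. 0"] by auto
  have K: "convex K" "K \<subseteq> finite_tensors"
    unfolding K_def by (rule convex_truncation_errors truncation_errors_finite_tensors)+
  obtain D where D: "\<And>t ps. 0 \<le> t \<Longrightarrow> admissible a b t ps \<Longrightarrow> (\<Sum>P\<leftarrow>ps. blinfun_apply (blinfun_apply D (snd P)) (fst
      P)) \<le> t"
    "\<And>ps. tensor ps \<in> K \<Longrightarrow> \<epsilon> \<le> (\<Sum>P\<leftarrow>ps. blinfun_apply (blinfun_apply D (snd P)) (fst P))"
    by (rule tensor_separation[OF ab K ne]) ((rule far; assumption), (rule that; assumption))
  \<comment> \<open>\<open>h j\<close> is the restriction of \<open>D (x j)\<close> to E; the
    tolerances \<open>d j\<close> add up to \<open>\<epsilon> / 2\<close>.\<close>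
  define h where "h j = D (x j) o\<^sub>L bidual_embedding" for j
  define d where "d j = \<epsilon> * (1 / 2) ^ (j + 2)" for j
  have d: "0 < d j" for j using \<epsilon> by (simp add: d_def)
  have "\<exists>v. norm v \<le> norm (u j) \<and> u j (h j) \<le> h j v + d j" for j
  proof -
    let ?c = "norm (u j) * norm (h j)"
    have c: "0 < 1 + ?c" by (simp add: add_pos_nonneg)
    then have "0 < d j / (1 + ?c)" using d by simp
    then obtain w where w: "norm w \<le> 1" "(1 - d j / (1 + ?c)) * norm (h j) \<le> h j w"
      using almost_norming[of "d j / (1 + ?c)" "h j"] by blast
    have "u j (h j) \<le> ?c" using abs_blinfun_le(1)[of "u j" "h j"] by simp
    also have "\<dots> = norm (u j) * ((1 - d j / (1 + ?c)) * norm (h j)) + d j * (?c / (1 + ?c))"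
      by (simp add: algebra_simps)
    also have "\<dots> \<le> norm (u j) * h j w + d j * 1"
      using w(2) d[of j] c by (intro add_mono mult_left_mono) (auto simp: divide_le_eq less_imp_le)
    also have "\<dots> = h j (norm (u j) *\<^sub>R w) + d j" by (simp add: blinfun.scaleR_right)
    finally show ?thesis using w(1) by (intro exI[of _ "norm (u j) *\<^sub>R w"]) (simp add: mult_left_le)
  qed
  then obtain v where v: "\<And>j. norm (v j) \<le> norm (u j)" "\<And>j. u j (h j) \<le> h j (v j) + d j" by metis
  have d_sum: "(\<Sum>j<k. d j) \<le> \<epsilon> / 2" for k
  proof -
    have "d sums (\<epsilon> / 4 * (1 / (1 - 1 / 2)))"
      using sums_mult[OF geometric_sums[of "1 / 2 :: real"], of "\<epsilon> / 4"]
          by (simp add: d_def[abs_def] power_add ac_simps)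
    then have "suminf d = \<epsilon> / 2" "summable d" by (auto simp: sums_iff)
    then show ?thesis using sum_le_suminf[of d "{..<k}"] d by (simp add: less_imp_le)
  qed
  have ge: "\<epsilon> / 2 \<le> (\<Sum>j<k. annihilator_part (D (x j)) (u j))" if k: "k \<ge> k0" for k
  proof -
    let ?ps = "map (\<lambda>j. (u j - bidual_embedding (v j), x j)) [0..<k]"
    have "tensor ?ps = (\<Sum>j<k. rank_one (u j - bidual_embedding (v j)) (x j))"
      by (simp add: tensor_def o_def sum_list_upt atLeast0LessThan)
    then have "tensor ?ps \<in> K" using in_K[OF k v(1)] by simp
    then have "\<epsilon> \<le> (\<Sum>P\<leftarrow>?ps. D (snd P) (fst P))" by (rule D(2))
    also have "\<dots> = (\<Sum>j<k. D (x j) (u j - bidual_embedding (v j)))"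
      by (simp add: o_def sum_list_upt atLeast0LessThan)
    also have "\<dots> \<le> (\<Sum>j<k. annihilator_part (D (x j)) (u j) + d j)"
    proof (rule sum_mono)
      fix j
      show "D (x j) (u j - bidual_embedding (v j)) \<le> annihilator_part (D (x j)) (u j) + d j"
        using v(2)[of j] by (simp add: blinfun.diff_right annihilator_part_apply h_def)
    qed
    also have "\<dots> \<le> (\<Sum>j<k. annihilator_part (D (x j)) (u j)) + \<epsilon> / 2" using d_sum by (simp add: sum.distrib)
    finally show ?thesis by simp
  qed
  have "(\<lambda>k. \<Sum>j<k. annihilator_part (D (x j)) (u j)) \<longlonglongrightarrow> 0"
    by (rule trace_tendsto_0[OF ab AP T adm A D(1)])
  then have "\<epsilon> / 2 \<le> 0" by (rule tendsto_lowerbound) (use ge in \<open>auto simp: eventually_sequentially\<close>)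
  with \<epsilon> show False by simp
qed

text \<open>The strong cost and all weak costs form one family, so that the bookkeeping for
  splitting and slicing is done once.\<close>

definition cost_functions :: "real \<Rightarrow> real \<Rightarrow> (('w::real_normed_vector \<times> 'y::banach_lattice) \<Rightarrow> ennreal) set" where
  "cost_functions a b = insert (\<lambda>P. pcost a (norm (fst P))) {\<lambda>P. pcost b (blinfun_apply F (snd P)) |F :: 'y
      dual. norm F \<le> 1}"

lemma admissible_iff_cost_functions:
  "admissible a b t ps \<longleftrightarrow> (\<forall>P\<in>set ps. 0 \<le> snd P) \<and> (\<forall>c\<in>cost_functions a b. (\<Sum>P\<leftarrow>ps. c P) \<le> ennreal t)"
  by (auto simp: admissible_iff cost_functions_def)

lemma cost_function_scale:
  assumes "c \<in> cost_functions a b" "0 \<le> a" "0 \<le> b" "0 \<le> s"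
  shows "c (scale_pair a b s P) \<le> ennreal s * c P"
  using assms unfolding cost_functions_def
  by (elim insertE CollectE exE conjE) (simp_all add: scale_pair_cost)

lemma cost_function_zero: "c \<in> cost_functions a b \<Longrightarrow> c (0, 0) = 0"
  by (auto simp: cost_functions_def blinfun.zero_right)

lemma cost_function_mono:
  "c \<in> cost_functions a b \<Longrightarrow> 0 \<le> a \<Longrightarrow> norm v \<le> norm w \<Longrightarrow> c (v, y) \<le> c (w, y)"
  by (auto simp: cost_functions_def intro: pcost_mono)

text \<open>Scaling by \<open>\<mu> j\<close> and by \<open>1 - \<mu> j\<close> multiplies the cost
  of a term by at most these factors, which add up to 1: a term present in both parts is paid for
  once.\<close>

lemma split_cost:
  fixes k m :: nat
  assumes c: "c \<in> cost_functions a b" and ab: "0 \<le> a" "0 \<le> b"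
    and \<mu>: "\<And>j. 0 \<le> \<mu> j \<and> \<mu> j \<le> 1" and Q: "\<And>j. c (Q j) \<le> c (P j)"
  shows "(\<Sum>j<k. c (scale_pair a b (\<mu> j) (Q j))) + (\<Sum>j<m. c (scale_pair a b (1 - \<mu> j) (P j))) \<le> (\<Sum>j<max k m. c (P j))"
proof -
  let ?K = "max k m"
  have "(\<Sum>j<k. c (scale_pair a b (\<mu> j) (Q j))) \<le> (\<Sum>j<?K. ennreal (\<mu> j) * c (P j))"
  proof -
    have "(\<Sum>j<k. c (scale_pair a b (\<mu> j) (Q j))) \<le> (\<Sum>j<?K. c (scale_pair a b (\<mu> j) (Q j)))"
      by (intro sum_mono2) auto
    also have "\<dots> \<le> (\<Sum>j<?K. ennreal (\<mu> j) * c (P j))"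
    proof (rule sum_mono)
      fix j
      have "c (scale_pair a b (\<mu> j) (Q j)) \<le> ennreal (\<mu> j) * c (Q j)" using \<mu>
          by (intro cost_function_scale[OF c ab]) auto
      also have "\<dots> \<le> ennreal (\<mu> j) * c (P j)" by (intro mult_left_mono Q) simp
      finally show "c (scale_pair a b (\<mu> j) (Q j)) \<le> ennreal (\<mu> j) * c (P j)" .
    qed
    finally show ?thesis .
  qed
  moreover have "(\<Sum>j<m. c (scale_pair a b (1 - \<mu> j) (P j))) \<le> (\<Sum>j<?K. ennreal (1 - \<mu> j) * c (P j))"
  proof -
    have "(\<Sum>j<m. c (scale_pair a b (1 - \<mu> j) (P j))) \<le> (\<Sum>j<?K. c (scale_pair a b (1 - \<mu> j) (P j)))"
      by (intro sum_mono2) auto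
    also have "\<dots> \<le> (\<Sum>j<?K. ennreal (1 - \<mu> j) * c (P j))"
      using \<mu> by (intro sum_mono cost_function_scale[OF c ab]) auto
    finally show ?thesis .
  qed
  ultimately have "(\<Sum>j<k. c (scale_pair a b (\<mu> j) (Q j))) + (\<Sum>j<m. c (scale_pair a b (1 - \<mu> j) (P j))) \<le>
      (\<Sum>j<?K. ennreal (\<mu> j) * c (P j)) + (\<Sum>j<?K. ennreal (1 - \<mu> j) * c (P j))" by (rule add_mono)
  also have "\<dots> = (\<Sum>j<?K. c (P j))"
    unfolding sum.distrib[symmetric]
  proof (intro sum.cong refl)
    fix j
    have "ennreal (\<mu> j) + ennreal (1 - \<mu> j) = 1" using \<mu>[of j] by (simp flip: ennreal_plus)
    then show "ennreal (\<mu> j) * c (P j) + ennreal (1 - \<mu> j) * c (P j) = c (P j)"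
      by (simp flip: distrib_right)
  qed
  finally show ?thesis .
qed

section \<open>Concatenation and slicing of finite blocks\<close>

lemma admissible_appendD:
  assumes "admissible a b t (ps @ qs)"
  shows "admissible a b t ps" "admissible a b t qs"
proof -
  have "(\<Sum>P\<leftarrow>ps. c P) \<le> (\<Sum>P\<leftarrow>ps @ qs. c P)" "(\<Sum>P\<leftarrow>qs. c P) \<le> (\<Sum>P\<leftarrow>ps @ qs. c P)" for c :: "_ \<Rightarrow> ennreal"
    by simp_all
  moreover have "(\<Sum>P\<leftarrow>ps @ qs. c P) \<le> ennreal t" if "c \<in> cost_functions a b" for c
    using assms that by (simp only: admissible_iff_cost_functions)
  ultimately have "\<forall>c\<in>cost_functions a b. (\<Sum>P\<leftarrow>ps. c P) \<le> ennreal t \<and> (\<Sum>P\<leftarrow>qs. c P) \<le> ennreal t"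
    by (meson order_trans)
  then show "admissible a b t ps" "admissible a b t qs"
    using assms unfolding admissible_iff_cost_functions by auto
qed

definition prepend :: "'p list \<Rightarrow> (nat \<Rightarrow> 'p) \<Rightarrow> nat \<Rightarrow> 'p" where
  "prepend ds s j = (if j < length ds then ds ! j else s (j - length ds))"

lemma map_prepend: "map (prepend ds s) [0..<k] = take k ds @ map s [0..<k - length ds]"
  by (rule nth_equalityI) (auto simp: prepend_def nth_append min_def)

lemma sums_prepend:
  fixes g :: "'p \<Rightarrow> 'a::real_normed_vector"
  assumes "(\<lambda>j. g (s j)) sums S"
  shows "(\<lambda>j. g (prepend ds s j)) sums ((\<Sum>P\<leftarrow>ds. g P) + S)"
proof -
  have "(\<Sum>j<length ds. g (prepend ds s j)) = (\<Sum>P\<leftarrow>ds. g P)"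
    by (simp add: sum_list_sum_nth atLeast0LessThan prepend_def)
  moreover have "(\<lambda>j. g (prepend ds s (j + length ds))) sums S" using assms by (simp add: prepend_def)
  ultimately show ?thesis using sums_iff_shift'[of "\<lambda>j. g (prepend ds s j)" "length ds" "(\<Sum>P\<leftarrow>ds. g P) + S"] by simp
qed

text \<open>A prefix of the \<open>m\<close> rounds is a fraction i / m of the whole operator plus a
  prefix of a single round of weight 1 / m. For large \<open>m\<close> its norm hardly exceeds that
  of the whole, however large the single terms of \<open>L\<close> are.\<close>

definition spread :: "real \<Rightarrow> real \<Rightarrow> nat \<Rightarrow> ('w::real_vector \<times> 'y::real_vector) list \<Rightarrow> ('w \<times> 'y) list" where
  "spread a b m L = concat (replicate m (map (scale_pair a b (1 / real m)) L))"

lemma op_tensor_scale_pair: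
  assumes "a + b = 1" "0 \<le> c"
  shows "op_tensor (map (scale_pair a b c) L) = c *\<^sub>R op_tensor L"
proof (induction L)
  case (Cons P L)
  have "c powr a * c powr b = c" using assms by (simp flip: powr_add)
  then show ?case using Cons
    by (simp add: scale_pair_def rank_one_scaleR scaleR_right_distrib mult.commute)
qed simp

lemma op_tensor_concat_replicate: "op_tensor (concat (replicate m L)) = real m *\<^sub>R op_tensor L"
  by (induction m) (simp_all add: scaleR_left_distrib)

lemma op_tensor_spread:
  assumes "a + b = 1" "0 < m"
  shows "op_tensor (spread a b m L) = op_tensor L"
  using assms by (simp add: spread_def op_tensor_concat_replicate op_tensor_scale_pair)

lemma embed_scale_pair: "embed_pair (scale_pair a b c P) = scale_pair a b c (embed_pair P)"
  by (simp add: embed_pair_def scale_pair_def blinfun.scaleR_right)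

lemma spread_cost:
  assumes c: "c \<in> cost_functions a b" and ab: "0 \<le> a" "0 \<le> b"
  shows "(\<Sum>P\<leftarrow>map embed_pair (spread a b m L). c P) \<le> (\<Sum>P\<leftarrow>map embed_pair L. c P)"
proof -
  let ?s = "\<Sum>P\<leftarrow>map (scale_pair a b (1 / real m)) L. c (embed_pair P)"
  have 1: "(\<Sum>P\<leftarrow>concat (replicate n L'). f P) = of_nat n * (\<Sum>P\<leftarrow>L'. f P)" for n and L' :: "'q list" and f ::
      "'q \<Rightarrow> ennreal"
    by (induction n) (simp_all add: distrib_right)
  have "?s \<le> ennreal (1 / real m) * (\<Sum>P\<leftarrow>L. c (embed_pair P))"
  proof (induction L)
    case (Cons P L)
    have "c (embed_pair (scale_pair a b (1 / real m) P)) \<le> ennreal (1 / real m) * c (embed_pair P)"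
      unfolding embed_scale_pair by (rule cost_function_scale[OF c ab]) simp
    with Cons show ?case by (simp add: distrib_left add_mono)
  qed simp
  then have "ennreal (real m) * ?s \<le> ennreal (real m) * (ennreal (1 / real m) * (\<Sum>P\<leftarrow>L. c (embed_pair P)))"
    by (rule mult_left_mono) simp
  also have "\<dots> = ennreal (real m * (1 / real m)) * (\<Sum>P\<leftarrow>L. c (embed_pair P))"
    by (simp add: ennreal_mult mult.assoc del: times_divide_eq_right)
  also have "\<dots> \<le> 1 * (\<Sum>P\<leftarrow>L. c (embed_pair P))"
    by (intro mult_right_mono) (cases "m = 0"; simp)+
  finally show ?thesis
    using 1[of "\<lambda>P. c (embed_pair P)" m "map (scale_pair a b (1 / real m)) L"]
    by (simp add: spread_def o_def ennreal_of_nat_eq_real_of_nat)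
qed

lemma take_concat_replicate:
  "\<exists>i\<le>m. \<exists>q. op_tensor (take r (concat (replicate m L))) = real i *\<^sub>R op_tensor L + op_tensor (take q L)"
proof (induction m arbitrary: r)
  case 0
  then show ?case by (auto intro: exI[of _ 0])
next
  case (Suc m)
  show ?case
  proof (cases "r \<le> length L")
    case True
    then show ?thesis by (intro exI[of _ 0] conjI exI[of _ r]) auto
  next
    case False
    obtain i q where "i \<le> m" "op_tensor (take (r - length L) (concat (replicate m L))) = real i *\<^sub>R op_tensor L
        + op_tensor (take q L)"
      using Suc by blast
    then show ?thesis using False
      by (intro exI[of _ "Suc i"] conjI exI[of _ q]) (auto simp: scaleR_left_distrib)
  qed
qed

lemma norm_op_tensor_take_le: "norm (op_tensor (take q L)) \<le> (\<Sum>P\<leftarrow>L. norm (rank_one (snd P) (fst P)))"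
proof -
  have "norm (op_tensor (take q L)) \<le> (\<Sum>P\<leftarrow>take q L. norm (rank_one (snd P) (fst P)))"
    unfolding op_tensor_def by (rule norm_sum_list_le) simp
  also have "\<dots> \<le> (\<Sum>P\<leftarrow>take q L. norm (rank_one (snd P) (fst P))) + (\<Sum>P\<leftarrow>drop q L. norm (rank_one (snd P) (fst P)))"
    by (auto intro!: sum_list_nonneg)
  also have "\<dots> = (\<Sum>P\<leftarrow>L. norm (rank_one (snd P) (fst P)))"
    by (simp only: sum_list_append[symmetric] map_append[symmetric] append_take_drop_id)
  finally show ?thesis .
qed

lemma spread_prefix_small:
  assumes ab: "a + b = 1" and \<epsilon>: "0 < \<epsilon>"
  obtains m where "0 < m" "\<And>r. norm (op_tensor (take r (spread a b m L))) \<le> norm (op_tensor L) + \<epsilon>"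
proof -
  define M where "M = (\<Sum>P\<leftarrow>L. norm (rank_one (snd P) (fst P)))"
  obtain m0 where m0: "M / \<epsilon> \<le> real m0" using real_arch_simple by blast
  define m where "m = Suc m0"
  have m: "0 < m" "M / real m \<le> \<epsilon>" using m0 \<epsilon> by (auto simp: m_def field_simps)
  have "norm (op_tensor (take r (spread a b m L))) \<le> norm (op_tensor L) + \<epsilon>" for r
  proof -
    let ?L = "map (scale_pair a b (1 / real m)) L"
    obtain i q where i: "i \<le> m" "op_tensor (take r (spread a b m L)) = real i *\<^sub>R op_tensor ?L
        + op_tensor (take q ?L)"
      using take_concat_replicate[of m r ?L] unfolding spread_def by blast
    have "op_tensor (take r (spread a b m L)) = (real i / real m) *\<^sub>R op_tensor L
        + (1 / real m) *\<^sub>R op_tensor (take q L)"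
      using i(2) op_tensor_scale_pair[OF ab, of "1 / real m" L] op_tensor_scale_pair[OF ab, of "1 / real m"
          "take q L"]
      by (simp add: take_map)
    also have "norm \<dots> \<le> (real i / real m) * norm (op_tensor L) + (1 / real m) * norm (op_tensor (take q L))"
      by (rule order_trans[OF norm_triangle_ineq]) simp
    also have "\<dots> \<le> 1 * norm (op_tensor L) + (1 / real m) * M"
      using i(1) m(1) norm_op_tensor_take_le[of q L] unfolding M_def
      by (intro add_mono mult_right_mono mult_left_mono) (auto simp: divide_le_eq_1)
    also have "\<dots> \<le> norm (op_tensor L) + \<epsilon>" using m(2) by simp
    finally show ?thesis .
  qed
  with m(1) show ?thesis using that by blast
qed

text \<open>\<open>L\<close> collects the portions \<open>\<mu> j\<close> moved to E; the new series
  is the correction \<open>ps\<close> followed by the remaining portions \<open>1 - \<mu> j\<close>.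
  The adjoint of \<open>T'\<close> is \<open>tensor ps\<close>, of norm at most
  \<open>2 * t\<close>, plus a truncation error of at most \<open>\<epsilon> / 2\<close>. The terms
  split off earlier are carried along in \<open>pre\<close>, so that one bound covers the cost of
  the whole representation.\<close>

lemma split_off_step:
  fixes T :: "'x::banach_lattice \<Rightarrow>\<^sub>L 'e::banach"
    and z :: "nat \<Rightarrow> 'e dual dual \<times> 'x dual"
  assumes ab: "0 \<le> a" "0 \<le> b" "a + b = 1"
    and AP: "approximation_property TYPE('e dual dual dual) \<or>
         positive_metric_approximation_property TYPE('x dual)"
    and T: "(\<lambda>j. rank_one (fst (z j)) (snd (z j))) sums blinfun_adjoint T"
    and adm: "\<And>k. admissible a b A (pre @ map z [0..<k])" and A: "0 < A" and \<epsilon>: "0 < \<epsilon>"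
  shows "\<exists>L z' T'. L \<noteq> [] \<and> (\<forall>k. admissible a b (A + \<epsilon>) (pre @ map embed_pair L @ map z' [0..<k])) \<and>
     (\<lambda>j. rank_one (fst (z' j)) (snd (z' j))) sums blinfun_adjoint T' \<and> T = op_tensor L + T' \<and> norm T' \<le> \<epsilon> \<and>
     (\<forall>r. norm (op_tensor (take r L)) \<le> norm T + 2 * \<epsilon>)"
proof -
  define u x where "u j = fst (z j)" and "x j = snd (z j)" for j
  have z: "z j = (u j, x j)" for j by (simp add: u_def x_def)
  have T: "(\<lambda>j. rank_one (u j) (x j)) sums blinfun_adjoint T" using T by (simp add: u_def x_def)
  have "seq_admissible a b A u x"
    unfolding seq_admissible_def using admissible_appendD(2)[OF adm] by (simp add: z[abs_def])
  then have x0: "0 \<le> x j" for j by (simp add: seq_admissible_iff)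
  have "0 < \<epsilon> / 2" "0 < \<epsilon> / 4" using \<epsilon> by simp_all
  from truncation_tensor_small[OF ab AP T \<open>seq_admissible a b A u x\<close> A this]
  obtain t ps k \<mu> w where t: "0 \<le> t" "t < \<epsilon> / 4" and ps: "admissible a b t ps" and tr:
      "truncations T u x (\<epsilon> / 2) k \<mu> w"
    and tps: "tensor ps = (\<Sum>j<k. rank_one (\<mu> j *\<^sub>R u j - bidual_embedding (w j)) (x j))" by blast
  have \<mu>: "0 \<le> \<mu> j \<and> \<mu> j \<le> 1" "norm (w j) \<le> \<mu> j * norm (u j)" for j using tr by (auto simp: truncations_def)
  \<comment> \<open>If \<open>\<mu> j = 0\<close>, then \<open>w j = 0\<close>, and division by zero
    yields the vector 0.\<close>
  define Q where "Q j = ((1 / \<mu> j) *\<^sub>R w j, x j)" for j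
  define L0 where "L0 = map (\<lambda>j. scale_pair a b (\<mu> j) (Q j)) [0..<k]"
  define s where "s j = scale_pair a b (1 - \<mu> j) (z j)" for j
  define z' where "z' = prepend ps s"
  define T' where "T' = T - op_tensor L0"
  have scale_Q: "rank_one (snd (scale_pair a b (\<mu> j) (Q j))) (fst (scale_pair a b (\<mu> j) (Q j)))
      = rank_one (x j) (w j)" for j
  proof -
    have "op_tensor (map (scale_pair a b (\<mu> j)) [Q j]) = \<mu> j *\<^sub>R op_tensor [Q j]"
      using \<mu>(1) by (intro op_tensor_scale_pair ab) auto
    moreover have "\<mu> j *\<^sub>R rank_one (x j) ((1 / \<mu> j) *\<^sub>R w j) = rank_one (x j) (w j)"
      using \<mu>(2)[of j] by (cases "\<mu> j = 0") (auto simp: rank_one_scaleR)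
    ultimately show ?thesis by (simp add: Q_def)
  qed
  have L0: "op_tensor L0 = (\<Sum>j<k. rank_one (x j) (w j))"
    by (simp add: L0_def op_tensor_def o_def scale_Q sum_list_upt atLeast0LessThan)
  have adj_L0: "blinfun_adjoint (op_tensor L0) = (\<Sum>j<k. rank_one (bidual_embedding (w j)) (x j))"
    unfolding L0 by (simp add: linear_sum[OF bounded_linear.linear[OF bounded_linear_blinfun_adjoint]]
        blinfun_adjoint_rank_one)
  have tail: "(\<lambda>j. rank_one (fst (s j)) (snd (s j))) sums (blinfun_adjoint T - (\<Sum>j<k. \<mu> j *\<^sub>R rank_one (u j) (x j)))"
  proof -
    have "(\<lambda>j. \<mu> j *\<^sub>R rank_one (u j) (x j)) sums (\<Sum>j<k. \<mu> j *\<^sub>R rank_one (u j) (x j))"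
      using tr by (intro sums_finite) (auto simp: truncations_def not_less)
    from sums_diff[OF T this]
    have "(\<lambda>j. rank_one (u j) (x j) - \<mu> j *\<^sub>R rank_one (u j) (x j)) sums
        (blinfun_adjoint T - (\<Sum>j<k. \<mu> j *\<^sub>R rank_one (u j) (x j)))" .
    moreover have "rank_one (fst (s j)) (snd (s j)) = rank_one (u j) (x j) - \<mu> j *\<^sub>R rank_one (u j) (x j)" for j
      using \<mu>(1)[of j] rank_one_scale_pair[OF ab(3), of "1 - \<mu> j" "z j"]
      by (simp add: s_def z scaleR_left_diff_distrib)
    ultimately show ?thesis by simp
  qed
  have tps_eq: "tensor ps = (\<Sum>j<k. \<mu> j *\<^sub>R rank_one (u j) (x j)) - blinfun_adjoint (op_tensor L0)"
    by (simp add: tps adj_L0 rank_one_diff rank_one_scaleR sum_subtractf)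
  have adj_T': "blinfun_adjoint T' = tensor ps + (blinfun_adjoint T - (\<Sum>j<k. \<mu> j *\<^sub>R rank_one (u j) (x j)))"
    by (simp add: T'_def blinfun_adjoint_diff tps_eq)
  have sums': "(\<lambda>j. rank_one (fst (z' j)) (snd (z' j))) sums blinfun_adjoint T'"
    using sums_prepend[where g = "\<lambda>P. rank_one (fst P) (snd P)" and s = s, OF tail, of ps]
        by (simp add: z'_def adj_T' tensor_def)
  have T'_norm: "norm T' \<le> \<epsilon>"
  proof -
    have "norm T' \<le> norm (blinfun_adjoint T')" by (rule norm_blinfun_adjoint_ge)
    also have "\<dots> \<le> norm (tensor ps) + norm (blinfun_adjoint T - (\<Sum>j<k. \<mu> j *\<^sub>R rank_one (u j) (x j)))"
      unfolding adj_T' by (rule norm_triangle_ineq)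
    also have "\<dots> \<le> 2 * t + \<epsilon> / 2"
      using norm_tensor_le[OF ab t(1) ps] tr by (intro add_mono) (auto simp: truncations_def)
    finally show ?thesis using t by simp
  qed
  obtain m where m: "0 < m" "\<And>r. norm (op_tensor (take r (spread a b m L0))) \<le> norm (op_tensor L0) + \<epsilon>"
    using spread_prefix_small[OF ab(3) \<epsilon>, of L0] by blast
  \<comment> \<open>The leading zero term makes \<open>L\<close> nonempty, so that the list grows at
    every step of the iteration.\<close>
  define L where "L = (0, 0) # spread a b m L0"
  have "op_tensor L = op_tensor L0" using op_tensor_spread[OF ab(3) m(1)] by (simp add: L_def)
  then have T_eq: "T = op_tensor L + T'" by (simp add: T'_def)
  have prefix: "norm (op_tensor (take r L)) \<le> norm T + 2 * \<epsilon>" for r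
  proof -
    have "norm (op_tensor L0) \<le> norm T + norm T'"
      using norm_triangle_ineq4[of T T'] by (simp add: T'_def)
    moreover have "norm (op_tensor (take r L)) \<le> norm (op_tensor L0) + \<epsilon>"
    proof (cases r)
      case (Suc r')
      then show ?thesis using m(2)[of r'] by (simp add: L_def)
    qed (use \<epsilon> in simp)
    ultimately show ?thesis using T'_norm by simp
  qed
  have adm': "admissible a b (A + \<epsilon>) (pre @ map embed_pair L @ map z' [0..<q])" for q
    unfolding admissible_iff_cost_functions
  proof (intro conjI ballI)
    fix P assume "P \<in> set (pre @ map embed_pair L @ map z' [0..<q])"
    then consider "P \<in> set pre" | "P \<in> embed_pair ` set L" | "P \<in> set (map z' [0..<q])" by auto
    then show "0 \<le> snd P"
    proof cases
      case 1
      then show ?thesis using adm[of 0] by (simp add: admissible_iff)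
    next
      case 2
      then show ?thesis using x0 m(1)
        by (auto simp: L_def spread_def L0_def Q_def embed_pair_def scale_pair_def intro!: scaleR_nonneg_nonneg)
    next
      case 3
      then have "P \<in> set (take q ps) \<or> P \<in> s ` {0..<q - length ps}" unfolding z'_def map_prepend by simp
      then show ?thesis
      proof
        assume "P \<in> set (take q ps)"
        then have "P \<in> set ps" by (rule in_set_takeD)
        then show ?thesis using ps by (simp add: admissible_iff)
      next
        assume "P \<in> s ` {0..<q - length ps}"
        then obtain j where "P = s j" by blast
        then show ?thesis using x0[of j] by (simp add: s_def z scale_pair_def scaleR_nonneg_nonneg)
      qed
    qed
  next
    fix c :: "'e dual dual \<times> 'x dual \<Rightarrow> ennreal" assume c: "c \<in> cost_functions a b"
    let ?n = "q - length ps"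
    have "(\<Sum>P\<leftarrow>map embed_pair L. c P) \<le> (\<Sum>P\<leftarrow>map embed_pair L0. c P)"
      using spread_cost[OF c ab(1,2), of m L0] cost_function_zero[OF c]
      by (simp add: L_def embed_pair_def blinfun.zero_right)
    also have "\<dots> = (\<Sum>j<k. c (scale_pair a b (\<mu> j) (embed_pair (Q j))))"
      by (simp add: L0_def o_def embed_scale_pair sum_list_upt atLeast0LessThan)
    finally have 1: "(\<Sum>P\<leftarrow>map embed_pair L. c P) \<le> (\<Sum>j<k. c (scale_pair a b (\<mu> j) (embed_pair (Q j))))" .
    have 2: "(\<Sum>P\<leftarrow>map z' [0..<q]. c P) \<le> ennreal t + (\<Sum>j<?n. c (scale_pair a b (1 - \<mu> j) (z j)))"
    proof -
      have "(\<Sum>P\<leftarrow>take q ps. c P) \<le> ennreal t"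
        using admissible_appendD(1)[of a b t "take q ps" "drop q ps"] ps c
            by (simp add: admissible_iff_cost_functions)
      moreover have "(\<Sum>P\<leftarrow>map z' [0..<q]. c P) = (\<Sum>P\<leftarrow>take q ps. c P) + (\<Sum>j<?n. c (scale_pair a b (1 - \<mu> j) (z j)))"
        unfolding z'_def map_prepend by (simp add: o_def s_def sum_list_upt atLeast0LessThan)
      ultimately show ?thesis by (simp add: add_right_mono)
    qed
    have Q: "c (embed_pair (Q j)) \<le> c (z j)" for j
    proof -
      have "norm ((1 / \<mu> j) *\<^sub>R w j) \<le> norm (u j)"
        using \<mu>(1)[of j] \<mu>(2)[of j] by (cases "\<mu> j = 0") (auto simp: field_simps)
      then show ?thesis unfolding z Q_def embed_pair_def fst_conv snd_conv
        by (intro cost_function_mono[OF c ab(1)]) simp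
    qed
    have "(\<Sum>P\<leftarrow>pre @ map embed_pair L @ map z' [0..<q]. c P) =
        (\<Sum>P\<leftarrow>pre. c P) + ((\<Sum>P\<leftarrow>map embed_pair L. c P) + (\<Sum>P\<leftarrow>map z' [0..<q]. c P))" by simp
    also have "\<dots> \<le> (\<Sum>P\<leftarrow>pre. c P) + ((\<Sum>j<k. c (scale_pair a b (\<mu> j) (embed_pair (Q j)))) +
        (ennreal t + (\<Sum>j<?n. c (scale_pair a b (1 - \<mu> j) (z j)))))"
      by (intro add_left_mono add_mono 1 2)
    also have "\<dots> = (\<Sum>P\<leftarrow>pre. c P) + ((\<Sum>j<k. c (scale_pair a b (\<mu> j) (embed_pair (Q j)))) +
        (\<Sum>j<?n. c (scale_pair a b (1 - \<mu> j) (z j)))) + ennreal t" by (simp add: ac_simps)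
    \<comment> \<open>The moved and the remaining portions recombine to a prefix of the old series;
      only the cost \<open>t\<close> of the correction is new.\<close>
    also have "\<dots> \<le> (\<Sum>P\<leftarrow>pre. c P) + (\<Sum>j<max k ?n. c (z j)) + ennreal t"
      by (intro add_left_mono add_right_mono split_cost[OF c ab(1,2) \<mu>(1) Q])
    also have "(\<Sum>P\<leftarrow>pre. c P) + (\<Sum>j<max k ?n. c (z j)) = (\<Sum>P\<leftarrow>pre @ map z [0..<max k ?n]. c P)"
      by (simp add: o_def sum_list_upt atLeast0LessThan)
    also have "\<dots> \<le> ennreal A" using adm c by (simp only: admissible_iff_cost_functions)
    also have "ennreal A + ennreal t = ennreal (A + t)" using A t by simp
    also have "\<dots> \<le> ennreal (A + \<epsilon>)" using t \<epsilon> by (intro ennreal_leI) simp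
    finally show "(\<Sum>P\<leftarrow>pre @ map embed_pair L @ map z' [0..<q]. c P) \<le> ennreal (A + \<epsilon>)"
      by (simp add: add_right_mono)
  qed
  have ne: "L \<noteq> []" by (simp add: L_def)
  show ?thesis
  proof (rule exI[of _ L], rule exI[of _ z'], rule exI[of _ T'], intro conjI)
    show "L \<noteq> []" by (rule ne)
    show "\<forall>k. admissible a b (A + \<epsilon>) (pre @ map embed_pair L @ map z' [0..<k])" using adm' by blast
    show "(\<lambda>j. rank_one (fst (z' j)) (snd (z' j))) sums blinfun_adjoint T'" by (rule sums')
    show "T = op_tensor L + T'" by (rule T_eq)
    show "norm T' \<le> \<epsilon>" by (rule T'_norm)
    show "\<forall>r. norm (op_tensor (take r L)) \<le> norm T + 2 * \<epsilon>" using prefix by blast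
  qed
qed

section \<open>Iteration and convergence\<close>

lemma limit_of_prefixes:
  fixes p :: "nat \<Rightarrow> 'q list"
  assumes step: "\<And>n. \<exists>L. L \<noteq> [] \<and> p (Suc n) = p n @ L"
  obtains y where "\<And>k n. k \<le> length (p n) \<Longrightarrow> map y [0..<k] = take k (p n)"
proof -
  have ext: "\<exists>L. p m = p n @ L" if "n \<le> m" for n m
    using that
  proof (induction rule: dec_induct)
    case (step m)
    with assms[of m] show ?case by auto
  qed simp
  have len: "n \<le> length (p n)" for n
  proof (induction n)
    case (Suc n)
    obtain L where "L \<noteq> []" "p (Suc n) = p n @ L" using step by blast
    with Suc show ?case by (cases L) auto
  qed simp
  define y where "y j = p (Suc j) ! j" for j
  have "map y [0..<k] = take k (p n)" if k: "k \<le> length (p n)" for k n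
  proof (rule nth_equalityI)
    fix j assume "j < length (map y [0..<k])"
    then have j: "j < k" by simp
    have "p (Suc j) ! j = p n ! j"
    proof (cases "Suc j \<le> n")
      case True
      then obtain L where "p n = p (Suc j) @ L" using ext by blast
      then show ?thesis using len[of "Suc j"] by (simp add: nth_append)
    next
      case False
      then obtain L where "p (Suc j) = p n @ L" using ext[of n "Suc j"] by auto
      then show ?thesis using j k by (simp add: nth_append)
    qed
    then show "map y [0..<k] ! j = take k (p n) ! j" using j by (simp add: y_def)
  qed (use k in simp)
  then show ?thesis using that by blast
qed

text \<open>Step n may spend \<open>e n\<close>, and the budgets \<open>B n\<close> stay below
  \<open>A + \<epsilon>\<close>. The remainders \<open>S n\<close> tend to 0. Prefixes of a block
  are controlled by the remainder before it, so the partial sums that stop inside a block converge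
  too.\<close>

theorem bidual_series_representation:
  fixes T :: "'x::banach_lattice \<Rightarrow>\<^sub>L 'e::banach"
    and z :: "nat \<Rightarrow> 'e dual dual \<times> 'x dual"
  assumes ab: "0 \<le> a" "0 \<le> b" "a + b = 1"
    and AP: "approximation_property TYPE('e dual dual dual) \<or>
         positive_metric_approximation_property TYPE('x dual)"
    and T: "(\<lambda>j. rank_one (fst (z j)) (snd (z j))) sums blinfun_adjoint T"
    and adm: "\<And>k. admissible a b A (map z [0..<k])" and A: "0 < A" and \<epsilon>: "0 < \<epsilon>"
  obtains y :: "nat \<Rightarrow> 'e \<times> 'x dual"
  where "\<And>k. admissible a b (A + \<epsilon>) (map embed_pair (map y [0..<k]))"
    "(\<lambda>j. rank_one (snd (y j)) (fst (y j))) sums T"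
proof -
  define e where "e n = \<epsilon> * (1 / 2) ^ Suc n" for n
  define B where "B n = A + \<epsilon> * (1 - (1 / 2) ^ n)" for n
  have e: "0 < e n" for n using \<epsilon> by (simp add: e_def)
  have e_dec: "e (Suc n) \<le> e n" for n using \<epsilon> by (simp add: e_def)
  have B_Suc: "B n + e n = B (Suc n)" for n by (simp add: B_def e_def algebra_simps)
  have B_pos: "0 < B n" and B_le: "B n \<le> A + \<epsilon>" for n
    using A \<epsilon> by (auto simp: B_def power_le_one intro!: add_pos_nonneg mult_nonneg_nonneg mult_left_le)
  \<comment> \<open>A state consists of the terms already in E, the series still in the bidual, and
    the operator which that series represents.\<close>
  define inv where "inv n \<sigma> \<longleftrightarrow> (case \<sigma> of (pre, z', S) \<Rightarrow>
      (\<forall>k. admissible a b (B n) (map embed_pair pre @ map z' [0..<k])) \<and>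
      (\<lambda>j. rank_one (fst (z' j)) (snd (z' j))) sums blinfun_adjoint S \<and> T = op_tensor pre + S)"
    for n and \<sigma> :: "('e \<times> 'x dual) list \<times> (nat \<Rightarrow> 'e dual dual \<times> 'x dual) \<times> ('x \<Rightarrow>\<^sub>L 'e)"
  define rel where "rel n \<sigma> \<sigma>' \<longleftrightarrow> (\<exists>L. L \<noteq> [] \<and> fst \<sigma>' = fst \<sigma> @ L \<and> norm (snd (snd \<sigma>')) \<le> e n \<and>
      (\<forall>r. norm (op_tensor (take r L)) \<le> norm (snd (snd \<sigma>)) + 2 * e n))"
    for n and \<sigma> \<sigma>' :: "('e \<times> 'x dual) list \<times> (nat \<Rightarrow> 'e dual dual \<times> 'x dual) \<times> ('x \<Rightarrow>\<^sub>L 'e)"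
  have "\<exists>f. \<forall>n. inv n (f n) \<and> rel n (f n) (f (Suc n))"
  proof (rule dependent_nat_choice)
    show "\<exists>\<sigma>. inv 0 \<sigma>"
      by (rule exI[of _ "([], z, T)"]) (use adm T in \<open>simp add: inv_def B_def\<close>)
  next
    fix \<sigma> n assume "inv n \<sigma>"
    moreover obtain pre z' S where \<sigma>: "\<sigma> = (pre, z', S)" by (cases \<sigma>) auto
    ultimately have 1: "admissible a b (B n) (map embed_pair pre @ map z' [0..<k])"
      and 2: "(\<lambda>j. rank_one (fst (z' j)) (snd (z' j))) sums blinfun_adjoint S" and 3: "T = op_tensor pre + S" for k
      by (auto simp: inv_def)
    from split_off_step[OF ab AP 2 1 B_pos e[of n]] obtain L z'' S' where
      L: "L \<noteq> []" "\<forall>k. admissible a b (B n + e n) (map embed_pair pre @ map embed_pair L @ map z'' [0..<k])"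
        "(\<lambda>j. rank_one (fst (z'' j)) (snd (z'' j))) sums blinfun_adjoint S'" "S = op_tensor L + S'" "norm S' \<le> e n"
        "\<forall>r. norm (op_tensor (take r L)) \<le> norm S + 2 * e n"
      by (elim exE conjE) (rule that)
    have "inv (Suc n) (pre @ L, z'', S')"
      using L(2-4) 3 by (simp add: inv_def B_Suc add.assoc)
    moreover have "rel n \<sigma> (pre @ L, z'', S')" using L by (simp add: rel_def \<sigma>)
    ultimately show "\<exists>\<sigma>'. inv (Suc n) \<sigma>' \<and> rel n \<sigma> \<sigma>'" by blast
  qed
  then obtain f where f: "\<And>n. inv n (f n)" "\<And>n. rel n (f n) (f (Suc n))" by blast
  define p where "p n = fst (f n)" for n
  define S where "S n = snd (snd (f n))" for n
  have p_step: "\<exists>L. L \<noteq> [] \<and> p (Suc n) = p n @ L \<and> (\<forall>r. norm (op_tensor (take r L)) \<le> norm (S n) + 2 * e n)" for n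
    using f(2)[of n] by (auto simp: rel_def p_def S_def)
  have S_norm: "norm (S (Suc n)) \<le> e n" for n using f(2)[of n] by (auto simp: rel_def S_def)
  have T_eq: "T = op_tensor (p n) + S n" and p_adm: "admissible a b (A + \<epsilon>) (map embed_pair (p n))" for n
  proof -
    obtain z' where "f n = (p n, z', S n)" by (metis p_def S_def prod.collapse)
    with f(1)[of n] have "T = op_tensor (p n) + S n"
      and 1: "\<forall>k. admissible a b (B n) (map embed_pair (p n) @ map z' [0..<k])"
      unfolding inv_def by auto
    then show "T = op_tensor (p n) + S n" "admissible a b (A + \<epsilon>) (map embed_pair (p n))"
      using admissible_mono[OF admissible_appendD(1)[OF spec[OF 1, of 0]] B_le] by auto
  qed
  have "\<exists>L. L \<noteq> [] \<and> p (Suc n) = p n @ L" for n using p_step by blast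
  then obtain y where y: "\<And>k n. k \<le> length (p n) \<Longrightarrow> map y [0..<k] = take k (p n)"
    by (rule limit_of_prefixes) (rule that)
  have len: "n \<le> length (p n)" for n
  proof (induction n)
    case (Suc n)
    obtain L where "L \<noteq> []" "p (Suc n) = p n @ L" using p_step by blast
    with Suc show ?case by (cases L) auto
  qed simp
  show ?thesis
  proof (rule that[of y])
    fix k
    have "map embed_pair (map y [0..<k]) @ map embed_pair (drop k (p k)) = map embed_pair (p k)"
      using y[OF len] by (simp flip: map_append)
    then show "admissible a b (A + \<epsilon>) (map embed_pair (map y [0..<k]))"
      using p_adm[of k] admissible_appendD(1) by metis
  next
    have "(\<lambda>k. \<Sum>j<k. rank_one (snd (y j)) (fst (y j))) \<longlonglongrightarrow> T"
    proof (rule LIMSEQ_I)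
      fix r :: real assume r: "0 < r"
      have "(\<lambda>n. 4 * e n) \<longlonglongrightarrow> 4 * (\<epsilon> * 0)"
        unfolding e_def by (intro tendsto_intros LIMSEQ_Suc LIMSEQ_realpow_zero) auto
      then have "\<forall>\<^sub>F n in sequentially. 4 * e n < r" using r by (intro order_tendstoD(2)[of _ 0]) simp_all
      then obtain N where N: "4 * e n < r" if "n \<ge> N" for n by (auto simp: eventually_sequentially)
      show "\<exists>K. \<forall>k\<ge>K. norm ((\<Sum>j<k. rank_one (snd (y j)) (fst (y j))) - T) < r"
      proof (intro exI[of _ "length (p (Suc N))"] allI impI)
        fix k assume k: "k \<ge> length (p (Suc N))"
        define I where "I = {n. length (p n) \<le> k}"
        have "I \<subseteq> {..k}" using len by (auto simp: I_def intro: order_trans)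
        then have fin: "finite I" by (rule finite_subset) simp
        have N_in: "Suc N \<in> I" using k by (simp add: I_def)
        \<comment> \<open>The last block boundary that is not beyond \<open>k\<close>.\<close>
        define n where "n = Max I"
        have n_in: "n \<in> I" unfolding n_def using fin N_in by (intro Max_in) auto
        have n_ge: "Suc N \<le> n" unfolding n_def using fin N_in by (rule Max_ge)
        have "Suc n \<notin> I" using Max_ge[OF fin, of "Suc n"] by (auto simp: n_def)
        then have kn: "length (p n) \<le> k" "k \<le> length (p (Suc n))" using n_in by (auto simp: I_def)
        obtain L where L: "p (Suc n) = p n @ L" "\<And>r. norm (op_tensor (take r L)) \<le> norm (S n) + 2 * e n"
          using p_step by blast
        have "(\<Sum>j<k. rank_one (snd (y j)) (fst (y j))) = op_tensor (map y [0..<k])"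
          by (simp add: op_tensor_def o_def sum_list_upt atLeast0LessThan)
        also have "\<dots> = op_tensor (p n) + op_tensor (take (k - length (p n)) L)"
          using y[OF kn(2)] kn(1) by (simp add: L(1))
        finally have "(\<Sum>j<k. rank_one (snd (y j)) (fst (y j))) - T = op_tensor (take (k - length (p n)) L) - S n"
          using T_eq[of n] by simp
        then have "norm ((\<Sum>j<k. rank_one (snd (y j)) (fst (y j))) - T)
            \<le> norm (op_tensor (take (k - length (p n)) L)) + norm (S n)"
          by (simp add: norm_triangle_ineq4)
        also have "\<dots> \<le> 2 * norm (S n) + 2 * e n" using L(2)[of "k - length (p n)"] by simp
        \<comment> \<open>\<open>S n\<close> is bounded by the tolerance of the step before;
          \<open>n - 1\<close> is a true predecessor because \<open>n\<close> is at least
          \<open>Suc N\<close>.\<close>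
        also have "\<dots> \<le> 4 * e (n - 1)"
          using S_norm[of "n - 1"] e_dec[of "n - 1"] n_ge by simp
        also have "\<dots> < r" using n_ge by (intro N) simp
        finally show "norm ((\<Sum>j<k. rank_one (snd (y j)) (fst (y j))) - T) < r" .
      qed
    qed
    then show "(\<lambda>j. rank_one (snd (y j)) (fst (y j))) sums T" by (simp add: sums_def)
  qed
qed

section \<open>Costs and the norms of strongly and weakly summable sequences\<close>

definition inv_exponent :: "ereal \<Rightarrow> real" where
  "inv_exponent p = (if p = \<infinity> then 0 else 1 / real_of_ereal p)"

lemma exponent_cases:
  assumes "1 \<le> (p::ereal)"
  obtains "p = \<infinity>" | r where "p = ereal r" "1 \<le> r"
  using assms by (cases p) auto

lemma inv_exponent_bounds: "1 \<le> p \<Longrightarrow> 0 \<le> inv_exponent p \<and> inv_exponent p \<le> 1"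
  by (erule exponent_cases) (auto simp: inv_exponent_def)

lemma conj_exponent_props:
  assumes "1 \<le> p"
  shows "1 \<le> conj_exponent p" "inv_exponent (conj_exponent p) = 1 - inv_exponent p"
proof -
  have "1 \<le> conj_exponent p \<and> inv_exponent (conj_exponent p) = 1 - inv_exponent p"
    using assms
  proof (cases rule: exponent_cases)
    case 1
    then show ?thesis by (simp add: conj_exponent_def inv_exponent_def)
  next
    case (2 r)
    show ?thesis
    proof (cases "r = 1")
      case True
      then show ?thesis using 2 by (simp add: conj_exponent_def inv_exponent_def one_ereal_def)
    next
      case False
      with 2 have r: "1 < r" by simp
      have "conj_exponent p = ereal (r / (r - 1))"
        using 2 r by (simp add: conj_exponent_def one_ereal_def)
      then show ?thesis using 2 r by (simp add: inv_exponent_def one_ereal_def field_simps)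
    qed
  qed
  then show "1 \<le> conj_exponent p" "inv_exponent (conj_exponent p) = 1 - inv_exponent p" by auto
qed

lemma lp_norm_nonneg: "c \<in> lp_space p \<Longrightarrow> 0 \<le> lp_norm p c"
proof (cases "p = \<infinity>")
  case True
  assume "c \<in> lp_space p"
  then have "bdd_above (range (\<lambda>n. norm (c n)))" using True by (auto simp: lp_space_def bounded_iff bdd_above_def)
  then have "norm (c 0) \<le> (SUP n. norm (c n))" by (rule cSUP_upper[rotated]) simp
  then show ?thesis using True norm_ge_zero[of "c 0"] by (simp add: lp_norm_def del: norm_ge_zero)
qed (simp add: lp_norm_def)

lemma lp_comparison:
  fixes c :: "nat \<Rightarrow> 'a::real_normed_vector" and d :: "nat \<Rightarrow> 'b::real_normed_vector"
  assumes p: "1 \<le> p" and d: "d \<in> lp_space p" and s: "0 < s" and le: "\<And>j. norm (c j) \<le> s * norm (d j)"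
  shows "c \<in> lp_space p \<and> lp_norm p c \<le> s * lp_norm p d"
  using p
proof (cases rule: exponent_cases)
  case 1
  then have bdd: "bdd_above (range (\<lambda>n. norm (d n)))" using d by (auto simp: lp_space_def bounded_iff bdd_above_def)
  have *: "norm (c j) \<le> s * (SUP n. norm (d n))" for j
    using order_trans[OF le mult_left_mono[OF cSUP_upper[OF _ bdd] less_imp_le[OF s]]] by auto
  then show ?thesis using 1 by (auto simp: lp_space_def lp_norm_def bounded_iff intro!: cSUP_least)
next
  case (2 r)
  have le': "norm (c j) powr r \<le> s powr r * norm (d j) powr r" for j
    using powr_mono2[OF _ norm_ge_zero le, of r j] 2 s by (simp add: powr_mult)
  have sd: "summable (\<lambda>j. norm (d j) powr r)" using d 2 by (simp add: lp_space_def)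
  then have sd': "summable (\<lambda>j. s powr r * norm (d j) powr r)" by (rule summable_mult)
  then have sc: "summable (\<lambda>j. norm (c j) powr r)"
    by (rule summable_comparison_test'[where N = 0]) (use le' in simp)
  have "(\<Sum>j. norm (c j) powr r) \<le> s powr r * (\<Sum>j. norm (d j) powr r)"
    using suminf_le[OF le' sc sd'] suminf_mult[OF sd, of "s powr r"] by simp
  then have "(\<Sum>j. norm (c j) powr r) powr (1 / r) \<le> (s powr r * (\<Sum>j. norm (d j) powr r)) powr (1 / r)"
    using 2 by (intro powr_mono2 suminf_nonneg sc) auto
  also have "\<dots> = s * (\<Sum>j. norm (d j) powr r) powr (1 / r)"
    using 2 s by (simp add: powr_mult suminf_nonneg sd powr_powr)
  finally show ?thesis using 2 sc by (simp add: lp_space_def lp_norm_def)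
qed

text \<open>For exponent infinity the bound \<open>A powr 0\<close> equals 1 because
  \<open>A\<close> is positive, and this is the condition for zero cost.\<close>

lemma pcost_sum_le_of_lp_norm:
  assumes p: "1 \<le> p" and c: "c \<in> lp_space p" "lp_norm p c \<le> A powr inv_exponent p" and A: "0 < A"
  shows "(\<Sum>j<k. pcost (inv_exponent p) (norm (c j))) \<le> ennreal A"
  using p
proof (cases rule: exponent_cases)
  case 1
  then have bdd: "bdd_above (range (\<lambda>n. norm (c n)))" using c by (auto simp: lp_space_def bounded_iff bdd_above_def)
  have "norm (c j) \<le> 1" for j
    using cSUP_upper[OF _ bdd, of j] c(2) 1 A by (auto simp: lp_norm_def inv_exponent_def)
  then show ?thesis using 1 by (simp add: pcost_def inv_exponent_def)
next
  case (2 r)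
  have sc: "summable (\<lambda>j. norm (c j) powr r)" using c 2 by (simp add: lp_space_def)
  have "(\<Sum>j<k. norm (c j) powr r) \<le> (\<Sum>j. norm (c j) powr r)" by (intro sum_le_suminf sc) auto
  also have "\<dots> = ((\<Sum>j. norm (c j) powr r) powr (1 / r)) powr r"
    using 2 by (simp add: powr_powr suminf_nonneg sc)
  also have "\<dots> \<le> (A powr (1 / r)) powr r"
  proof (rule powr_mono2)
    show "(\<Sum>j. norm (c j) powr r) powr (1 / r) \<le> A powr (1 / r)"
      using c(2) 2 by (simp add: lp_norm_def inv_exponent_def)
  qed (use 2 in auto)
  also have "\<dots> = A" using 2 A by (simp add: powr_powr)
  finally have "ennreal (\<Sum>j<k. norm (c j) powr r) \<le> ennreal A" by (rule ennreal_leI)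
  then show ?thesis using 2 by (simp add: pcost_def inv_exponent_def)
qed

lemma lp_norm_le_of_pcost_sum:
  assumes p: "1 \<le> p" and c: "\<And>k. (\<Sum>j<k. pcost (inv_exponent p) (norm (c j))) \<le> ennreal A" and A: "0 < A"
  shows "c \<in> lp_space p \<and> lp_norm p c \<le> A powr inv_exponent p"
  using p
proof (cases rule: exponent_cases)
  case 1
  have *: "norm (c j) \<le> 1" for j
  proof (rule ccontr)
    assume "\<not> norm (c j) \<le> 1"
    then have "pcost (inv_exponent p) (norm (c j)) = \<infinity>" using 1 by (simp add: pcost_def inv_exponent_def)
    moreover have "pcost (inv_exponent p) (norm (c j)) \<le> (\<Sum>i<Suc j. pcost (inv_exponent p) (norm (c i)))" by simp
    moreover note c[of "Suc j"]
    ultimately have "\<infinity> \<le> ennreal A" by (metis order_trans)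
    then show False by (simp add: top_unique)
  qed
  then have "(SUP n. norm (c n)) \<le> 1" by (intro cSUP_least) auto
  with * show ?thesis using 1 A by (auto simp: lp_space_def lp_norm_def bounded_iff inv_exponent_def)
next
  case (2 r)
  have "(\<Sum>j<k. norm (c j) powr r) \<le> A" for k
  proof -
    have "(\<Sum>j<k. pcost (inv_exponent p) (norm (c j))) = ennreal (\<Sum>j<k. norm (c j) powr r)"
      using 2 by (simp add: pcost_def inv_exponent_def)
    then show ?thesis using c[of k] A by simp
  qed
  note le = this
  have sc: "summable (\<lambda>j. norm (c j) powr r)" by (rule summableI_nonneg_bounded[OF _ le]) simp
  have "(\<Sum>j. norm (c j) powr r) \<le> A" by (rule suminf_le_const[OF sc le])
  then have "(\<Sum>j. norm (c j) powr r) powr (1 / r) \<le> A powr (1 / r)"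
    using 2 by (intro powr_mono2 suminf_nonneg sc) auto
  then show ?thesis using 2 sc by (simp add: lp_space_def lp_norm_def inv_exponent_def)
qed

text \<open>
  For positive terms the uniform boundedness of the evaluations is elementary: functionals
  \<open>F\<^sub>n\<close> with large values would be dominated by multiples of the single functional \<open>\<Sum>\<^sub>n 2\<^sup>-\<^sup>n \<bar>F\<^sub>n\<bar>\<close>.
\<close>

lemma weak_lp_bdd_above:
  fixes x :: "nat \<Rightarrow> 'y::banach_lattice"
  assumes q: "1 \<le> q" and x: "x \<in> weak_lp_space q" "\<And>j. 0 \<le> x j"
  shows "bdd_above ((\<lambda>F. lp_norm q (\<lambda>j. blinfun_apply F (x j))) ` cball (0 :: 'y dual) 1)"
proof (rule ccontr)
  assume "\<not> ?thesis"
  then have *: "\<forall>M. \<exists>F\<in>cball (0 :: 'y dual) 1. M < lp_norm q (\<lambda>j. blinfun_apply F (x j))"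
    by (auto simp: bdd_above_def not_le)
  \<comment> \<open>The growth \<open>4 ^ n\<close> beats the factor \<open>2 ^ n\<close> lost when
    the n-th functional is dominated by a multiple of the single functional
    \<open>G\<close>.\<close>
  have "\<exists>F :: 'y dual. norm F \<le> 1 \<and> 4 ^ n < lp_norm q (\<lambda>j. blinfun_apply F (x j))" for n :: nat
    using spec[OF *, of "4 ^ n"] by auto
  then have "\<exists>F. \<forall>n. norm (F n :: 'y dual) \<le> 1 \<and> 4 ^ n < lp_norm q (\<lambda>j. blinfun_apply (F n) (x j))"
    by (intro choice allI)
  then obtain F :: "nat \<Rightarrow> 'y dual" where F: "\<And>n. norm (F n) \<le> 1" "\<And>n. 4 ^ n < lp_norm q (\<lambda>j. blinfun_apply (F n)
      (x j))" by blast
  have "\<exists>M :: 'y dual. (\<forall>y\<ge>0. \<bar>F n y\<bar> \<le> blinfun_apply M y) \<and> norm M \<le> norm (F n)" for n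
    using modulus_functional[of "F n"] by blast
  then have "\<exists>M. \<forall>n. (\<forall>y\<ge>0. \<bar>F n y\<bar> \<le> blinfun_apply (M n) y) \<and> norm (M n :: 'y dual) \<le> norm (F n)"
    by (intro choice allI)
  then obtain M :: "nat \<Rightarrow> 'y dual" where M: "\<And>n y. 0 \<le> y \<Longrightarrow> \<bar>F n y\<bar> \<le> M n y" "\<And>n. norm (M n) \<le> 1"
    using F(1) by (meson order_trans)
  let ?t = "\<lambda>n. (1 / 2) ^ n *\<^sub>R M n"
  have "summable (\<lambda>n. norm (?t n))"
    by (rule summable_comparison_test'[OF summable_geometric[of "1 / 2 :: real"], of 0])
      (use M(2) in \<open>auto intro: mult_left_le\<close>)
  then have "summable ?t" by (rule summable_norm_cancel)
  define G where "G = suminf ?t"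
  have G_sums: "(\<lambda>n. (1 / 2) ^ n * M n y) sums G y" for y
    using bounded_linear.sums[OF blinfun.bounded_linear_left summable_sums[OF \<open>summable ?t\<close>], of y]
    by (simp add: G_def blinfun.scaleR_left)
  have F_le: "norm (F n (x j)) \<le> 2 ^ n * norm (G (x j))" for n j
  proof -
    have Mx: "0 \<le> M n (x j)" for n using M(1)[OF x(2), of n j] by linarith
    have "(\<Sum>i\<in>{n}. (1 / 2) ^ i * M i (x j)) \<le> G (x j)"
      using G_sums[of "x j"] Mx by (subst sums_unique[OF G_sums]) (intro sum_le_suminf; auto simp: sums_iff)
    then have "M n (x j) \<le> 2 ^ n * G (x j)" by (simp add: field_simps power_divide)
    also have "\<dots> \<le> 2 ^ n * norm (G (x j))" by (intro mult_left_mono) auto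
    finally show ?thesis using M(1)[OF x(2), of n j] by simp
  qed
  have Gx: "(\<lambda>j. G (x j)) \<in> lp_space q" using x(1) by (simp add: weak_lp_space_def)
  obtain n :: nat where n: "lp_norm q (\<lambda>j. G (x j)) < 2 ^ n" using real_arch_pow[of 2 "lp_norm q (\<lambda>j. G (x j))"]
      by auto
  have "(4::real) ^ n < lp_norm q (\<lambda>j. F n (x j))" by (rule F(2))
  also have "\<dots> \<le> 2 ^ n * lp_norm q (\<lambda>j. G (x j))" using lp_comparison[OF q Gx, of "2 ^ n" "\<lambda>j. F n (x j)"] F_le
      by simp
  also have "\<dots> \<le> 2 ^ n * 2 ^ n" using n by (intro mult_left_mono) auto
  also have "\<dots> = 4 ^ n" by (simp flip: power_mult_distrib)
  finally show False by simp
qed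

lemma weak_lp_norm_upper:
  fixes x :: "nat \<Rightarrow> 'y::banach_lattice" and F :: "'y dual"
  assumes "1 \<le> q" "x \<in> weak_lp_space q" "\<And>j. 0 \<le> x j" "norm F \<le> 1"
  shows "lp_norm q (\<lambda>j. blinfun_apply F (x j)) \<le> weak_lp_norm q x"
  unfolding weak_lp_norm_def
  by (rule cSUP_upper[where f = "\<lambda>F. lp_norm q (\<lambda>j. blinfun_apply F (x j))", OF _ weak_lp_bdd_above[OF assms(1-3)]])
    (use assms(4) in simp)

lemma weak_lp_norm_nonneg:
  fixes x :: "nat \<Rightarrow> 'y::banach_lattice"
  assumes "1 \<le> q" "x \<in> weak_lp_space q" "\<And>j. 0 \<le> x j"
  shows "0 \<le> weak_lp_norm q x"
proof -
  have "(\<lambda>j. blinfun_apply (0 :: 'y dual) (x j)) \<in> lp_space q"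
    using assms(2) unfolding weak_lp_space_def by blast
  from lp_norm_nonneg[OF this] weak_lp_norm_upper[OF assms, of 0] show ?thesis by simp
qed

lemma weak_lp_space_of_pcost_sum:
  fixes x :: "nat \<Rightarrow> 'y::banach_lattice"
  assumes q: "1 \<le> q" and A: "0 < A"
    and c: "\<And>F k. norm F \<le> 1 \<Longrightarrow> (\<Sum>j<k. pcost (inv_exponent q) (blinfun_apply F (x j))) \<le> ennreal A"
  shows "x \<in> weak_lp_space q \<and> weak_lp_norm q x \<le> A powr inv_exponent q"
proof -
  have F: "(\<lambda>j. F (x j)) \<in> lp_space q \<and> lp_norm q (\<lambda>j. F (x j)) \<le> A powr inv_exponent q"
    if "norm F \<le> 1" for F :: "'y dual"
    using lp_norm_le_of_pcost_sum[OF q _ A, of "\<lambda>j. F (x j)"] c[OF that] by simp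
  have "(\<lambda>j. F (x j)) \<in> lp_space q" for F :: "'y dual"
  proof -
    have "norm (F /\<^sub>R (1 + norm F)) \<le> 1"
      using norm_ge_zero[of F] by (simp add: divide_inverse_commute[symmetric] divide_le_eq_1 del: norm_ge_zero)
    from conjunct1[OF F[OF this]] have "(\<lambda>j. (F /\<^sub>R (1 + norm F)) (x j)) \<in> lp_space q" .
    moreover have "norm (F (x j)) \<le> (1 + norm F) * norm ((F /\<^sub>R (1 + norm F)) (x j))" for j
    proof -
      have "1 + norm F \<noteq> 0" using norm_ge_zero[of F] by linarith
      then show ?thesis by (simp add: blinfun.scaleR_left abs_mult mult.assoc[symmetric])
    qed
    ultimately show ?thesis using lp_comparison[OF q, of _ "1 + norm F"]
        by (metis add_pos_nonneg norm_ge_zero zero_less_one)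
  qed
  moreover have "weak_lp_norm q x \<le> A powr inv_exponent q"
    unfolding weak_lp_norm_def using F by (intro cSUP_least) auto
  ultimately show ?thesis by (simp add: weak_lp_space_def)
qed

section \<open>Positively nuclear operators and their adjoints\<close>

lemma positively_nuclear_norm_le:
  fixes T :: "'x::banach_lattice \<Rightarrow>\<^sub>L 'e::banach"
  assumes p: "1 \<le> p" and R: "(x, u) \<in> positively_nuclear_reps p T"
  shows "positively_nuclear_norm p T \<le> weak_lp_norm (conj_exponent p) x * lp_norm p u"
proof -
  have "bdd_below ((\<lambda>(x, u). weak_lp_norm (conj_exponent p) x * lp_norm p u) ` positively_nuclear_reps p T)"
    by (rule bdd_belowI[of _ 0])
      (auto simp: positively_nuclear_reps_def intro!: mult_nonneg_nonneg weak_lp_norm_nonneg lp_norm_nonneg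
          conj_exponent_props p)
  from cINF_lower[OF this R] show ?thesis by (simp add: positively_nuclear_norm_def)
qed

lemma latticially_nuclear_norm_le:
  fixes S :: "'e::banach \<Rightarrow>\<^sub>L 'y::banach_lattice"
  assumes p: "1 \<le> p" and R: "(u, x) \<in> latticially_nuclear_reps p S"
  shows "latticially_nuclear_norm p S \<le> lp_norm p u * weak_lp_norm (conj_exponent p) x"
proof -
  have "bdd_below ((\<lambda>(u, x). lp_norm p u * weak_lp_norm (conj_exponent p) x) ` latticially_nuclear_reps p S)"
    by (rule bdd_belowI[of _ 0])
      (auto simp: latticially_nuclear_reps_def intro!: mult_nonneg_nonneg weak_lp_norm_nonneg lp_norm_nonneg
          conj_exponent_props p)
  from cINF_lower[OF this R] show ?thesis by (simp add: latticially_nuclear_norm_def)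
qed

text \<open>The easy inequality: adjoints are taken term by term, and the embedding into the bidual
  is isometric.\<close>

lemma latticially_nuclear_reps_adjoint:
  assumes "(x, u) \<in> positively_nuclear_reps p T"
  shows "(\<lambda>j. bidual_embedding (u j), x) \<in> latticially_nuclear_reps p (blinfun_adjoint T)"
    "lp_norm p (\<lambda>j. bidual_embedding (u j)) = lp_norm p u"
proof -
  have "(\<lambda>j. blinfun_adjoint (rank_one (x j) (u j))) sums blinfun_adjoint T"
    using assms by (intro bounded_linear.sums[OF bounded_linear_blinfun_adjoint]) (simp add:
        positively_nuclear_reps_def)
  then show "(\<lambda>j. bidual_embedding (u j), x) \<in> latticially_nuclear_reps p (blinfun_adjoint T)"
    using assms by (auto simp: positively_nuclear_reps_def latticially_nuclear_reps_def blinfun_adjoint_rank_one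
        lp_space_def bounded_iff)
qed (simp add: lp_norm_def)

text \<open>The representation is balanced by a scalar, moved into E by
  \<open>bidual_series_representation\<close>, and read back; the two balanced bounds multiply to
  \<open>A + \<delta>\<close>.\<close>

lemma positively_nuclear_reps_of_adjoint:
  fixes T :: "'x::banach_lattice \<Rightarrow>\<^sub>L 'e::banach"
  assumes p: "1 \<le> p"
    and AP: "approximation_property TYPE('e dual dual dual) \<or>
         positive_metric_approximation_property TYPE('x dual)"
    and R: "(u, x) \<in> latticially_nuclear_reps p (blinfun_adjoint T)" and \<delta>: "0 < \<delta>"
  shows "\<exists>(y, v) \<in> positively_nuclear_reps p T. weak_lp_norm (conj_exponent p) y * lp_norm p v \<le>
    (lp_norm p u + \<delta>) * (weak_lp_norm (conj_exponent p) x + \<delta>) + \<delta>"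
proof -
  define a b where "a = inv_exponent p" and "b = inv_exponent (conj_exponent p)"
  let ?q = "conj_exponent p"
  note q = conj_exponent_props(1)[OF p]
  have ab: "0 \<le> a" "0 \<le> b" "a + b = 1"
    using inv_exponent_bounds[OF p] conj_exponent_props(2)[OF p] by (auto simp: a_def b_def)
  have u: "u \<in> lp_space p" and x: "x \<in> weak_lp_space ?q" "\<And>j. 0 \<le> x j"
    and T: "(\<lambda>j. rank_one (u j) (x j)) sums blinfun_adjoint T"
    using R by (auto simp: latticially_nuclear_reps_def)
  \<comment> \<open>The added \<open>\<delta>\<close> makes both factors positive, so that they can
    be balanced even if one of the norms is 0.\<close>
  let ?M = "lp_norm p u + \<delta>" and ?W = "weak_lp_norm ?q x + \<delta>"
  define A where "A = ?M * ?W"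
  have M: "0 < ?M" using lp_norm_nonneg[OF u] \<delta> by simp
  have W: "0 < ?W" using weak_lp_norm_nonneg[OF q x] \<delta> by simp
  have A: "0 < A" using M W by (simp add: A_def)
  \<comment> \<open>Balances the two factors: \<open>s * ?M\<close> equals \<open>A powr a\<close>,
    and \<open>?W / s\<close> equals \<open>A powr b\<close> by a + b = 1.\<close>
  define s where "s = A powr a / ?M"
  have s: "0 < s" using A M by (simp add: s_def)
  define z where "z j = (s *\<^sub>R u j, (1 / s) *\<^sub>R x j)" for j
  have "rank_one (fst (z j)) (snd (z j)) = rank_one (u j) (x j)" for j
    using s by (simp add: z_def rank_one_scaleR)
  then have Tz: "(\<lambda>j. rank_one (fst (z j)) (snd (z j))) sums blinfun_adjoint T" using T by simp
  have "seq_admissible a b A (\<lambda>j. s *\<^sub>R u j) (\<lambda>j. (1 / s) *\<^sub>R x j)"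
    unfolding seq_admissible_iff
  proof (intro conjI allI impI)
    show "0 \<le> (1 / s) *\<^sub>R x j" for j using s x(2) by (simp add: scaleR_nonneg_nonneg)
    have "(\<lambda>j. s *\<^sub>R u j) \<in> lp_space p \<and> lp_norm p (\<lambda>j. s *\<^sub>R u j) \<le> s * lp_norm p u"
      using s by (intro lp_comparison[OF p u]) auto
    moreover have "s * lp_norm p u \<le> s * ?M" using s \<delta> by (intro mult_left_mono) auto
    moreover have "s * ?M = A powr a" using M by (simp add: s_def)
    ultimately show "(\<Sum>j<k. pcost a (norm (s *\<^sub>R u j))) \<le> ennreal A" for k
      unfolding a_def by (intro pcost_sum_le_of_lp_norm[OF p _ _ A]) auto
  next
    fix F :: "'x dual dual" and k assume F: "norm F \<le> 1"
    have Fx: "(\<lambda>j. F (x j)) \<in> lp_space ?q" using x(1) by (simp add: weak_lp_space_def)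
    have "(\<lambda>j. F ((1 / s) *\<^sub>R x j)) \<in> lp_space ?q \<and> lp_norm ?q (\<lambda>j. F ((1 / s) *\<^sub>R x j))
        \<le> (1 / s) * lp_norm ?q (\<lambda>j. F (x j))"
      using s by (intro lp_comparison[OF q Fx]) (auto simp: blinfun.scaleR_right)
    moreover have "(1 / s) * lp_norm ?q (\<lambda>j. F (x j)) \<le> (1 / s) * ?W"
      using s \<delta> weak_lp_norm_upper[OF q x F] by (intro mult_left_mono) auto
    moreover have "(1 / s) * ?W = A powr b"
    proof -
      have "A powr a * A powr b = A" using A ab by (simp flip: powr_add)
      then have "A powr b = A / A powr a" using A by (simp add: field_simps)
      also have "\<dots> = (1 / s) * ?W" using M by (simp add: s_def A_def)
      finally show ?thesis by simp
    qed
    ultimately have "(\<Sum>j<k. pcost b (norm (F ((1 / s) *\<^sub>R x j)))) \<le> ennreal A"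
      unfolding b_def by (intro pcost_sum_le_of_lp_norm[OF q _ _ A]) auto
    then show "(\<Sum>j<k. pcost b (F ((1 / s) *\<^sub>R x j))) \<le> ennreal A" by simp
  qed
  then have "admissible a b A (map z [0..<k])" for k by (simp add: seq_admissible_def z_def[abs_def])
  then obtain y where y: "\<And>k. admissible a b (A + \<delta>) (map embed_pair (map y [0..<k]))"
    "(\<lambda>j. rank_one (snd (y j)) (fst (y j))) sums T"
    by (rule bidual_series_representation[OF ab AP Tz _ A \<delta>]) (rule that)
  have A\<delta>: "0 < A + \<delta>" using A \<delta> by simp
  have "seq_admissible a b (A + \<delta>) (\<lambda>j. bidual_embedding (fst (y j))) (\<lambda>j. snd (y j))"
    using y(1) by (simp add: seq_admissible_def embed_pair_def o_def)
  then have y': "\<And>j. 0 \<le> snd (y j)" "\<And>k. (\<Sum>j<k. pcost a (norm (fst (y j)))) \<le> ennreal (A + \<delta>)"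
    "\<And>F k. norm F \<le> 1 \<Longrightarrow> (\<Sum>j<k. pcost b (blinfun_apply F (snd (y j)))) \<le> ennreal (A + \<delta>)"
    by (auto simp: seq_admissible_iff)
  have 1: "(\<lambda>j. fst (y j)) \<in> lp_space p \<and> lp_norm p (\<lambda>j. fst (y j)) \<le> (A + \<delta>) powr a"
    unfolding a_def using y'(2) by (intro lp_norm_le_of_pcost_sum[OF p _ A\<delta>]) (simp add: a_def)
  have 2: "(\<lambda>j. snd (y j)) \<in> weak_lp_space ?q \<and> weak_lp_norm ?q (\<lambda>j. snd (y j)) \<le> (A + \<delta>) powr b"
    unfolding b_def using y'(3) by (intro weak_lp_space_of_pcost_sum[OF q A\<delta>]) (simp add: b_def)
  have "weak_lp_norm ?q (\<lambda>j. snd (y j)) * lp_norm p (\<lambda>j. fst (y j)) \<le> (A + \<delta>) powr b * (A + \<delta>) powr a"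
    using 1 2 by (intro mult_mono) (auto intro: lp_norm_nonneg)
  also have "\<dots> = A + \<delta>" using A\<delta> ab by (simp add: add.commute flip: powr_add)
  finally have "weak_lp_norm ?q (\<lambda>j. snd (y j)) * lp_norm p (\<lambda>j. fst (y j)) \<le> A + \<delta>" .
  moreover have "(\<lambda>j. snd (y j), \<lambda>j. fst (y j)) \<in> positively_nuclear_reps p T"
    using 1 2 y'(1) y(2) by (simp add: positively_nuclear_reps_def)
  ultimately show ?thesis by (intro bexI[of _ "(\<lambda>j. snd (y j), \<lambda>j. fst (y j))"]) (auto simp: A_def)
qed

theorem corollary2p13:
  fixes p :: ereal
    and T :: "'x::banach_lattice \<Rightarrow>\<^sub>L 'e::banach"
  assumes "1 \<le> p"
    and "approximation_property TYPE((('e \<Rightarrow>\<^sub>L real) \<Rightarrow>\<^sub>L real) \<Rightarrow>\<^sub>L real) \<or>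
         positive_metric_approximation_property TYPE('x \<Rightarrow>\<^sub>L real)"
    and "latticially_nuclear p (blinfun_adjoint T)"
  shows "positively_nuclear p T \<and>
         positively_nuclear_norm p T = latticially_nuclear_norm p (blinfun_adjoint T)"
proof
  note step = positively_nuclear_reps_of_adjoint[OF assms(1,2)]
  let ?L = "latticially_nuclear_reps p (blinfun_adjoint T)" and ?P = "positively_nuclear_reps p T"
  obtain u0 x0 where R0: "(u0, x0) \<in> ?L" using assms(3) by (auto simp: latticially_nuclear_def)
  from step[OF this, of 1] have ne: "?P \<noteq> {}" by auto
  then show "positively_nuclear p T" by (simp add: positively_nuclear_def)
  show "positively_nuclear_norm p T = latticially_nuclear_norm p (blinfun_adjoint T)"
  proof (rule antisym)
    show "positively_nuclear_norm p T \<le> latticially_nuclear_norm p (blinfun_adjoint T)"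
      unfolding latticially_nuclear_norm_def
    proof (rule cINF_greatest)
      show "?L \<noteq> {}" using R0 by auto
      fix R assume "R \<in> ?L"
      moreover obtain u x where R_eq: "R = (u, x)" by (cases R) auto
      ultimately have R: "(u, x) \<in> ?L" by simp
      let ?m = "lp_norm p u" and ?w = "weak_lp_norm (conj_exponent p) x"
      \<comment> \<open>The slack stems from making both norms positive and from the increase of the
        cost; it disappears as \<open>\<delta>\<close> tends to 0.\<close>
      have *: "positively_nuclear_norm p T \<le> (?m + \<delta>) * (?w + \<delta>) + \<delta>" if "0 < \<delta>" for \<delta>
        using step[OF R that] positively_nuclear_norm_le[OF assms(1), of _ _ T] by (force intro: order_trans)
      have "((\<lambda>\<delta>. (?m + \<delta>) * (?w + \<delta>) + \<delta>) \<longlongrightarrow> (?m + 0) * (?w + 0) + 0) (at_right 0)"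
        by (intro tendsto_intros)
      then have "positively_nuclear_norm p T \<le> (?m + 0) * (?w + 0) + 0"
      proof (rule tendsto_lowerbound)
        show "\<forall>\<^sub>F \<delta> in at_right 0. positively_nuclear_norm p T \<le> (?m + \<delta>) * (?w + \<delta>) + \<delta>"
          unfolding eventually_at_filter by (rule always_eventually) (use * in auto)
      qed simp
      then show "positively_nuclear_norm p T \<le> (case R of (u, x) \<Rightarrow> lp_norm p u * weak_lp_norm (conj_exponent p) x)"
        by (simp add: R_eq)
    qed
    show "latticially_nuclear_norm p (blinfun_adjoint T) \<le> positively_nuclear_norm p T"
      unfolding positively_nuclear_norm_def
    proof (rule cINF_greatest[OF ne])
      fix R assume "R \<in> ?P"
      moreover obtain x u where R_eq: "R = (x, u)" by (cases R) auto
      ultimately have R: "(x, u) \<in> ?P" by simp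
      show "latticially_nuclear_norm p (blinfun_adjoint T) \<le> (case R of (x, u) \<Rightarrow> weak_lp_norm (conj_exponent p) x * lp_norm p u)"
        using latticially_nuclear_norm_le[OF assms(1) latticially_nuclear_reps_adjoint(1)[OF R]]
        by (simp add: R_eq latticially_nuclear_reps_adjoint(2)[OF R] mult.commute)
    qed
  qed
qed

end
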